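(* Let $\alpha_1,\alpha_2,\vartheta\in\mathbb{R}\setminus\{0\}$ and let $\chi:\mathbb{R}\to\mathbb{R}$ be smooth with $\chi(X)^2\to1$ as $|X|\to\infty$ sufficiently rapidly (so that $\chi^2-1\in L^1(\mathbb{R})$). Assume further that $$\int_{\mathbb{R}}(\chi(X)^2-1)\,dX<0.$$ Then the operator $\mathfrak{S}(0)=-\alpha_2P_X^2\sigma_2+\vartheta\chi(X)\sigma_3$ acting in $L^2(\mathbb{R};\mathbb{C}^2)$ has at least two nonzero eigenvalues $\Omega_+>0$ and $\Omega_-=-\Omega_+$ within its spectral gap $(-|\vartheta|,|\vartheta|)$.
   Context: $P_X=-i\partial_X$, $\sigma_2=\begin{bmatrix}0&-i\\i&0\end{bmatrix}$, $\sigma_3=\begin{bmatrix}1&0\\0&-1\end{bmatrix}$. $\mathfrak{S}(0)$ is self-adjoint with domain $H^2(\mathbb{R};\mathbb{C}^2)$; the gap in its essential spectrum is $(-|\vartheta|,|\vartheta|)$. It is the value at $\kappa=0$ (with $\alpha_0=1$) of the family $\mathfrak{S}(\kappa)=(1-\alpha_0)(P_X^2+\kappa^2)I+2\alpha_1\kappa P_X\sigma_1-\alpha_2(P_X^2-\kappa^2)\sigma_2+\vartheta\chi(X)\sigma_3$, with $\sigma_1=\begin{bmatrix}0&1\\1&0\end{bmatrix}$. *)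

theory Defs
  imports "HOL-Analysis.Analysis"
begin

definition smooth :: "(real \<Rightarrow> real) \<Rightarrow> bool" where
  "smooth f \<longleftrightarrow> (\<forall>n x. (deriv ^^ n) f differentiable (at x))"

definition test_function :: "(real \<Rightarrow> real) \<Rightarrow> bool" where
  "test_function \<phi> \<longleftrightarrow> smooth \<phi> \<and> compact (closure {x. \<phi> x \<noteq> 0})"

text \<open>
  Elements of \<open>L\<^sup>2(\<real>; \<complex>\<^sup>2)\<close> and of the Sobolev spaces are represented by functions;
  equality of elements is equality almost everywhere. The norm of \<^typ>\<open>complex ^ 2\<close> is the
  Hermitian one.
\<close>

definition L2 :: "(real \<Rightarrow> complex ^ 2) set" where
  "L2 = {f. f \<in> borel_measurable lborel \<and> integrable lborel (\<lambda>x. (norm (f x))\<^sup>2)}"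

definition locally_integrable :: "(real \<Rightarrow> complex ^ 2) \<Rightarrow> bool" where
  "locally_integrable f \<longleftrightarrow> (\<forall>a b. set_integrable lborel {a..b} f)"

definition has_weak_deriv :: "(real \<Rightarrow> complex ^ 2) \<Rightarrow> (real \<Rightarrow> complex ^ 2) \<Rightarrow> bool" where
  "has_weak_deriv f g \<longleftrightarrow> locally_integrable f \<and> locally_integrable g \<and>
     (\<forall>\<phi>. test_function \<phi> \<longrightarrow>
        (LINT x|lborel. deriv \<phi> x *\<^sub>R f x) = - (LINT x|lborel. \<phi> x *\<^sub>R g x))"

text \<open>
  The weak derivative is unique up to null sets, so the choice of representative below is
  immaterial. On functions without a weak derivative the value is unspecified.
\<close>

definition weak_deriv :: "(real \<Rightarrow> complex ^ 2) \<Rightarrow> real \<Rightarrow> complex ^ 2" where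
  "weak_deriv f = (SOME g. has_weak_deriv f g)"

text \<open>The Sobolev space \<open>H\<^sup>k(\<real>; \<complex>\<^sup>2)\<close>.\<close>

primrec sobolev :: "nat \<Rightarrow> (real \<Rightarrow> complex ^ 2) set" where
  "sobolev 0 = L2"
| "sobolev (Suc k) = {f \<in> L2. \<exists>g \<in> sobolev k. has_weak_deriv f g}"

definition P_X :: "(real \<Rightarrow> complex ^ 2) \<Rightarrow> real \<Rightarrow> complex ^ 2" where
  "P_X f = (\<lambda>X. (- \<i>) *s weak_deriv f X)"

definition \<sigma>1 :: "complex ^ 2 ^ 2" where
  "\<sigma>1 = vector [vector [0, 1], vector [1, 0]]"

definition \<sigma>2 :: "complex ^ 2 ^ 2" where
  "\<sigma>2 = vector [vector [0, - \<i>], vector [\<i>, 0]]"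

definition \<sigma>3 :: "complex ^ 2 ^ 2" where
  "\<sigma>3 = vector [vector [1, 0], vector [0, - 1]]"

text \<open>
  The family \<open>\<SS>(\<kappa>)\<close>, as an action on (representatives of) elements of \<open>H\<^sup>2(\<real>; \<complex>\<^sup>2)\<close>; the
  constant matrices commute with \<^const>\<open>P_X\<close>.
\<close>

definition \<SS> :: "real \<Rightarrow> real \<Rightarrow> real \<Rightarrow> real \<Rightarrow> (real \<Rightarrow> real) \<Rightarrow> real \<Rightarrow>
    (real \<Rightarrow> complex ^ 2) \<Rightarrow> real \<Rightarrow> complex ^ 2" where
  "\<SS> \<alpha>0 \<alpha>1 \<alpha>2 \<theta> chi \<kappa> \<psi> = (\<lambda>X.
       complex_of_real (1 - \<alpha>0) *s (P_X (P_X \<psi>) X + complex_of_real (\<kappa>\<^sup>2) *s \<psi> X)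
     + complex_of_real (2 * \<alpha>1 * \<kappa>) *s (\<sigma>1 *v P_X \<psi> X)
     - complex_of_real \<alpha>2 *s (\<sigma>2 *v (P_X (P_X \<psi>) X - complex_of_real (\<kappa>\<^sup>2) *s \<psi> X))
     + complex_of_real (\<theta> * chi X) *s (\<sigma>3 *v \<psi> X))"

lemma \<SS>_at_zero:
  "\<SS> 1 \<alpha>1 \<alpha>2 \<theta> chi 0 \<psi> = (\<lambda>X.
       - (complex_of_real \<alpha>2 *s (\<sigma>2 *v P_X (P_X \<psi>) X))
     + complex_of_real (\<theta> * chi X) *s (\<sigma>3 *v \<psi> X))"
  by (simp add: \<SS>_def)

definition eigenvalue_on :: "(real \<Rightarrow> complex ^ 2) set \<Rightarrow>
    ((real \<Rightarrow> complex ^ 2) \<Rightarrow> real \<Rightarrow> complex ^ 2) \<Rightarrow> complex \<Rightarrow> bool" where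
  "eigenvalue_on D T \<Omega> \<longleftrightarrow>
     (\<exists>\<psi> \<in> D. \<not> (AE X in lborel. \<psi> X = 0) \<and> (AE X in lborel. T \<psi> X = \<Omega> *s \<psi> X))"

end

theory Submission
  imports Defs "HOL-Complex_Analysis.Great_Picard"
begin

text \<open>
  In the components \<open>q = \<psi>\<^sub>1 - \<psi>\<^sub>2\<close> and \<open>p = \<psi>\<^sub>1 + \<psi>\<^sub>2\<close> the eigenvalue equation reads \<open>D q = (\<i> \<Omega> / \<alpha>\<^sub>2) p\<close>,
  \<open>D\<^sup>* p = - (\<i> \<Omega> / \<alpha>\<^sub>2) q\<close> with \<open>D = - \<partial>\<^sup>2 + \<i> c \<chi>\<close> and \<open>c = \<theta> / \<alpha>\<^sub>2\<close>; so every \<open>L\<^sup>2\<close> eigenvalue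
  \<open>\<lambda> \<in> (0, c\<^sup>2)\<close> of \<open>D\<^sup>* D\<close> yields both \<open>\<Omega> = \<plusminus> \<bar>\<alpha>\<^sub>2\<bar> \<surd>\<lambda>\<close>. Let \<open>\<lambda>\<close> be the infimum of \<open>\<parallel>D f\<parallel>\<^sup>2\<close> over
  compactly supported \<open>f\<close> with \<open>\<parallel>f\<parallel> = 1\<close>. For real \<open>f\<close> the cross term vanishes, so
  \<open>\<parallel>D f\<parallel>\<^sup>2 - c\<^sup>2 \<parallel>f\<parallel>\<^sup>2 = \<parallel>f''\<parallel>\<^sup>2 + c\<^sup>2 \<integral> (\<chi>\<^sup>2 - 1) f\<^sup>2\<close>, and a wide cutoff shows \<open>\<lambda> < c\<^sup>2\<close>. A minimising
  sequence has a pointwise convergent subsequence; the limit \<open>a\<close> is not zero, because sequences tending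
  to zero locally only see the constant coefficients \<open>\<chi> = \<plusminus>1\<close> at infinity, where \<open>\<parallel>D f\<parallel>\<^sup>2 \<ge> c\<^sup>2 \<parallel>f\<parallel>\<^sup>2\<close>
  asymptotically. The Euler--Lagrange equation holds weakly for \<open>a\<close>, hence classically by the lemma of
  du Bois-Reymond. Finally \<open>\<lambda> \<noteq> 0\<close>, because pairing \<open>f'' = \<plusminus> \<i> c \<chi> f\<close> with \<open>f\<close> and taking real parts
  leaves \<open>\<integral> \<bar>f'\<bar>\<^sup>2 = 0\<close>.
\<close>

subsection \<open>Compactly supported functions\<close>

text \<open>The operator is unbounded above and below, so an eigenvalue in its gap cannot be found
  by minimising its own form. In the components \<open>p\<close>, \<open>q\<close> it is
  off-diagonal, and its square is \<alpha>2^2 times the blocks D D* and D* D; these are nonnegative,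
  with essential spectrum starting at c^2, so a value of the form below c^2 is enough. The obstacle
  is the weak convergence available. The minimising sequence converges pointwise only: mass may
  escape to infinity, and nothing is claimed about the limits of its derivatives. The limit is
  therefore shown neither to be normalised nor to attain the infimum. What survives is whatever can
  be tested against a fixed compactly supported function once all derivatives have been moved onto
  it: the Euler-Lagrange equation, and a dual bound from which D a in L^2 is recovered after
  regularity is known. Throughout, the inner product on the complex numbers is the real one, Re (z *
  cnj w), for which i z is orthogonal to z.\<close>

definition csupp :: "(real \<Rightarrow> 'a::zero) \<Rightarrow> bool" where
  "csupp f \<longleftrightarrow> (\<exists>R. \<forall>x. R < \<bar>x\<bar> \<longrightarrow> f x = 0)"

lemma csuppI: "(\<And>x. R < \<bar>x\<bar> \<Longrightarrow> f x = 0) \<Longrightarrow> csupp f"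
  unfolding csupp_def by blast

lemma csuppE:
  assumes "csupp f"
  obtains R where "\<And>x. R < \<bar>x\<bar> \<Longrightarrow> f x = 0" "0 < R"
proof -
  obtain R where "\<forall>x. R < \<bar>x\<bar> \<longrightarrow> f x = 0" using assms unfolding csupp_def by blast
  then show ?thesis using that[of "max R 1"] by simp
qed

lemma csupp_mono: "csupp f \<Longrightarrow> (\<And>x. f x = 0 \<Longrightarrow> g x = 0) \<Longrightarrow> csupp g"
  unfolding csupp_def by blast

lemma csupp_combine:
  assumes "csupp f" "csupp g" "\<And>x. f x = 0 \<Longrightarrow> g x = 0 \<Longrightarrow> h x = 0"
  shows "csupp h"
proof -
  obtain R where "\<And>x. R < \<bar>x\<bar> \<Longrightarrow> f x = 0" using csuppE[OF assms(1)] by blast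
  moreover obtain S where "\<And>x. S < \<bar>x\<bar> \<Longrightarrow> g x = 0" using csuppE[OF assms(2)] by blast
  ultimately show ?thesis using assms(3) by (intro csuppI[of "max R S"]) simp
qed

lemma csupp_deriv:
  assumes "csupp f" "\<And>x. (f has_vector_derivative f' x) (at x)"
  shows "csupp f'"
proof -
  obtain R where R: "\<And>x. R < \<bar>x\<bar> \<Longrightarrow> f x = 0" using csuppE[OF assms(1)] by blast
  show ?thesis
  proof (rule csuppI)
    fix x assume x: "R < \<bar>x\<bar>"
    have "open {y. R < \<bar>y\<bar>}" by (intro open_Collect_less continuous_intros)
    then have "((\<lambda>_. 0) has_vector_derivative f' x) (at x)"
      using has_vector_derivative_transform_within_open[OF assms(2)[of x], of "{y. R < \<bar>y\<bar>}" "\<lambda>_. 0"] x R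
      by auto
    then show "f' x = 0"
      using vector_derivative_unique_at has_vector_derivative_const by blast
  qed
qed

lemma csupp_integrable:
  fixes f :: "real \<Rightarrow> 'a::{banach, second_countable_topology}"
  assumes "continuous_on UNIV f" "csupp f"
  shows "integrable lborel f"
proof -
  obtain R where R: "\<And>x. R < \<bar>x\<bar> \<Longrightarrow> f x = 0" using csuppE[OF assms(2)] by blast
  have "(\<lambda>x. indicator {-R..R} x *\<^sub>R f x) = f"
    using R by (auto simp: indicator_def fun_eq_iff)
  then show ?thesis
    using borel_integrable_compact[of "{-R..R}" f] continuous_on_subset[OF assms(1)] by auto
qed

text \<open>Cutting the line at \<open>a\<close> leaves exactly one boundary value. These values
  yield the pointwise bound \<open>sup_bound\<close> and the boundary terms in
  \<open>tail_lower_bound\<close>.\<close>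

lemma csupp_integral_deriv_right:
  fixes F :: "real \<Rightarrow> 'a::euclidean_space"
  assumes "csupp F" "\<And>x. (F has_vector_derivative F' x) (at x)" "continuous_on UNIV F'"
  shows "(LINT x|lborel. indicator {a<..} x *\<^sub>R F' x) = - F a"
    and "(LINT x|lborel. indicator {..<a} x *\<^sub>R F' x) = F a"
proof -
  obtain R where R: "\<And>x. R < \<bar>x\<bar> \<Longrightarrow> F x = 0" "\<And>x. R < \<bar>x\<bar> \<Longrightarrow> F' x = 0"
  proof -
    obtain R where R: "\<And>x. R < \<bar>x\<bar> \<Longrightarrow> F x = 0" using csuppE[OF assms(1)] by blast
    obtain S where S: "\<And>x. S < \<bar>x\<bar> \<Longrightarrow> F' x = 0" using csuppE[OF csupp_deriv[OF assms(1,2)]] by blast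
    show ?thesis using that[of "max R S"] R S by simp
  qed
  define b where "b = max \<bar>R\<bar> \<bar>a\<bar> + 1"
  have b: "a \<le> b" "-b \<le> a" "F b = 0" "F (-b) = 0" "\<And>x. b < \<bar>x\<bar> \<Longrightarrow> F' x = 0"
    unfolding b_def using R by auto
  \<comment> \<open>The cut point is a null set, so the open half-line may be traded for a closed
    interval, where the fundamental theorem of calculus applies.\<close>
  have AE: "AE x in lborel. x \<noteq> a" by (rule AE_lborel_singleton)
  have [measurable]: "F' \<in> borel_measurable borel"
    using assms(3) by (rule borel_measurable_continuous_onI)
  have "(LINT x|lborel. indicator {a<..} x *\<^sub>R F' x) = (LINT x|lborel. indicator {a..b} x *\<^sub>R F' x)"
    by (intro integral_cong_AE eventually_mono[OF AE])
       (use b(5) in \<open>auto simp: indicator_def split: if_splits\<close>)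
  also have "\<dots> = F b - F a"
    by (rule integral_FTC_atLeastAtMost)
       (use b assms in \<open>auto intro: has_vector_derivative_at_within continuous_on_subset\<close>)
  finally show "(LINT x|lborel. indicator {a<..} x *\<^sub>R F' x) = - F a" using b by simp
  have "(LINT x|lborel. indicator {..<a} x *\<^sub>R F' x) = (LINT x|lborel. indicator {-b..a} x *\<^sub>R F' x)"
    by (intro integral_cong_AE eventually_mono[OF AE])
       (use b(5) in \<open>auto simp: indicator_def split: if_splits\<close>)
  also have "\<dots> = F a - F (-b)"
    by (rule integral_FTC_atLeastAtMost)
       (use b assms in \<open>auto intro: has_vector_derivative_at_within continuous_on_subset\<close>)
  finally show "(LINT x|lborel. indicator {..<a} x *\<^sub>R F' x) = F a" using b by simp
qed

lemma csupp_integral_deriv: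
  fixes F :: "real \<Rightarrow> 'a::euclidean_space"
  assumes "csupp F" "\<And>x. (F has_vector_derivative F' x) (at x)" "continuous_on UNIV F'"
  shows "(LINT x|lborel. F' x) = 0"
proof -
  obtain R where R: "\<And>x. R < \<bar>x\<bar> \<Longrightarrow> F x = 0" using csuppE[OF assms(1)] by blast
  obtain S where S: "\<And>x. S < \<bar>x\<bar> \<Longrightarrow> F' x = 0" using csuppE[OF csupp_deriv[OF assms(1,2)]] by blast
  define b where "b = - max \<bar>R\<bar> \<bar>S\<bar> - 1"
  have "indicator {b<..} x *\<^sub>R F' x = F' x" for x
    using S[of x] unfolding b_def by (auto simp: indicator_def)
  then show ?thesis
    using csupp_integral_deriv_right(1)[OF assms, of b] R[of b] unfolding b_def by simp
qed

text \<open>Compact support of one factor is enough, which later allows the other factor to be a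
  solution on the whole line.\<close>

lemma integral_by_parts_cs:
  fixes f g :: "real \<Rightarrow> complex"
  assumes f: "\<And>x. (f has_vector_derivative f' x) (at x)" "continuous_on UNIV f'"
    and g: "\<And>x. (g has_vector_derivative g' x) (at x)" "continuous_on UNIV g'"
    and "csupp f \<or> csupp g"
  shows "(LINT x|lborel. f' x \<bullet> g x) = - (LINT x|lborel. f x \<bullet> g' x)"
proof -
  have cf: "continuous_on UNIV f" "continuous_on UNIV g"
    using f g by (meson continuous_at_imp_continuous_on has_vector_derivative_continuous)+
  have csupp: "csupp (\<lambda>x. f x \<bullet> g x)" "csupp (\<lambda>x. f' x \<bullet> g x)" "csupp (\<lambda>x. f x \<bullet> g' x)"
    using \<open>csupp f \<or> csupp g\<close> csupp_deriv[of f f'] csupp_deriv[of g g'] f(1) g(1)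
    by (auto intro: csupp_mono[of f] csupp_mono[of g] csupp_mono[of f'] csupp_mono[of g'])
  have "(LINT x|lborel. f x \<bullet> g' x + f' x \<bullet> g x) = 0"
    by (rule csupp_integral_deriv[OF csupp(1)])
       (use f g cf in \<open>auto intro!: derivative_eq_intros continuous_intros
          bounded_bilinear.has_vector_derivative[OF bounded_bilinear_inner]\<close>)
  moreover have "(LINT x|lborel. f x \<bullet> g' x + f' x \<bullet> g x) = (LINT x|lborel. f x \<bullet> g' x) + (LINT x|lborel. f' x \<bullet> g x)"
    by (intro Bochner_Integration.integral_add csupp_integrable csupp continuous_intros cf f g)
  ultimately show ?thesis by simp
qed

subsection \<open>The quadratic form\<close>

text \<open>Both derivatives are carried as arguments, so that sums, multiples and the form
  \<open>Q\<close> are explicit expressions and no choice of derivative enters.\<close>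

definition C2c :: "(real \<Rightarrow> complex) \<Rightarrow> (real \<Rightarrow> complex) \<Rightarrow> (real \<Rightarrow> complex) \<Rightarrow> bool" where
  "C2c f f1 f2 \<longleftrightarrow> (\<forall>x. (f has_vector_derivative f1 x) (at x)) \<and>
     (\<forall>x. (f1 has_vector_derivative f2 x) (at x)) \<and> continuous_on UNIV f2 \<and> csupp f"

lemma C2cD:
  assumes "C2c f f1 f2"
  shows "(f has_vector_derivative f1 x) (at x)" "(f1 has_vector_derivative f2 x) (at x)"
    "continuous_on UNIV f" "continuous_on UNIV f1" "continuous_on UNIV f2"
    "csupp f" "csupp f1" "csupp f2"
proof -
  show d: "(f has_vector_derivative f1 x) (at x)" "(f1 has_vector_derivative f2 x) (at x)" for x
    using assms unfolding C2c_def by auto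
  show "continuous_on UNIV f" "continuous_on UNIV f1"
    using d by (meson continuous_at_imp_continuous_on has_vector_derivative_continuous)+
  show "continuous_on UNIV f2" and c: "csupp f" using assms unfolding C2c_def by auto
  show "csupp f1" using csupp_deriv[OF c] d by blast
  then show "csupp f2" using csupp_deriv d by blast
qed

lemma C2c_add:
  assumes "C2c f f1 f2" "C2c g g1 g2"
  shows "C2c (\<lambda>x. f x + g x) (\<lambda>x. f1 x + g1 x) (\<lambda>x. f2 x + g2 x)"
  using C2cD[OF assms(1)] C2cD[OF assms(2)] csupp_combine[of f g "\<lambda>x. f x + g x"]
  by (auto simp: C2c_def intro!: derivative_intros continuous_intros)

lemma C2c_scaleR:
  assumes "C2c f f1 f2"
  shows "C2c (\<lambda>x. t *\<^sub>R f x) (\<lambda>x. t *\<^sub>R f1 x) (\<lambda>x. t *\<^sub>R f2 x)"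
  using C2cD[OF assms] csupp_mono[of f "\<lambda>x. t *\<^sub>R f x"]
  by (auto simp: C2c_def intro!: continuous_intros derivative_eq_intros)

text \<open>Multiplication by i is a rotation by a right angle. Every cancellation of a cross term
  below comes from this.\<close>

lemma inner_ii [simp]: "(\<i> * z) \<bullet> (\<i> * w) = z \<bullet> w" "z \<bullet> (\<i> * z) = 0" "(\<i> * z) \<bullet> z = 0"
  by (simp_all add: inner_complex_def)

lemma inner_le_half: "\<bar>(x::'a::real_inner) \<bullet> y\<bar> \<le> (x \<bullet> x + y \<bullet> y) / 2"
proof -
  have "0 \<le> (x - y) \<bullet> (x - y)" "0 \<le> (x + y) \<bullet> (x + y)" by simp_all
  then show ?thesis by (simp add: inner_diff_left inner_diff_right inner_add_left inner_add_right inner_commute)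
qed

text \<open>Integration by parts turns the left side into the integral of -f f'', and the
  arithmetic-geometric mean inequality splits the product. This supplies the missing middle
  derivative in the a priori bounds.\<close>

lemma C2c_interpolation:
  assumes "C2c f f1 f2"
  shows "(LINT x|lborel. f1 x \<bullet> f1 x) \<le> ((LINT x|lborel. f x \<bullet> f x) + (LINT x|lborel. f2 x \<bullet> f2 x)) / 2"
proof -
  note D = C2cD[OF assms]
  have "(LINT x|lborel. f1 x \<bullet> f1 x) = - (LINT x|lborel. f x \<bullet> f2 x)"
    using integral_by_parts_cs[of f f1 f1 f2] D by auto
  also have "\<dots> = (LINT x|lborel. - (f x \<bullet> f2 x))" by simp
  also have "\<dots> \<le> (LINT x|lborel. (f x \<bullet> f x + f2 x \<bullet> f2 x) / 2)"
  proof (rule integral_mono)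
    show "- (f x \<bullet> f2 x) \<le> (f x \<bullet> f x + f2 x \<bullet> f2 x) / 2" for x
      using inner_le_half[of "f x" "f2 x"] by linarith
    show "integrable lborel (\<lambda>x. - (f x \<bullet> f2 x))"
      by (intro csupp_integrable continuous_intros D csupp_mono[OF D(6)]) auto
    show "integrable lborel (\<lambda>x. (f x \<bullet> f x + f2 x \<bullet> f2 x) / 2)"
      by (intro csupp_integrable continuous_intros D csupp_combine[OF D(6) D(8)]) auto
  qed
  also have "\<dots> = ((LINT x|lborel. f x \<bullet> f x) + (LINT x|lborel. f2 x \<bullet> f2 x)) / 2"
  proof -
    have "integrable lborel (\<lambda>x. f x \<bullet> f x)" "integrable lborel (\<lambda>x. f2 x \<bullet> f2 x)"
      by (intro csupp_integrable continuous_intros D csupp_mono[OF D(6)] csupp_mono[OF D(8)]; simp)+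
    then show ?thesis by simp
  qed
  finally show ?thesis .
qed

text \<open>The one-dimensional Sobolev embedding: |f(x)|^2 is minus the integral of (|f|^2)' over
  the half-line to the right of x.\<close>

lemma sup_bound:
  fixes f :: "real \<Rightarrow> complex"
  assumes f: "\<And>x. (f has_vector_derivative f' x) (at x)" "continuous_on UNIV f'" "csupp f"
  shows "f x \<bullet> f x \<le> (LINT x|lborel. f x \<bullet> f x) + (LINT x|lborel. f' x \<bullet> f' x)"
proof -
  have cf: "continuous_on UNIV f"
    using f by (meson continuous_at_imp_continuous_on has_vector_derivative_continuous)
  have csupp': "csupp f'" by (rule csupp_deriv[OF f(3,1)])
  have [measurable]: "f \<in> borel_measurable borel" "f' \<in> borel_measurable borel"
    using cf f(2) by (auto intro: borel_measurable_continuous_onI)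
  have int: "integrable lborel (\<lambda>x. f x \<bullet> f' x + f' x \<bullet> f x)"
    "integrable lborel (\<lambda>x. f x \<bullet> f x)" "integrable lborel (\<lambda>x. f' x \<bullet> f' x)"
    by (intro csupp_integrable continuous_intros cf f csupp_mono[OF f(3)] csupp_mono[OF csupp']; simp)+
  have "f x \<bullet> f x = - (LINT y|lborel. indicator {x<..} y *\<^sub>R (f y \<bullet> f' y + f' y \<bullet> f y))"
    by (subst csupp_integral_deriv_right(1)[of "\<lambda>y. f y \<bullet> f y"])
       (use f cf in \<open>auto intro!: derivative_eq_intros continuous_intros csupp_mono[OF f(3)]
          bounded_bilinear.has_vector_derivative[OF bounded_bilinear_inner]\<close>)
  also have "\<dots> = (LINT y|lborel. - (indicator {x<..} y *\<^sub>R (f y \<bullet> f' y + f' y \<bullet> f y)))" by simp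
  also have "\<dots> \<le> (LINT y|lborel. f y \<bullet> f y + f' y \<bullet> f' y)"
  proof (rule integral_mono)
    show "integrable lborel (\<lambda>y. - (indicat_real {x<..} y *\<^sub>R (f y \<bullet> f' y + f' y \<bullet> f y)))"
      by (rule Bochner_Integration.integrable_bound[OF int(1)]) (auto simp: indicator_def)
    show "- (indicat_real {x<..} y *\<^sub>R (f y \<bullet> f' y + f' y \<bullet> f y)) \<le> f y \<bullet> f y + f' y \<bullet> f' y" for y
      using inner_le_half[of "f y" "f' y"] by (auto simp: indicator_def inner_commute)
  qed (use int in auto)
  finally show ?thesis using int by simp
qed

text \<open>The operator \<open>D f = - f'' + \<i> c \<chi> f\<close>, where the argument \<open>f2\<close> stands for \<open>f''\<close>.\<close>

definition DD :: "real \<Rightarrow> (real \<Rightarrow> real) \<Rightarrow> (real \<Rightarrow> complex) \<Rightarrow> (real \<Rightarrow> complex) \<Rightarrow> real \<Rightarrow> complex" where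
  "DD c chi f f2 x = (c * chi x) *\<^sub>R (\<i> * f x) - f2 x"

section \<open>The coefficient \<open>chi\<close> and the form near infinity\<close>

locale wall =
  fixes c :: real and chi chi1 chi2 :: "real \<Rightarrow> real"
  assumes c: "c \<noteq> 0"
    and chi: "\<And>x. (chi has_real_derivative chi1 x) (at x)"
    and chi1: "\<And>x. (chi1 has_real_derivative chi2 x) (at x)"
    and chi2: "continuous_on UNIV chi2"
    and chi_lim: "((\<lambda>X. (chi X)\<^sup>2) \<longlongrightarrow> 1) at_infinity"
begin

lemma chi_cont: "continuous_on A chi" "continuous_on A chi1"
  using chi chi1 by (meson DERIV_continuous_on has_field_derivative_at_within)+

text \<open>Only the square of \<open>chi\<close> has a prescribed limit, so each end may have its
  own sign. Near infinity \<open>chi\<close> cannot vanish, and on a connected half-line a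
  nonvanishing continuous function keeps its sign.\<close>

lemma chi_near_one:
  assumes "0 < e"
  shows "\<exists>R>0. (\<exists>s\<in>{1,-1}. \<forall>x>R. \<bar>chi x - s\<bar> \<le> e) \<and> (\<exists>s\<in>{1,-1}. \<forall>x< -R. \<bar>chi x - s\<bar> \<le> e)"
proof -
  have "\<forall>\<^sub>F x in at_infinity. dist ((chi x)\<^sup>2) 1 < min e (1/2)"
    using chi_lim assms by (intro tendstoD) auto
  then obtain B where B: "\<And>x. B \<le> \<bar>x\<bar> \<Longrightarrow> \<bar>(chi x)\<^sup>2 - 1\<bar> < min e (1/2)"
    unfolding eventually_at_infinity by (auto simp: dist_real_def)
  define R where "R = max B 1"
  have *: "\<exists>s\<in>{1,-1}. \<forall>x\<in>S. \<bar>chi x - s\<bar> \<le> e" if S: "connected S" "\<And>x. x \<in> S \<Longrightarrow> B \<le> \<bar>x\<bar>" for S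
  proof -
    \<comment> \<open>The bound 1/2 built into \<open>B\<close> keeps the square of
      \<open>chi\<close> away from 0.\<close>
    have nz: "chi x \<noteq> 0" if "x \<in> S" for x using B[OF S(2)[OF that]] by auto
    have "connected (chi ` S)" using S(1) chi_cont by (intro connected_continuous_image)
    then have "0 \<in> chi ` S" if "x \<in> S" "y \<in> S" "chi x < 0" "0 < chi y" for x y
      using connectedD_interval[of "chi ` S" "chi x" "chi y" 0] that by auto
    then have sg: "(\<forall>x\<in>S. chi x > 0) \<or> (\<forall>x\<in>S. chi x < 0)"
      using nz by (metis imageE linorder_neqE_linordered_idom)
    have est: "\<bar>chi x - s\<bar> \<le> e" if x: "x \<in> S" and s: "s \<in> {1,-1}" "0 < s * chi x" for x s
    proof -
      \<comment> \<open>Since \<open>s\<close> and \<open>chi x\<close> have equal signs, |chi x +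
        s| is at least 1, and the difference of squares dominates the difference.\<close>
      have "\<bar>chi x - s\<bar> * 1 \<le> \<bar>chi x - s\<bar> * \<bar>chi x + s\<bar>"
        using s by (intro mult_left_mono) auto
      also have "\<dots> = \<bar>(chi x)\<^sup>2 - 1\<bar>"
        using s(1) by (subst abs_mult[symmetric]) (auto simp: power2_eq_square algebra_simps)
      finally show ?thesis using B[OF S(2)[OF x]] by auto
    qed
    from sg show ?thesis
    proof
      assume "\<forall>x\<in>S. chi x > 0"
      then show ?thesis using est[of _ 1] by (intro bexI[of _ 1]) auto
    next
      assume "\<forall>x\<in>S. chi x < 0"
      then show ?thesis using est[of _ "-1"] by (intro bexI[of _ "-1"]) auto
    qed
  qed
  have "\<exists>s\<in>{1,-1}. \<forall>x\<in>{R<..}. \<bar>chi x - s\<bar> \<le> e" "\<exists>s\<in>{1,-1}. \<forall>x\<in>{..< -R}. \<bar>chi x - s\<bar> \<le> e"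
    by (rule *; force simp: R_def)+
  then show ?thesis by (intro exI[of _ R]) (auto simp: R_def)
qed

lemma chi_bounded: "\<exists>M>0. \<forall>x. \<bar>chi x\<bar> \<le> M"
proof -
  obtain R s t where R: "R > 0" "s \<in> {1,-1}" "\<forall>x>R. \<bar>chi x - s\<bar> \<le> 1" "t \<in> {1,-1}" "\<forall>x< -R. \<bar>chi x - t\<bar> \<le> 1"
    using chi_near_one[of 1] by (metis zero_less_one)
  have "bounded (chi ` {-R..R})"
    by (intro compact_imp_bounded compact_continuous_image chi_cont compact_Icc)
  then obtain M where M: "\<And>x. x \<in> {-R..R} \<Longrightarrow> \<bar>chi x\<bar> \<le> M" unfolding bounded_iff by (metis imageI real_norm_def)
  have "\<bar>chi x\<bar> \<le> max 2 M" for x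
  proof -
    consider "x > R" | "x < -R" | "x \<in> {-R..R}" by fastforce
    then show ?thesis
    proof cases
      case 1 then have "\<bar>chi x - s\<bar> \<le> 1" using R by auto
      then show ?thesis using R(2) by auto
    next
      case 2 then have "\<bar>chi x - t\<bar> \<le> 1" using R by auto
      then show ?thesis using R(4) by auto
    qed (use M in force)
  qed
  then show ?thesis by (intro exI[of _ "max 2 M"]) auto
qed

abbreviation "N f \<equiv> (LINT x|lborel. f x \<bullet> f x)"
abbreviation "Q f f2 \<equiv> (LINT x|lborel. DD c chi f f2 x \<bullet> DD c chi f f2 x)"

lemma DD_cont:
  assumes "C2c f f1 f2"
  shows "continuous_on UNIV (DD c chi f f2)" "csupp (DD c chi f f2)"
  unfolding DD_def
  using C2cD[OF assms] by (auto intro!: continuous_intros chi_cont csupp_combine[of f f2])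

lemma int_inner:
  fixes f g :: "real \<Rightarrow> complex"
  assumes "continuous_on UNIV f" "continuous_on UNIV g" "csupp f \<or> csupp g"
  shows "integrable lborel (\<lambda>x. f x \<bullet> g x)"
  using assms by (intro csupp_integrable continuous_intros) (auto intro: csupp_mono)

lemma int_N: "C2c f f1 f2 \<Longrightarrow> integrable lborel (\<lambda>x. f x \<bullet> f x)"
  "C2c f f1 f2 \<Longrightarrow> integrable lborel (\<lambda>x. f1 x \<bullet> f1 x)"
  "C2c f f1 f2 \<Longrightarrow> integrable lborel (\<lambda>x. f2 x \<bullet> f2 x)"
  "C2c f f1 f2 \<Longrightarrow> integrable lborel (\<lambda>x. DD c chi f f2 x \<bullet> DD c chi f f2 x)"
  by (auto intro: int_inner DD_cont C2cD)

text \<open>Where \<open>chi\<close> is replaced by a constant s, the cross term 2 c s (i f) . f''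
  is the derivative of 2 c s (i f) . f', because (i f') . f' = 0. It thus integrates to boundary
  values at R and -R, and what remains is at least c^2 |f|^2 up to small errors. On [-R, R] no
  information on \<open>chi\<close> is used and c^2 |f|^2 is simply given away.\<close>

lemma tail_lower_bound:
  assumes "0 < e"
  shows "\<exists>R>0. \<forall>f f1 f2. C2c f f1 f2 \<longrightarrow>
     (c\<^sup>2 - e) * N f - e * N f2 - c\<^sup>2 * (LINT x|lborel. indicator {-R..R} x *\<^sub>R (f x \<bullet> f x))
       - 2 * \<bar>c\<bar> * (norm (f1 R) * norm (f R) + norm (f1 (-R)) * norm (f (-R))) \<le> Q f f2"
proof -
  \<comment> \<open>Replacing \<open>chi\<close> by s costs 2 c^2 d |f|^2 in the square and |c| d
    (|f|^2 + |f''|^2) in the cross term; this \<open>d\<close> keeps the coefficients of |f|^2 and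
    |f''|^2 below \<open>e\<close>.\<close>
  define d where "d = e / (2 * c\<^sup>2 + \<bar>c\<bar> + 1)"
  have den: "2 * c\<^sup>2 + \<bar>c\<bar> + 1 > 0" by (simp add: add_nonneg_pos)
  have d: "d > 0" using assms den unfolding d_def by simp
  have de: "2 * c\<^sup>2 * d + \<bar>c\<bar> * d \<le> e" "\<bar>c\<bar> * d \<le> e"
  proof -
    have "(2 * c\<^sup>2 + \<bar>c\<bar> + 1) * d = e" using den by (simp add: d_def)
    then show "2 * c\<^sup>2 * d + \<bar>c\<bar> * d \<le> e" using d by (simp add: algebra_simps)
    moreover have "0 \<le> 2 * c\<^sup>2 * d" using d by simp
    ultimately show "\<bar>c\<bar> * d \<le> e" by linarith
  qed
  obtain R s t where R: "R > 0" "s \<in> {1,-1}" "\<And>x. x>R \<Longrightarrow> \<bar>chi x - s\<bar> \<le> d"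
     "t \<in> {1,-1}" "\<And>x. x< -R \<Longrightarrow> \<bar>chi x - t\<bar> \<le> d"
    using chi_near_one[OF d] by metis
  have pw: "(c\<^sup>2 - e) * (u \<bullet> u) - e * (v \<bullet> v) - 2 * c * s * ((\<i> * u) \<bullet> v)
      \<le> ((c * x) *\<^sub>R (\<i> * u) - v) \<bullet> ((c * x) *\<^sub>R (\<i> * u) - v)"
    if s: "s \<in> {1,-1}" and x: "\<bar>x - s\<bar> \<le> d" for u v :: complex and s x :: real
  proof -
    have "1 - 2 * d \<le> x\<^sup>2"
    proof -
      have "x\<^sup>2 = 1 + 2 * (s * (x - s)) + (x - s)\<^sup>2" using s by (auto simp: power2_eq_square algebra_simps)
      moreover have "\<bar>s * (x - s)\<bar> \<le> d" using s x by (auto simp: abs_mult)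
      ultimately show ?thesis by (smt (verit) zero_le_power2)
    qed
    then have "c\<^sup>2 * (1 - 2 * d) * (u \<bullet> u) \<le> c\<^sup>2 * x\<^sup>2 * (u \<bullet> u)"
      by (intro mult_right_mono mult_left_mono) auto
    moreover have "\<bar>2 * c * (x - s) * ((\<i> * u) \<bullet> v)\<bar> \<le> \<bar>c\<bar> * d * (u \<bullet> u + v \<bullet> v)"
    proof -
      have "\<bar>2 * c * (x - s) * ((\<i> * u) \<bullet> v)\<bar> = 2 * \<bar>c\<bar> * (\<bar>x - s\<bar> * \<bar>(\<i> * u) \<bullet> v\<bar>)" by (simp add: abs_mult)
      also have "\<dots> \<le> 2 * \<bar>c\<bar> * (d * ((u \<bullet> u + v \<bullet> v) / 2))"
        using inner_le_half[of "\<i> * u" v] x d by (intro mult_left_mono mult_mono) auto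
      finally show ?thesis by simp
    qed
    moreover have "((c * x) *\<^sub>R (\<i> * u) - v) \<bullet> ((c * x) *\<^sub>R (\<i> * u) - v)
        = c\<^sup>2 * x\<^sup>2 * (u \<bullet> u) + v \<bullet> v - 2 * c * s * ((\<i> * u) \<bullet> v) - 2 * c * (x - s) * ((\<i> * u) \<bullet> v)"
      by (simp add: inner_diff_left inner_diff_right inner_commute[of v "\<i> * u"] power2_eq_square algebra_simps)
    moreover have "(2 * c\<^sup>2 * d + \<bar>c\<bar> * d) * (u \<bullet> u) \<le> e * (u \<bullet> u)" "\<bar>c\<bar> * d * (v \<bullet> v) \<le> e * (v \<bullet> v)"
      using de by (auto intro!: mult_right_mono)
    moreover have "0 \<le> v \<bullet> v" by simp
    ultimately show ?thesis
      unfolding abs_le_iff by (simp only: distrib_left distrib_right left_diff_distrib right_diff_distrib mult_1_right) linarith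
  qed
  have "(c\<^sup>2 - e) * N f - e * N f2 - c\<^sup>2 * (LINT x|lborel. indicator {-R..R} x *\<^sub>R (f x \<bullet> f x))
       - 2 * \<bar>c\<bar> * (norm (f1 R) * norm (f R) + norm (f1 (-R)) * norm (f (-R))) \<le> Q f f2"
    if C: "C2c f f1 f2" for f f1 f2
  proof -
    note D = C2cD[OF C]
    have [measurable]: "f \<in> borel_measurable borel" "f2 \<in> borel_measurable borel"
      by (intro borel_measurable_continuous_onI D)+
    let ?I = "\<lambda>x. (\<i> * f x) \<bullet> f2 x"
    have ii: "integrable lborel ?I"
      by (intro csupp_integrable continuous_intros D csupp_mono[OF D(6)]) auto
    have FTC: "(LINT x|lborel. indicator {R<..} x *\<^sub>R ?I x) = - ((\<i> * f R) \<bullet> f1 R)"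
        "(LINT x|lborel. indicator {..< -R} x *\<^sub>R ?I x) = (\<i> * f (-R)) \<bullet> f1 (-R)"
      by (rule csupp_integral_deriv_right[of "\<lambda>x. (\<i> * f x) \<bullet> f1 x"];
          (auto intro!: csupp_mono[OF D(6)] continuous_intros D)?;
          rule has_vector_derivative_eq_rhs,
          rule bounded_bilinear.has_vector_derivative[OF bounded_bilinear_inner],
          rule has_vector_derivative_mult_right[OF D(1)], rule D(2), simp)+
    have i1: "integrable lborel (\<lambda>x. indicator {R<..} x *\<^sub>R ?I x)"
      "integrable lborel (\<lambda>x. indicator {..< -R} x *\<^sub>R ?I x)"
      by (rule Bochner_Integration.integrable_bound[OF ii]; auto simp: indicator_def)+
    have i2: "integrable lborel (\<lambda>x. indicator {-R..R} x *\<^sub>R (f x \<bullet> f x))"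
      by (rule Bochner_Integration.integrable_bound[OF int_N(1)[OF C]]) (auto simp: indicator_def)
    let ?L = "\<lambda>x. (c\<^sup>2 - e) * (f x \<bullet> f x) - e * (f2 x \<bullet> f2 x) - c\<^sup>2 * (indicator {-R..R} x *\<^sub>R (f x \<bullet> f x))
       - 2 * c * s * (indicator {R<..} x *\<^sub>R ?I x) - 2 * c * t * (indicator {..< -R} x *\<^sub>R ?I x)"
    have "(LINT x|lborel. ?L x) \<le> Q f f2"
    proof (rule integral_mono)
      show "?L x \<le> DD c chi f f2 x \<bullet> DD c chi f f2 x" for x
      proof -
        consider "x > R" | "x < -R" | "x \<in> {-R..R}" by fastforce
        then show ?thesis
        proof cases
          case 1
          then show ?thesis using pw[OF R(2) R(3)[OF 1], of "f x" "f2 x"] R(1) by (auto simp: DD_def)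
        next
          case 2
          then show ?thesis using pw[OF R(4) R(5)[OF 2], of "f x" "f2 x"] R(1) by (auto simp: DD_def)
        next
          case 3
          \<comment> \<open>On the middle interval \<open>?L x\<close> reduces to -e (|f|^2 +
            |f''|^2), which is at most 0.\<close>
          have "0 \<le> e * (f x \<bullet> f x)" "0 \<le> e * (f2 x \<bullet> f2 x)" "0 \<le> DD c chi f f2 x \<bullet> DD c chi f f2 x"
            using assms by auto
          then show ?thesis using 3 by (simp add: algebra_simps del: inner_ge_zero)
        qed
      qed
    qed (use int_N[OF C] i1 i2 in auto)
    also have "(LINT x|lborel. ?L x) = (c\<^sup>2 - e) * N f - e * N f2
        - c\<^sup>2 * (LINT x|lborel. indicator {-R..R} x *\<^sub>R (f x \<bullet> f x))
        - 2 * c * s * (- ((\<i> * f R) \<bullet> f1 R)) - 2 * c * t * ((\<i> * f (-R)) \<bullet> f1 (-R))"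
      unfolding FTC[symmetric] using int_N[OF C] i1 i2 by simp
    finally have *: "\<dots> \<le> Q f f2" .
    have **: "2 * c * s * w \<le> 2 * \<bar>c\<bar> * (norm u * norm v)"
      if "s \<in> {1,-1}" "\<bar>w\<bar> \<le> norm v * norm u" for s w and u v :: complex
    proof -
      have "2 * c * s * w \<le> \<bar>2 * c * s * w\<bar>" by simp
      also have "\<dots> = 2 * \<bar>c\<bar> * \<bar>w\<bar>" using that by (auto simp: abs_mult)
      also have "\<dots> \<le> 2 * \<bar>c\<bar> * (norm u * norm v)" using that(2) by (intro mult_left_mono) (auto simp: mult.commute)
      finally show ?thesis .
    qed
    have "\<bar>- ((\<i> * f R) \<bullet> f1 R)\<bar> \<le> norm (f R) * norm (f1 R)"
      "\<bar>(\<i> * f (-R)) \<bullet> f1 (-R)\<bar> \<le> norm (f (-R)) * norm (f1 (-R))"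
      using Cauchy_Schwarz_ineq2[of "\<i> * f R" "f1 R"] Cauchy_Schwarz_ineq2[of "\<i> * f (-R)" "f1 (-R)"]
      by (auto simp: norm_mult)
    from **[OF R(2) this(1)] **[OF R(4) this(2)] * show ?thesis
      by (simp only: distrib_left)
  qed
  with R(1) show ?thesis by blast
qed

end

section \<open>The infimum, a priori bounds and almost minimisers\<close>

lemma inner_expand:
  "((u::'a::real_inner) + t *\<^sub>R v) \<bullet> (u + t *\<^sub>R v) = u \<bullet> u + 2 * t * (u \<bullet> v) + t\<^sup>2 * (v \<bullet> v)"
  by (simp add: inner_add_left inner_add_right inner_commute[of v u] power2_eq_square algebra_simps)

context wall
begin

abbreviation "Dop \<equiv> DD c chi"

lemma DD_linear:
  "Dop (\<lambda>x. f x + g x) (\<lambda>x. f2 x + g2 x) x = Dop f f2 x + Dop g g2 x"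
  "Dop (\<lambda>x. t *\<^sub>R f x) (\<lambda>x. t *\<^sub>R f2 x) x = t *\<^sub>R Dop f f2 x"
  by (simp_all add: DD_def algebra_simps scaleR_conv_of_real)

lemma Q_nonneg: "0 \<le> Q f f2" and N_nonneg: "0 \<le> N f"
  by (auto intro: integral_nonneg_AE)

definition lam :: real where
  "lam = Inf {Q f f2 | f f1 f2. C2c f f1 f2 \<and> N f = 1}"

lemma lam_bdd: "bdd_below {Q f f2 | f f1 f2. C2c f f1 f2 \<and> N f = 1}"
  using Q_nonneg by (intro bdd_belowI[of _ 0]) auto

lemma N_Q_scaleR: "N (\<lambda>x. t *\<^sub>R f x) = t\<^sup>2 * N f" "Q (\<lambda>x. t *\<^sub>R f x) (\<lambda>x. t *\<^sub>R f2 x) = t\<^sup>2 * Q f f2"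
  unfolding DD_linear by (simp_all add: power2_eq_square mult.assoc)

lemma normalise:
  assumes C: "C2c f f1 f2" and N: "N f > 0"
  shows "Q f f2 / N f \<in> {Q f f2 | f f1 f2. C2c f f1 f2 \<and> N f = 1}"
proof -
  define t where "t = 1 / sqrt (N f)"
  have t: "t\<^sup>2 = 1 / N f" using N by (simp add: t_def power_divide)
  have 1: "C2c (\<lambda>x. t *\<^sub>R f x) (\<lambda>x. t *\<^sub>R f1 x) (\<lambda>x. t *\<^sub>R f2 x)" by (rule C2c_scaleR[OF C])
  have 2: "N (\<lambda>x. t *\<^sub>R f x) = 1" "Q (\<lambda>x. t *\<^sub>R f x) (\<lambda>x. t *\<^sub>R f2 x) = Q f f2 / N f"
    using N t by (simp_all only: N_Q_scaleR) auto
  show ?thesis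
    unfolding mem_Collect_eq by (intro exI conjI) (rule 2(2)[symmetric], rule 1, rule 2(1))
qed

lemma lam_le:
  assumes C: "C2c f f1 f2"
  shows "lam * N f \<le> Q f f2"
proof (cases "N f > 0")
  case True
  have "lam \<le> Q f f2 / N f"
    unfolding lam_def by (rule cInf_lower[OF normalise[OF C True] lam_bdd])
  then show ?thesis using True by (simp add: pos_le_divide_eq)
next
  case False
  then have "N f = 0" using N_nonneg[of f] by linarith
  then show ?thesis using Q_nonneg by simp
qed

text \<open>Since \<open>chi\<close> is bounded, f'' = i c chi f - D f is controlled by f and D f;
  interpolation then controls f', and \<open>sup_bound\<close> applied to f and to f' gives the
  pointwise bounds.\<close>

lemma apriori:
  "\<exists>K>0. \<forall>f f1 f2. C2c f f1 f2 \<longrightarrow> N f2 \<le> K * (Q f f2 + N f) \<and>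
     (\<forall>x. f x \<bullet> f x \<le> K * (Q f f2 + N f)) \<and> (\<forall>x. f1 x \<bullet> f1 x \<le> K * (Q f f2 + N f))"
proof -
  obtain M where M: "M > 0" "\<And>x. \<bar>chi x\<bar> \<le> M" using chi_bounded by blast
  \<comment> \<open>\<open>L\<close> dominates both coefficients 2 and 2 (|c| M)^2 in the bound for
    f''. As \<open>L\<close> is at least 2, the single factor 2 L + 1 covers all three
    estimates.\<close>
  define L where "L = 2 + 2 * (\<bar>c\<bar> * M)\<^sup>2"
  have L: "L \<ge> 2" by (simp add: L_def)
  have "N f2 \<le> (2 * L + 1) * (Q f f2 + N f) \<and>
     (\<forall>x. f x \<bullet> f x \<le> (2 * L + 1) * (Q f f2 + N f)) \<and> (\<forall>x. f1 x \<bullet> f1 x \<le> (2 * L + 1) * (Q f f2 + N f))"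
    if C: "C2c f f1 f2" for f f1 f2
  proof -
    note D = C2cD[OF C]
    have "N f2 \<le> (LINT x|lborel. 2 * (Dop f f2 x \<bullet> Dop f f2 x) + 2 * (\<bar>c\<bar> * M)\<^sup>2 * (f x \<bullet> f x))"
    proof (rule integral_mono)
      fix x
      define u where "u = (c * chi x) *\<^sub>R (\<i> * f x)"
      define v where "v = Dop f f2 x"
      have f2: "f2 x = u - v" by (simp add: u_def v_def DD_def)
      have "f2 x \<bullet> f2 x \<le> 2 * (v \<bullet> v) + 2 * (u \<bullet> u)"
        using inner_le_half[of u v] unfolding f2
        by (simp add: inner_diff_left inner_diff_right inner_commute[of v u])
      moreover have "u \<bullet> u \<le> (\<bar>c\<bar> * M)\<^sup>2 * (f x \<bullet> f x)"
      proof -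
        have "\<bar>c * chi x\<bar> \<le> \<bar>c\<bar> * M" using M(2)[of x] by (simp add: abs_mult mult_left_mono)
        then have "(c * chi x)\<^sup>2 \<le> (\<bar>c\<bar> * M)\<^sup>2" by (metis abs_ge_zero power2_abs power_mono)
        moreover have "u \<bullet> u = (c * chi x)\<^sup>2 * (f x \<bullet> f x)" by (simp add: u_def power2_eq_square)
        ultimately show ?thesis by (simp add: mult_right_mono)
      qed
      ultimately show "f2 x \<bullet> f2 x \<le> 2 * (Dop f f2 x \<bullet> Dop f f2 x) + 2 * (\<bar>c\<bar> * M)\<^sup>2 * (f x \<bullet> f x)"
        unfolding v_def by linarith
    qed (use int_N[OF C] in auto)
    also have "\<dots> = 2 * Q f f2 + 2 * (\<bar>c\<bar> * M)\<^sup>2 * N f" using int_N[OF C] by simp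
    also have "\<dots> \<le> L * Q f f2 + L * N f"
      using Q_nonneg[of f f2] N_nonneg[of f] by (intro add_mono mult_right_mono) (auto simp: L_def)
    finally have f2: "N f2 \<le> L * (Q f f2 + N f)" by (simp add: distrib_left)
    define E where "E = Q f f2 + N f"
    have E: "N f \<le> E" "0 \<le> E" "0 \<le> L * E" using Q_nonneg[of f f2] N_nonneg[of f] L by (simp_all add: E_def)
    have f2: "N f2 \<le> L * E" using f2 unfolding E_def .
    have f1: "N f1 \<le> (E + L * E) / 2"
      using order_trans[OF C2c_interpolation[OF C] divide_right_mono[OF add_mono[OF E(1) f2]]] by simp
    have EL: "2 * E \<le> L * E" using L E by (intro mult_right_mono) auto
    have "f x \<bullet> f x \<le> E + (E + L * E) / 2" for x
      using order_trans[OF sup_bound[of f f1 x] add_mono[OF E(1) f1]] D by blast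
    moreover have "f1 x \<bullet> f1 x \<le> (E + L * E) / 2 + L * E" for x
      using order_trans[OF sup_bound[of f1 f2 x] add_mono[OF f1 f2]] D by blast
    moreover have "(2 * L + 1) * E = 2 * (L * E) + E" by algebra
    moreover have "E + (E + L * E) / 2 \<le> 2 * (L * E) + E" "(E + L * E) / 2 + L * E \<le> 2 * (L * E) + E" "L * E \<le> 2 * (L * E) + E"
    proof -
      define P where "P = L * E"
      show "E + (E + L * E) / 2 \<le> 2 * (L * E) + E" "(E + L * E) / 2 + L * E \<le> 2 * (L * E) + E" "L * E \<le> 2 * (L * E) + E"
        using EL E(2,3) unfolding P_def[symmetric] by auto
    qed
    ultimately show ?thesis using f2 unfolding E_def[symmetric] by (simp only:) (blast intro: order_trans)
  qed
  moreover have "2 * L + 1 > 0" using L by simp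
  ultimately show ?thesis by blast
qed

text \<open>In \<open>tail_lower_bound\<close> the mass on [-R, R] tends to 0 by dominated
  convergence, the uniform bound on f serving as majorant, and the boundary products tend to 0
  because f' is bounded while f tends to 0 at the two points. Only the error proportional to
  \<open>d\<close> is left.\<close>

lemma vanishing:
  assumes C: "\<And>n. C2c (f n) (f1 n) (f2 n)"
    and B: "\<And>n. Q (f n) (f2 n) + N (f n) \<le> B"
    and lim: "\<And>x. (\<lambda>n. f n x) \<longlonglongrightarrow> 0" and e: "0 < e"
  shows "\<forall>\<^sub>F n in sequentially. c\<^sup>2 * N (f n) - e \<le> Q (f n) (f2 n)"
proof -
  obtain K where K: "K > 0" "\<And>n. N (f2 n) \<le> K * B" "\<And>n x. f n x \<bullet> f n x \<le> K * B" "\<And>n x. f1 n x \<bullet> f1 n x \<le> K * B"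
  proof -
    obtain K where K: "K > 0" "\<forall>f f1 f2. C2c f f1 f2 \<longrightarrow> N f2 \<le> K * (Q f f2 + N f) \<and>
      (\<forall>x. f x \<bullet> f x \<le> K * (Q f f2 + N f)) \<and> (\<forall>x. f1 x \<bullet> f1 x \<le> K * (Q f f2 + N f))"
      using apriori by blast
    have "K * (Q (f n) (f2 n) + N (f n)) \<le> K * B" for n using K(1) B by (simp add: mult_left_mono)
    then show ?thesis using that[OF K(1)] K(2) C by (meson order_trans)
  qed
  have B0: "0 \<le> B" using order_trans[OF add_nonneg_nonneg[OF Q_nonneg N_nonneg] B] .
  \<comment> \<open>Half of \<open>e\<close> pays for the error terms with N f and N f'', the other
    half for the local mass and the boundary products.\<close>
  define d where "d = e / (2 * (B + K * B + 1))"
  have den: "B + K * B + 1 > 0" using B0 K(1) by (simp add: add_nonneg_pos)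
  have d: "0 < d" "d * (B + K * B) \<le> e / 2"
  proof -
    show d0: "0 < d" using den e by (simp add: d_def)
    have "d * (B + K * B + 1) = e / 2" using den by (simp add: d_def field_simps)
    then show "d * (B + K * B) \<le> e / 2" using d0 by (simp add: distrib_left)
  qed
  obtain R where R: "\<And>f f1 f2. C2c f f1 f2 \<Longrightarrow>
     (c\<^sup>2 - d) * N f - d * N f2 - c\<^sup>2 * (LINT x|lborel. indicator {-R..R} x *\<^sub>R (f x \<bullet> f x))
       - 2 * \<bar>c\<bar> * (norm (f1 R) * norm (f R) + norm (f1 (-R)) * norm (f (-R))) \<le> Q f f2"
    using tail_lower_bound[OF d(1)] by blast
  have meas[measurable]: "f n \<in> borel_measurable borel" for n
    by (intro borel_measurable_continuous_onI C2cD[OF C])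
  have "(\<lambda>n. (LINT x|lborel. indicator {-R..R} x *\<^sub>R (f n x \<bullet> f n x))) \<longlonglongrightarrow> (LINT x|lborel. (indicator {-R..R} x *\<^sub>R (0 \<bullet> (0::complex)) :: real))"
  proof (rule integral_dominated_convergence[where w = "\<lambda>x. indicator {-R..R} x *\<^sub>R (K * B)"])
    show "integrable lborel (\<lambda>x. indicator {-R..R} x *\<^sub>R (K * B))"
      by (intro borel_integrable_compact) auto
    show "AE x in lborel. (\<lambda>n. indicator {-R..R} x *\<^sub>R (f n x \<bullet> f n x)) \<longlonglongrightarrow> (indicator {-R..R} x *\<^sub>R (0 \<bullet> (0::complex)) :: real)"
      by (intro AE_I2 tendsto_intros lim)
    show "AE x in lborel. norm (indicat_real {- R..R} x *\<^sub>R (f n x \<bullet> f n x)) \<le> indicat_real {- R..R} x *\<^sub>R (K * B)" for n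
      using K(3) by (auto simp: indicator_def)
  qed auto
  moreover have "(\<lambda>n. norm (f1 n y) * norm (f n y)) \<longlonglongrightarrow> 0" for y
  proof (rule Lim_null_comparison)
    have "norm (f1 n y) \<le> sqrt (K * B)" for n
      using K(4)[of n y] by (simp add: norm_eq_sqrt_inner)
    then show "\<forall>\<^sub>F n in sequentially. norm (norm (f1 n y) * norm (f n y)) \<le> sqrt (K * B) * norm (f n y)"
      by (intro always_eventually allI) (simp add: mult_right_mono)
    show "(\<lambda>n. sqrt (K * B) * norm (f n y)) \<longlonglongrightarrow> 0"
      using tendsto_mult_right_zero[OF tendsto_norm_zero[OF lim]] .
  qed
  ultimately have "(\<lambda>n. c\<^sup>2 * (LINT x|lborel. indicator {-R..R} x *\<^sub>R (f n x \<bullet> f n x))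
       + 2 * \<bar>c\<bar> * (norm (f1 n R) * norm (f n R) + norm (f1 n (-R)) * norm (f n (-R)))) \<longlonglongrightarrow> c\<^sup>2 * 0 + 2 * \<bar>c\<bar> * (0 + 0)"
    by (intro tendsto_intros) auto
  then have "\<forall>\<^sub>F n in sequentially. c\<^sup>2 * (LINT x|lborel. indicator {-R..R} x *\<^sub>R (f n x \<bullet> f n x))
       + 2 * \<bar>c\<bar> * (norm (f1 n R) * norm (f n R) + norm (f1 n (-R)) * norm (f n (-R))) < e / 2"
    using e by (intro order_tendstoD) auto
  then show ?thesis
  proof eventually_elim
    case (elim n)
    have "d * N (f n) + d * N (f2 n) \<le> d * (B + K * B)"
    proof -
      have "N (f n) \<le> B" using B[of n] Q_nonneg[of "f n" "f2 n"] by linarith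
      then have "d * (N (f n) + N (f2 n)) \<le> d * (B + K * B)"
        using d(1) K(2)[of n] by (intro mult_left_mono add_mono) auto
      then show ?thesis by (simp only: distrib_left)
    qed
    then show ?case using R[OF C[of n]] elim d(2) by (simp add: left_diff_distrib)
  qed
qed

text \<open>For every t, Q - lam N is nonnegative at a_n + t p. This is a quadratic polynomial in t
  whose constant term tends to 0, so by the discriminant its linear coefficient must tend to 0 too.
  No convergence of a_n is involved.\<close>

lemma euler_lagrange_limit:
  assumes C: "\<And>n. C2c (a n) (a1 n) (a2 n)" and N: "\<And>n. N (a n) = 1"
    and lim: "(\<lambda>n. Q (a n) (a2 n)) \<longlonglongrightarrow> lam" and p: "C2c p p1 p2"
  shows "(\<lambda>n. (LINT x|lborel. Dop (a n) (a2 n) x \<bullet> Dop p p2 x) - lam * (LINT x|lborel. a n x \<bullet> p x)) \<longlonglongrightarrow> 0"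
proof -
  define q where "q n = (LINT x|lborel. Dop (a n) (a2 n) x \<bullet> Dop p p2 x) - lam * (LINT x|lborel. a n x \<bullet> p x)" for n
  \<comment> \<open>The added 1 makes \<open>b\<close> positive even if Q - lam N vanishes at p, so
    that division by \<open>b\<close> is legitimate.\<close>
  define b where "b = Q p p2 - lam * N p + 1"
  have b: "b \<ge> 1" using lam_le[OF p] by (simp add: b_def)
  have quad: "0 \<le> (Q (a n) (a2 n) - lam) + 2 * t * q n + t\<^sup>2 * b" for n t
  proof -
    have C': "C2c (\<lambda>x. a n x + t *\<^sub>R p x) (\<lambda>x. a1 n x + t *\<^sub>R p1 x) (\<lambda>x. a2 n x + t *\<^sub>R p2 x)"
      by (intro C2c_add C C2c_scaleR p)
    have i: "integrable lborel (\<lambda>x. Dop (a n) (a2 n) x \<bullet> Dop p p2 x)" "integrable lborel (\<lambda>x. a n x \<bullet> p x)"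
      by (auto intro!: int_inner DD_cont[OF C] DD_cont[OF p] C2cD[OF C] C2cD[OF p])
    have "Q (\<lambda>x. a n x + t *\<^sub>R p x) (\<lambda>x. a2 n x + t *\<^sub>R p2 x)
        = (LINT x|lborel. Dop (a n) (a2 n) x \<bullet> Dop (a n) (a2 n) x + 2 * t * (Dop (a n) (a2 n) x \<bullet> Dop p p2 x) + t\<^sup>2 * (Dop p p2 x \<bullet> Dop p p2 x))"
      unfolding DD_linear inner_expand ..
    also have "\<dots> = Q (a n) (a2 n) + 2 * t * (LINT x|lborel. Dop (a n) (a2 n) x \<bullet> Dop p p2 x) + t\<^sup>2 * Q p p2"
      using i int_N[OF C] int_N[OF p] by simp
    finally have 1: "Q (\<lambda>x. a n x + t *\<^sub>R p x) (\<lambda>x. a2 n x + t *\<^sub>R p2 x) = \<dots>" .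
    have "N (\<lambda>x. a n x + t *\<^sub>R p x)
        = (LINT x|lborel. a n x \<bullet> a n x + 2 * t * (a n x \<bullet> p x) + t\<^sup>2 * (p x \<bullet> p x))"
      unfolding inner_expand ..
    also have "\<dots> = N (a n) + 2 * t * (LINT x|lborel. a n x \<bullet> p x) + t\<^sup>2 * N p"
      using i int_N[OF C] int_N[OF p] by simp
    finally have 2: "N (\<lambda>x. a n x + t *\<^sub>R p x) = \<dots>" .
    have "0 \<le> (Q (a n) (a2 n) - lam) + 2 * t * q n + t\<^sup>2 * (b - 1)"
      using lam_le[OF C'] unfolding 1 2 N q_def b_def by (simp add: algebra_simps)
    also have "\<dots> \<le> (Q (a n) (a2 n) - lam) + 2 * t * q n + t\<^sup>2 * b" by (simp add: algebra_simps)
    finally show ?thesis .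
  qed
  have "(q n)\<^sup>2 \<le> (Q (a n) (a2 n) - lam) * b" for n
  proof -
    \<comment> \<open>The value t = - q n / b minimises the quadratic; the factor \<open>b\<close>
      clears the denominator.\<close>
    have "0 \<le> b * ((Q (a n) (a2 n) - lam) + 2 * (- q n / b) * q n + (- q n / b)\<^sup>2 * b)"
      using quad[of n "- q n / b"] b by (intro mult_nonneg_nonneg) auto
    also have "\<dots> = (Q (a n) (a2 n) - lam) * b - (q n)\<^sup>2"
      using b by (simp add: field_simps power2_eq_square)
    finally show ?thesis by simp
  qed
  moreover have "(\<lambda>n. (Q (a n) (a2 n) - lam) * b) \<longlonglongrightarrow> 0"
    using tendsto_mult_left_zero[OF LIM_zero[OF lim]] .
  ultimately have "(\<lambda>n. (q n)\<^sup>2) \<longlonglongrightarrow> 0"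
    by (intro tendsto_sandwich[where f = "\<lambda>_. 0" and g = "\<lambda>n. (q n)\<^sup>2"
          and h = "\<lambda>n. (Q (a n) (a2 n) - lam) * b"] always_eventually allI) auto
  then have "(\<lambda>n. sqrt ((q n)\<^sup>2)) \<longlonglongrightarrow> sqrt 0" by (rule tendsto_real_sqrt)
  then show ?thesis unfolding q_def[symmetric] by (simp add: tendsto_rabs_zero_iff)
qed

text \<open>The formal adjoint of D: the second derivative is symmetric, and multiplication by i is
  skew for the real inner product.\<close>

definition Dstar :: "(real \<Rightarrow> complex) \<Rightarrow> (real \<Rightarrow> complex) \<Rightarrow> real \<Rightarrow> complex" where
  "Dstar g g2 x = - ((c * chi x) *\<^sub>R (\<i> * g x)) - g2 x"

text \<open>Only g has compact support. This serves the minimising sequence and later the solution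
  \<open>a\<close> itself.\<close>

lemma Dstar_adjoint:
  assumes f: "\<And>x. (f has_vector_derivative f1 x) (at x)" "\<And>x. (f1 has_vector_derivative f2 x) (at x)"
    "continuous_on UNIV f2" and g: "C2c g g1 g2"
  shows "(LINT x|lborel. Dop f f2 x \<bullet> g x) = (LINT x|lborel. f x \<bullet> Dstar g g2 x)"
proof -
  note D = C2cD[OF g]
  have cf: "continuous_on UNIV f" "continuous_on UNIV f1"
    using f by (meson continuous_at_imp_continuous_on has_vector_derivative_continuous)+
  have "(LINT x|lborel. f2 x \<bullet> g x) = - (LINT x|lborel. f1 x \<bullet> g1 x)"
    by (rule integral_by_parts_cs) (use f D in auto)
  also have "(LINT x|lborel. f1 x \<bullet> g1 x) = - (LINT x|lborel. f x \<bullet> g2 x)"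
    by (rule integral_by_parts_cs) (use f cf D in auto)
  finally have 1: "(LINT x|lborel. f2 x \<bullet> g x) = (LINT x|lborel. f x \<bullet> g2 x)" by simp
  have "(LINT x|lborel. Dop f f2 x \<bullet> g x) = (LINT x|lborel. ((c * chi x) *\<^sub>R (\<i> * f x)) \<bullet> g x) - (LINT x|lborel. f2 x \<bullet> g x)"
    unfolding DD_def inner_diff_left
    by (intro Bochner_Integration.integral_diff int_inner continuous_intros chi_cont cf f D disjI2)
  also have "\<dots> = (LINT x|lborel. f x \<bullet> (- ((c * chi x) *\<^sub>R (\<i> * g x)))) - (LINT x|lborel. f x \<bullet> g2 x)"
    unfolding 1 by (simp add: inner_complex_def algebra_simps)
  also have "\<dots> = (LINT x|lborel. f x \<bullet> Dstar g g2 x)"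
    unfolding Dstar_def inner_diff_right
    by (intro Bochner_Integration.integral_diff[symmetric] int_inner continuous_intros chi_cont cf f D disjI2 csupp_mono[OF D(6)]) auto
  finally show ?thesis .
qed

end

subsection \<open>Existence of a minimiser\<close>

lemma vector_derivative_bound:
  assumes "\<And>x. (f has_vector_derivative f' x) (at x)" "\<And>x. norm (f' x) \<le> B"
  shows "norm (f x - f y) \<le> B * \<bar>x - y\<bar>"
proof -
  have "norm (f x - f y) \<le> B * norm (x - y)"
  proof (rule differentiable_bound[of UNIV f "\<lambda>x h. h *\<^sub>R f' x"])
    show "onorm (\<lambda>h. h *\<^sub>R f' x) \<le> B" for x
      using assms(2)[of x] by (simp add: onorm_scaleR_left onorm_id)
  qed (use assms(1) in \<open>auto simp: has_vector_derivative_def\<close>)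
  then show ?thesis by simp
qed

text \<open>Fatou's lemma; it turns uniform bounds along a sequence or along cutoffs into
  square-integrability when no majorant is known.\<close>

lemma fatou_bound:
  fixes u :: "nat \<Rightarrow> 'a \<Rightarrow> real"
  assumes u: "\<And>n. integrable M (u n)" "\<And>n x. 0 \<le> u n x" "\<And>n. integral\<^sup>L M (u n) \<le> C"
    and lim: "\<And>x. (\<lambda>n. u n x) \<longlonglongrightarrow> v x"
  shows "integrable M v" "integral\<^sup>L M v \<le> C"
proof -
  have v: "v \<in> borel_measurable M"
    by (rule borel_measurable_LIMSEQ_metric[of u]) (use u lim in auto)
  have v0: "0 \<le> v x" for x by (rule LIMSEQ_le_const[OF lim]) (use u in auto)
  have C: "0 \<le> C" using u(3)[of 0] Bochner_Integration.integral_nonneg[of M "u 0"] u(2)[of 0] by (meson order_trans)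
  have "(\<integral>\<^sup>+x. ennreal (v x) \<partial>M) = (\<integral>\<^sup>+x. liminf (\<lambda>n. ennreal (u n x)) \<partial>M)"
    using lim by (intro nn_integral_cong lim_imp_Liminf[symmetric] tendsto_ennrealI) auto
  also have "\<dots> \<le> liminf (\<lambda>n. \<integral>\<^sup>+x. ennreal (u n x) \<partial>M)"
    using u(1) by (intro nn_integral_liminf) auto
  also have "\<dots> \<le> liminf (\<lambda>n::nat. ennreal C)"
    using u by (intro Liminf_mono always_eventually allI) (simp add: nn_integral_eq_integral ennreal_leI)
  also have "\<dots> = ennreal C" by (simp add: Liminf_const)
  finally have *: "(\<integral>\<^sup>+x. ennreal (v x) \<partial>M) \<le> ennreal C" .
  show "integrable M v"
    using v v0 * by (intro integrableI_nonneg) (auto simp: le_less_trans[OF _ ennreal_less_top])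
  then show "integral\<^sup>L M v \<le> C"
    using * v0 C by (simp add: nn_integral_eq_integral)
qed

context wall
begin

text \<open>The last two conclusions are the weak traces of D* D a = lam a and of D a in L^2. The
  second is stated by duality because \<open>a\<close> is only known to be continuous at this point;
  \<open>eigenpair\<close> exploits it with a truncation of D a as g.\<close>

lemma minimiser:
  assumes "C2c f0 f01 f02" "Q f0 f02 < c\<^sup>2 * N f0"
  obtains a B where "0 \<le> lam" "lam < c\<^sup>2" "continuous_on UNIV a" "integrable lborel (\<lambda>x. a x \<bullet> a x)"
    "\<exists>x. a x \<noteq> 0"
    "\<And>p p1 p2 g1 g2. C2c p p1 p2 \<Longrightarrow> C2c (Dop p p2) g1 g2 \<Longrightarrow>
       (LINT x|lborel. a x \<bullet> Dstar (Dop p p2) g2 x) = lam * (LINT x|lborel. a x \<bullet> p x)"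
    "\<And>g g1 g2. C2c g g1 g2 \<Longrightarrow> (LINT x|lborel. a x \<bullet> Dstar g g2 x) \<le> (B + N g) / 2"
proof -
  let ?A = "{Q f f2 | f f1 f2. C2c f f1 f2 \<and> N f = 1}"
  have N0: "N f0 > 0"
  proof (rule ccontr)
    assume "\<not> N f0 > 0"
    then have "N f0 = 0" using N_nonneg[of f0] by linarith
    then show False using assms(2) Q_nonneg[of f0 f02] by simp
  qed
  note ne = normalise[OF assms(1) N0]
  have lam0: "0 \<le> lam"
    unfolding lam_def using ne Q_nonneg by (intro cInf_greatest) auto
  have "lam \<le> Q f0 f02 / N f0" unfolding lam_def by (rule cInf_lower[OF ne lam_bdd])
  also have "\<dots> < c\<^sup>2" using assms(2) N0 by (simp add: pos_divide_less_eq)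
  finally have lamc: "lam < c\<^sup>2" .
  have "\<forall>n. \<exists>f f1 f2. C2c f f1 f2 \<and> N f = 1 \<and> Q f f2 < lam + 1 / real (Suc n)"
  proof
    fix n
    have "Inf ?A < lam + 1 / real (Suc n)" unfolding lam_def[symmetric] by simp
    then obtain y where "y \<in> ?A" "y < lam + 1 / real (Suc n)" using cInf_lessD[of ?A] ne by blast
    then show "\<exists>f f1 f2. C2c f f1 f2 \<and> N f = 1 \<and> Q f f2 < lam + 1 / real (Suc n)" by blast
  qed
  then obtain f f1 f2 where f: "\<And>n. C2c (f n) (f1 n) (f2 n)" "\<And>n. N (f n) = 1"
      "\<And>n. Q (f n) (f2 n) < lam + 1 / real (Suc n)"
    unfolding choice_iff by blast
  obtain L where L: "0 \<le> L" "\<And>n x. norm (f n x) \<le> L" "\<And>n x. norm (f1 n x) \<le> L"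
  proof -
    obtain K where K: "K > 0" and KK: "\<forall>f f1 f2. C2c f f1 f2 \<longrightarrow> N f2 \<le> K * (Q f f2 + N f) \<and>
      (\<forall>x. f x \<bullet> f x \<le> K * (Q f f2 + N f)) \<and> (\<forall>x. f1 x \<bullet> f1 x \<le> K * (Q f f2 + N f))"
      using apriori by blast
    have "K * (Q (f n) (f2 n) + N (f n)) \<le> K * (lam + 2)" for n
    proof (rule mult_left_mono)
      have "1 / real (Suc n) \<le> 1" by simp
      then show "Q (f n) (f2 n) + N (f n) \<le> lam + 2" using f(2)[of n] f(3)[of n] by linarith
    qed (use K in simp)
    then have "f n x \<bullet> f n x \<le> K * (lam + 2)" "f1 n x \<bullet> f1 n x \<le> K * (lam + 2)" for n x
      using KK f(1) by (blast intro: order_trans)+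
    then show ?thesis
      using that[of "sqrt (K * (lam + 2))"] K lam0 by (simp add: norm_eq_sqrt_inner)
  qed
  \<comment> \<open>A diagonal subsequence converges at the rationals; the common Lipschitz constant
    \<open>L\<close> spreads the convergence to all points.\<close>
  obtain k where k: "strict_mono (k::nat\<Rightarrow>nat)" "\<And>x. x \<in> \<rat> \<Longrightarrow> \<exists>l. (\<lambda>n. f (k n) x) \<longlonglongrightarrow> l"
    by (rule function_convergent_subsequence[OF countable_rat, of f L]) (use L(2) in auto)
  define b b1 b2 where "b n = f (k n)" and "b1 n = f1 (k n)" and "b2 n = f2 (k n)" for n
  have bC: "C2c (b n) (b1 n) (b2 n)" and bN: "N (b n) = 1" and bL: "norm (b n x) \<le> L" for n x
    unfolding b_def b1_def b2_def using f L by auto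
  note D = C2cD[OF bC]
  have "(\<lambda>n. Q (f n) (f2 n)) \<longlonglongrightarrow> lam"
  proof (rule tendsto_sandwich[where f = "\<lambda>_. lam" and h = "\<lambda>n. lam + 1 / real (Suc n)"])
    show "\<forall>\<^sub>F n in sequentially. lam \<le> Q (f n) (f2 n)"
      using lam_le[OF f(1)] f(2) by (intro always_eventually allI) (metis mult.right_neutral)
    show "\<forall>\<^sub>F n in sequentially. Q (f n) (f2 n) \<le> lam + 1 / real (Suc n)"
      using f(3) by (intro always_eventually allI less_imp_le)
    show "(\<lambda>n. lam + 1 / real (Suc n)) \<longlonglongrightarrow> lam"
      using tendsto_add[OF tendsto_const LIMSEQ_inverse_real_of_nat, of lam] by (simp add: inverse_eq_divide)
  qed simp
  then have bQ: "(\<lambda>n. Q (b n) (b2 n)) \<longlonglongrightarrow> lam"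
    unfolding b_def b2_def using LIMSEQ_subseq_LIMSEQ[OF _ k(1)] by (auto simp: o_def)
  have bQ1: "Q (b n) (b2 n) \<le> lam + 1" for n
  proof -
    have "1 / real (Suc (k n)) \<le> 1" by simp
    then show ?thesis unfolding b_def b2_def using f(3)[of "k n"] by linarith
  qed
  have lip: "norm (b n x - b n y) \<le> L * \<bar>x - y\<bar>" for n x y
    using vector_derivative_bound[of "b n" "b1 n" L x y] D(1) L(3) unfolding b1_def by auto
  have "\<exists>l. (\<lambda>n. b n x) \<longlonglongrightarrow> l" for x
  proof -
    have "Cauchy (\<lambda>n. b n x)"
    proof (rule metric_CauchyI)
      fix e :: real assume e: "0 < e"
      \<comment> \<open>The argument splits e into three thirds; L + 1 replaces \<open>L\<close> so
        that the denominator is positive even if \<open>L\<close> is 0.\<close>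
      define d where "d = e / (3 * (L + 1))"
      have d: "d > 0" "L * d \<le> e / 3" using e L(1) by (simp_all add: d_def field_simps)
      obtain y where y: "y \<in> \<rat>" "x < y" "y < x + d" using Rats_dense_in_real[of x "x + d"] d by auto
      then obtain l where "(\<lambda>n. b n y) \<longlonglongrightarrow> l" using k(2) unfolding b_def by blast
      then have "Cauchy (\<lambda>n. b n y)" by (rule LIMSEQ_imp_Cauchy)
      then obtain M where M: "\<And>m n. M \<le> m \<Longrightarrow> M \<le> n \<Longrightarrow> dist (b m y) (b n y) < e / 3"
        using metric_CauchyD[of "\<lambda>n. b n y" "e / 3"] e by auto
      have near: "dist (b n x) (b n y) \<le> e / 3" for n
      proof -
        have "L * \<bar>x - y\<bar> \<le> L * d" using y L(1) by (intro mult_left_mono) auto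
        then show ?thesis using lip[of n x y] d(2) by (simp add: dist_norm)
      qed
      have "dist (b m x) (b n x) < e" if "M \<le> m" "M \<le> n" for m n
        using M[OF that] dist_triangle[of "b m x" "b n x" "b m y"] dist_triangle[of "b m y" "b n x" "b n y"]
          near[of m] near[of n] dist_commute[of "b n y" "b n x"] by linarith
      then show "\<exists>M. \<forall>m\<ge>M. \<forall>n\<ge>M. dist (b m x) (b n x) < e" by blast
    qed
    then show ?thesis by (simp add: Cauchy_convergent_iff convergent_def)
  qed
  then obtain a where a: "\<And>x. (\<lambda>n. b n x) \<longlonglongrightarrow> a x" by metis
  have lipa: "norm (a x - a y) \<le> L * \<bar>x - y\<bar>" for x y
    using tendsto_norm[OF tendsto_diff[OF a[of x] a[of y]]] lip
    by (intro LIMSEQ_le_const2[where X = "\<lambda>n. norm (b n x - b n y)"]) auto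
  have ca: "continuous_on UNIV a"
    by (rule lipschitz_on_continuous_on[of L]) (auto intro!: lipschitz_onI simp: dist_norm L lipa)
  have [measurable]: "a \<in> borel_measurable borel" "b n \<in> borel_measurable borel" for n
    by (intro borel_measurable_continuous_onI ca D)+
  have inta: "integrable lborel (\<lambda>x. a x \<bullet> a x)"
    by (rule fatou_bound(1)[of _ "\<lambda>n x. b n x \<bullet> b n x" 1])
       (use bN int_N(1)[OF bC] in \<open>auto intro!: tendsto_intros a\<close>)
  \<comment> \<open>A zero limit would, by \<open>vanishing\<close>, force Q to stay above the
    midpoint of lam and c^2, whereas Q tends to lam.\<close>
  have nz: "\<exists>x. a x \<noteq> 0"
  proof (rule ccontr)
    assume "\<not> (\<exists>x. a x \<noteq> 0)"
    then have b0: "(\<lambda>n. b n x) \<longlonglongrightarrow> 0" for x using a[of x] by simp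
    have "\<forall>\<^sub>F n in sequentially. c\<^sup>2 * N (b n) - (c\<^sup>2 - lam) / 2 \<le> Q (b n) (b2 n)"
    proof (rule vanishing[OF bC _ b0, where B = "lam + 2"])
      show "Q (b n) (b2 n) + N (b n) \<le> lam + 2" for n using bQ1[of n] bN[of n] by linarith
    qed (use lamc in simp)
    moreover have "\<forall>\<^sub>F n in sequentially. Q (b n) (b2 n) < lam + (c\<^sup>2 - lam) / 2"
      using bQ lamc by (intro order_tendstoD) auto
    ultimately have "\<forall>\<^sub>F n in sequentially. False"
      by eventually_elim (use bN in \<open>simp add: field_simps\<close>)
    then show False by simp
  qed
  \<comment> \<open>Pointwise convergence and the uniform bound \<open>L\<close> suffice once the
    other factor is continuous with compact support.\<close>
  have conv: "(\<lambda>n. LINT x|lborel. b n x \<bullet> h x) \<longlonglongrightarrow> (LINT x|lborel. a x \<bullet> h x)"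
    if h: "continuous_on UNIV h" "csupp h" for h
  proof (rule integral_dominated_convergence[where w = "\<lambda>x. L * norm (h x)"])
    have [measurable]: "h \<in> borel_measurable borel" by (rule borel_measurable_continuous_onI[OF h(1)])
    show "(\<lambda>x. a x \<bullet> h x) \<in> borel_measurable lborel" "(\<lambda>x. b n x \<bullet> h x) \<in> borel_measurable lborel" for n by measurable
    show "integrable lborel (\<lambda>x. L * norm (h x))"
      by (intro csupp_integrable continuous_intros h csupp_mono[OF h(2)]) simp
    show "AE x in lborel. (\<lambda>n. b n x \<bullet> h x) \<longlonglongrightarrow> a x \<bullet> h x" by (intro AE_I2 tendsto_intros a)
    show "AE x in lborel. norm (b n x \<bullet> h x) \<le> L * norm (h x)" for n
    proof (rule AE_I2)
      fix x show "norm (b n x \<bullet> h x) \<le> L * norm (h x)"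
        using Cauchy_Schwarz_ineq2[of "b n x" "h x"] mult_right_mono[OF bL[of n x], of "norm (h x)"] by auto
    qed
  qed
  have Dst: "continuous_on UNIV (Dstar g g2)" "csupp (Dstar g g2)" if "C2c g g1 g2" for g g1 g2
    unfolding Dstar_def using C2cD[OF that]
    by (auto intro!: continuous_intros chi_cont csupp_combine[of g g2])
  \<comment> \<open>The derivatives of \<open>b n\<close> need not converge, so D is transferred to
    the test function before the limit is taken.\<close>
  have adj: "(LINT x|lborel. Dop (b n) (b2 n) x \<bullet> g x) = (LINT x|lborel. b n x \<bullet> Dstar g g2 x)"
    if "C2c g g1 g2" for n g g1 g2
    by (rule Dstar_adjoint[OF D(1) D(2) D(5) that])
  show ?thesis
  proof (rule that[of a "lam + 1", OF lam0 lamc ca inta nz])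
    fix p p1 p2 g1 g2 assume p: "C2c p p1 p2" and g: "C2c (Dop p p2) g1 g2"
    have "(\<lambda>n. (LINT x|lborel. b n x \<bullet> Dstar (Dop p p2) g2 x) - lam * (LINT x|lborel. b n x \<bullet> p x))
       \<longlonglongrightarrow> (LINT x|lborel. a x \<bullet> Dstar (Dop p p2) g2 x) - lam * (LINT x|lborel. a x \<bullet> p x)"
      by (intro tendsto_intros conv Dst[OF g] C2cD[OF p])
    moreover have "(\<lambda>n. (LINT x|lborel. b n x \<bullet> Dstar (Dop p p2) g2 x) - lam * (LINT x|lborel. b n x \<bullet> p x)) \<longlonglongrightarrow> 0"
      using euler_lagrange_limit[OF bC bN bQ p] unfolding adj[OF g] .
    ultimately have "(LINT x|lborel. a x \<bullet> Dstar (Dop p p2) g2 x) - lam * (LINT x|lborel. a x \<bullet> p x) = 0"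
      by (rule LIMSEQ_unique)
    then show "(LINT x|lborel. a x \<bullet> Dstar (Dop p p2) g2 x) = lam * (LINT x|lborel. a x \<bullet> p x)" by simp
  next
    fix g g1 g2 assume g: "C2c g g1 g2"
    have "(LINT x|lborel. b n x \<bullet> Dstar g g2 x) \<le> (lam + 1 + N g) / 2" for n
    proof -
      have "(LINT x|lborel. Dop (b n) (b2 n) x \<bullet> g x)
          \<le> (LINT x|lborel. (Dop (b n) (b2 n) x \<bullet> Dop (b n) (b2 n) x + g x \<bullet> g x) / 2)"
      proof (rule integral_mono)
        show "integrable lborel (\<lambda>x. Dop (b n) (b2 n) x \<bullet> g x)"
          by (intro int_inner DD_cont[OF bC] C2cD[OF g] disjI2)
        show "integrable lborel (\<lambda>x. (Dop (b n) (b2 n) x \<bullet> Dop (b n) (b2 n) x + g x \<bullet> g x) / 2)"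
          using int_N(4)[OF bC] int_N(1)[OF g] by simp
        show "Dop (b n) (b2 n) x \<bullet> g x \<le> (Dop (b n) (b2 n) x \<bullet> Dop (b n) (b2 n) x + g x \<bullet> g x) / 2" for x
          by (rule order_trans[OF abs_ge_self inner_le_half])
      qed
      also have "\<dots> = (Q (b n) (b2 n) + N g) / 2"
        using int_N(4)[OF bC] int_N(1)[OF g] by simp
      also have "\<dots> \<le> (lam + 1 + N g) / 2" using bQ1[of n] by simp
      finally show ?thesis unfolding adj[OF g] .
    qed
    then show "(LINT x|lborel. a x \<bullet> Dstar g g2 x) \<le> (lam + 1 + N g) / 2"
      by (intro LIMSEQ_le_const2[OF conv[OF Dst[OF g]]]) auto
  qed
qed

end

subsection \<open>The lemma of du Bois-Reymond\<close>

text \<open>A compactly supported C^n function together with its derivatives up to order n, indexed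
  by the order. Test functions of finite order can be built from polynomials and by integration,
  which smooth ones do not allow as easily.\<close>

definition jet :: "nat \<Rightarrow> (nat \<Rightarrow> real \<Rightarrow> real) \<Rightarrow> bool" where
  "jet n \<phi> \<longleftrightarrow> (\<forall>k<n. \<forall>x. (\<phi> k has_real_derivative \<phi> (Suc k) x) (at x)) \<and>
     continuous_on UNIV (\<phi> n) \<and> csupp (\<phi> 0)"

lemma jet_deriv: "jet n \<phi> \<Longrightarrow> k < n \<Longrightarrow> (\<phi> k has_vector_derivative \<phi> (Suc k) x) (at x)"
  unfolding jet_def has_real_derivative_iff_has_vector_derivative by blast

lemma jet_cs:
  assumes "jet n \<phi>" "k \<le> n"
  shows "csupp (\<phi> k)"
  using assms(2)
proof (induction k)
  case 0
  then show ?case using assms(1) unfolding jet_def by blast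
next
  case (Suc k)
  then show ?case using jet_deriv[OF assms(1), of k] csupp_deriv by (meson Suc_leD Suc_le_lessD)
qed

lemma jet_cont:
  assumes "jet n \<phi>" "k \<le> n"
  shows "continuous_on UNIV (\<phi> k)"
proof (cases "k = n")
  case False
  then show ?thesis using jet_deriv[OF assms(1), of k] assms(2)
    by (meson continuous_at_imp_continuous_on has_vector_derivative_continuous le_neq_implies_less)
qed (use assms in \<open>auto simp: jet_def\<close>)

lemma jet_le:
  assumes "jet n \<phi>" "m \<le> n"
  shows "jet m \<phi>"
  using assms jet_cont[OF assms] by (auto simp: jet_def)

text \<open>Only t = 0 needs an argument: there the difference quotient is at most
  |h|^(p+1).\<close>

lemma has_real_derivative_power_pos_part:
  "((\<lambda>t::real. max 0 t ^ Suc (Suc p)) has_real_derivative real (Suc (Suc p)) * max 0 t ^ Suc p) (at t)"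
proof -
  consider "t > 0" | "t < 0" | "t = 0" by linarith
  then show ?thesis
  proof cases
    case 1
    have "((\<lambda>t::real. t ^ Suc (Suc p)) has_real_derivative real (Suc (Suc p)) * max 0 t ^ Suc p) (at t)"
      using DERIV_pow[of "Suc (Suc p)" t] 1 by (simp add: max_def)
    then show ?thesis
      by (rule has_field_derivative_transform_within_open[where S = "{0<..}"]) (use 1 in auto)
  next
    case 2
    have "((\<lambda>t::real. 0) has_real_derivative real (Suc (Suc p)) * max 0 t ^ Suc p) (at t)"
      using 2 by (auto simp: max_def)
    then show ?thesis
      by (rule has_field_derivative_transform_within_open[where S = "{..<0}"]) (use 2 in auto)
  next
    case 3
    have "((\<lambda>h::real. (max 0 (0 + h) ^ Suc (Suc p) - max 0 0 ^ Suc (Suc p)) / h) \<longlongrightarrow> 0) (at 0)"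
    proof (rule Lim_null_comparison)
      have "norm ((max 0 (0 + h) ^ Suc (Suc p) - max 0 0 ^ Suc (Suc p)) / h) \<le> \<bar>h\<bar> ^ Suc p" if "h \<noteq> 0" for h :: real
      proof (cases "h > 0")
        case False
        then have "max 0 h = 0" by simp
        then show ?thesis by (simp del: power_Suc add: power_0_left)
      qed (auto simp: max_def)
      then show "\<forall>\<^sub>F h in at 0. norm ((max 0 (0 + h) ^ Suc (Suc p) - max 0 0 ^ Suc (Suc p)) / h) \<le> \<bar>h\<bar> ^ Suc p"
        by (auto simp: eventually_at_filter)
      have "((\<lambda>h::real. \<bar>h\<bar> ^ Suc p) \<longlongrightarrow> \<bar>0\<bar> ^ Suc p) (at 0)" by (intro tendsto_intros)
      then show "((\<lambda>h::real. \<bar>h\<bar> ^ Suc p) \<longlongrightarrow> 0) (at 0)" by simp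
    qed
    then show ?thesis unfolding 3 DERIV_def by simp
  qed
qed

text \<open>The bump is \<open>max 0 (1 - x\<^sup>2) ^ Suc n\<close>; its derivatives are polynomial multiples of lower powers.\<close>

lemma bump_jet: "\<exists>\<phi>. jet n \<phi> \<and> (\<forall>x. 0 \<le> \<phi> 0 x \<and> \<phi> 0 x \<le> 1) \<and> \<phi> 0 0 = 1"
proof -
  define w :: "real \<Rightarrow> real" where "w x = max 0 (1 - x\<^sup>2)" for x
  \<comment> \<open>The recursion is the product rule for q_k w^(n+1-k), with one power of w split
    off the first term and written as the polynomial 1 - x^2. The starting exponent n + 1 leaves w
    itself at order n, which is still continuous.\<close>
  define q :: "nat \<Rightarrow> real poly" where
    "q = rec_nat 1 (\<lambda>k r. pderiv r * [:1, 0, -1:] + smult (- 2 * real (Suc n - k)) (r * [:0, 1:]))"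
  have q: "q 0 = 1" "q (Suc k) = pderiv (q k) * [:1, 0, -1:] + smult (- 2 * real (Suc n - k)) (q k * [:0, 1:])" for k
    by (simp_all add: q_def)
  define \<phi> where "\<phi> k x = poly (q k) x * w x ^ (Suc n - k)" for k x
  have wd: "((\<lambda>x. w x ^ Suc (Suc p)) has_real_derivative real (Suc (Suc p)) * w x ^ Suc p * (- 2 * x)) (at x)" for p x
  proof -
    have "((\<lambda>x::real. 1 - x\<^sup>2) has_real_derivative - 2 * x) (at x)"
      by (auto intro!: derivative_eq_intros)
    from DERIV_chain2[OF has_real_derivative_power_pos_part this, of p] show ?thesis unfolding w_def by simp
  qed
  have "(\<phi> k has_real_derivative \<phi> (Suc k) x) (at x)" if k: "k < n" for k x
  proof -
    obtain p where "n = Suc (k + p)" using less_imp_Suc_add[OF k] by blast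
    then have p: "Suc n - k = Suc (Suc p)" "Suc n - Suc k = Suc p" by simp_all
    \<comment> \<open>Where w differs from 1 - x^2 it is 0, so the remaining power of w removes the
      discrepancy.\<close>
    have ww: "poly (pderiv (q k)) x * w x ^ Suc (Suc p) = poly (pderiv (q k)) x * (1 - x\<^sup>2) * w x ^ Suc p"
      by (auto simp: w_def max_def)
    have "((\<lambda>x. poly (q k) x * w x ^ Suc (Suc p)) has_real_derivative
        poly (pderiv (q k)) x * w x ^ Suc (Suc p) + poly (q k) x * (real (Suc (Suc p)) * w x ^ Suc p * (- 2 * x))) (at x)"
      by (rule DERIV_mult'[OF poly_DERIV wd, THEN DERIV_cong]) (simp add: algebra_simps)
    then show ?thesis
      unfolding ww \<phi>_def p q(2) by (rule DERIV_cong) (simp add: algebra_simps power2_eq_square)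
  qed
  moreover have "continuous_on UNIV (\<phi> n)" unfolding \<phi>_def w_def by (intro continuous_intros)
  moreover have "csupp (\<phi> 0)"
  proof (rule csuppI[of 1])
    fix x :: real assume "1 < \<bar>x\<bar>"
    then have "1 < x\<^sup>2" using abs_square_le_1[of x] by linarith
    then show "\<phi> 0 x = 0" by (simp add: \<phi>_def w_def)
  qed
  moreover have "0 \<le> \<phi> 0 x \<and> \<phi> 0 x \<le> 1" "\<phi> 0 0 = 1" for x
    unfolding \<phi>_def q(1) w_def by (auto intro!: power_le_one simp del: power_Suc)
  ultimately show ?thesis unfolding jet_def by blast
qed

lemma AE_zero_continuous:
  fixes f :: "real \<Rightarrow> 'a::real_normed_vector"
  assumes f: "continuous_on UNIV f" and AE: "AE x in lborel. f x = 0"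
  shows "f x = 0"
proof (rule ccontr)
  assume "f x \<noteq> 0"
  have "open {x. f x \<noteq> 0}" using f by (simp add: open_Collect_neq)
  then obtain e where e: "e > 0" "ball x e \<subseteq> {x. f x \<noteq> 0}"
    using \<open>f x \<noteq> 0\<close> unfolding open_contains_ball by blast
  have "AE y in lborel. y \<notin> {x - e <..< x + e}"
    using AE by eventually_elim (use e(2) in \<open>auto simp: subset_eq dist_real_def abs_less_iff\<close>)
  then have "emeasure lborel {x - e <..< x + e} = 0"
    by (subst (asm) AE_iff_null_sets[symmetric]) auto
  then show False using e(1) by simp
qed

lemma integral_zero_continuous:
  fixes f :: "real \<Rightarrow> real"
  assumes "continuous_on UNIV f" "integrable lborel f" "\<And>x. 0 \<le> f x" "(LINT x|lborel. f x) = 0"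
  shows "f x = 0"
  using assms by (intro AE_zero_continuous[of f]) (auto simp: integral_nonneg_eq_0_iff_AE)

lemma antiderivative:
  fixes h :: "real \<Rightarrow> 'a::euclidean_space"
  assumes "continuous_on UNIV h"
  obtains H where "\<And>x. (H has_vector_derivative h x) (at x)"
proof -
  have "((\<lambda>u. LBINT y=0..u. h y) has_vector_derivative h x) (at x)" for x
  proof -
    define b where "b = \<bar>x\<bar> + 1"
    have b: "-b \<le> 0" "0 \<le> b" "-b \<le> x" "x \<le> b" "x \<in> interior {-b..b}" by (auto simp: b_def)
    have "((\<lambda>u. LBINT y=0..u. h y) has_vector_derivative h x) (at x within {-b..b})"
      using interval_integral_FTC2[of "-b" 0 b h x] b continuous_on_subset[OF assms] by (auto simp: zero_ereal_def)
    then show ?thesis using b(5) by (metis at_within_interior)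
  qed
  then show ?thesis using that by blast
qed

text \<open>Any antiderivative is constant on each side of the support, and the zero integral makes
  the two constants equal; subtracting that value gives compact support.\<close>

lemma csupp_antiderivative:
  fixes h :: "real \<Rightarrow> 'a::euclidean_space"
  assumes h: "continuous_on UNIV h" "csupp h" "(LINT x|lborel. h x) = 0"
  obtains H where "\<And>x. (H has_vector_derivative h x) (at x)" "csupp H"
proof -
  obtain H where H: "\<And>x. (H has_vector_derivative h x) (at x)" using antiderivative[OF h(1)] by blast
  obtain R where R: "\<And>x. R < \<bar>x\<bar> \<Longrightarrow> h x = 0" "0 < R" using csuppE[OF h(2)] by blast
  have FTC: "(LINT x|lborel. indicator {a..b} x *\<^sub>R h x) = H b - H a" if "a \<le> b" for a b
    by (rule integral_FTC_atLeastAtMost[OF that])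
       (use H h in \<open>auto intro: has_vector_derivative_at_within continuous_on_subset\<close>)
  define H0 where "H0 x = H x - H (- R - 1)" for x
  have left: "H x = H (- R - 1)" if "x < - R" for x
  proof -
    have z: "(LINT x|lborel. indicator {a..b} x *\<^sub>R h x) = 0" if "b < -R" for a b
      by (rule integral_eq_zero_AE, rule AE_I2) (use that R in \<open>auto simp: indicator_def\<close>)
    show ?thesis
      using FTC[of x "-R-1"] FTC[of "-R-1" x] z[of "-R-1" x] z[of x "-R-1"] that by (cases "x \<le> -R-1") auto
  qed
  have right: "H x = H (- R - 1)" if "R < x" for x
  proof -
    have "(LINT y|lborel. indicator {-R-1..x} y *\<^sub>R h y) = (LINT y|lborel. h y)"
      by (rule Bochner_Integration.integral_cong) (use that R in \<open>auto simp: indicator_def abs_if\<close>)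
    then show ?thesis using FTC[of "-R-1" x] that R h(3) by simp
  qed
  have "csupp H0"
  proof (rule csuppI[of R])
    fix x assume "R < \<bar>x\<bar>"
    then consider "R < x" | "x < - R" by linarith
    then have "H x = H (- R - 1)" by cases (fact right, fact left)
    then show "H0 x = 0" by (simp add: H0_def)
  qed
  moreover have "(H0 has_vector_derivative h x) (at x)" for x
    unfolding H0_def using has_vector_derivative_diff[OF H has_vector_derivative_const] by simp
  ultimately show ?thesis using that by blast
qed

lemma integral_by_parts_scaleR:
  fixes g :: "real \<Rightarrow> 'a::euclidean_space"
  assumes f: "\<And>x. (f has_vector_derivative f' x) (at x)" "continuous_on UNIV f'" "csupp f"
    and g: "\<And>x. (g has_vector_derivative g' x) (at x)" "continuous_on UNIV g'"
  shows "(LINT x|lborel. f' x *\<^sub>R g x) = - (LINT x|lborel. f x *\<^sub>R g' x)"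
proof -
  have cf: "continuous_on UNIV f" "continuous_on UNIV g"
    using f g by (meson continuous_at_imp_continuous_on has_vector_derivative_continuous)+
  have csupp: "csupp (\<lambda>x. f x *\<^sub>R g x)" "csupp (\<lambda>x. f' x *\<^sub>R g x)" "csupp (\<lambda>x. f x *\<^sub>R g' x)"
    using f(3) csupp_deriv[of f f'] f(1) by (auto intro: csupp_mono[of f] csupp_mono[of f'])
  have "(LINT x|lborel. f x *\<^sub>R g' x + f' x *\<^sub>R g x) = 0"
    by (rule csupp_integral_deriv[OF csupp(1)])
       (use f g cf in \<open>auto intro!: derivative_eq_intros continuous_intros
          bounded_bilinear.has_vector_derivative[OF bounded_bilinear_scaleR]\<close>)
  moreover have "(LINT x|lborel. f x *\<^sub>R g' x + f' x *\<^sub>R g x) = (LINT x|lborel. f x *\<^sub>R g' x) + (LINT x|lborel. f' x *\<^sub>R g x)"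
    by (intro Bochner_Integration.integral_add csupp_integrable csupp continuous_intros cf f g)
  ultimately show ?thesis by (simp add: add_eq_0_iff)
qed

lemma jet_by_parts:
  fixes g :: "real \<Rightarrow> 'a::euclidean_space"
  assumes "jet n \<phi>" "k < n" "\<And>x. (g has_vector_derivative g' x) (at x)" "continuous_on UNIV g'"
  shows "(LINT x|lborel. \<phi> (Suc k) x *\<^sub>R g x) = - (LINT x|lborel. \<phi> k x *\<^sub>R g' x)"
  using assms by (intro integral_by_parts_scaleR jet_deriv[of n] jet_cont[of n] jet_cs[of n]) auto

lemma jet_integrable:
  fixes g :: "real \<Rightarrow> 'a::euclidean_space"
  assumes "jet n \<phi>" "k \<le> n" "continuous_on UNIV g"
  shows "integrable lborel (\<lambda>x. \<phi> k x *\<^sub>R g x)"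
  using assms by (intro csupp_integrable continuous_intros jet_cont[of n] csupp_mono[OF jet_cs[of n \<phi> k]]) auto

text \<open>Integrating by parts n times moves all derivatives onto x^n. The outcome shows that
  pairing with the n-th derivative detects the monomial x^n through the plain integral of the
  function.\<close>

lemma jet_moment:
  assumes "jet n \<phi>"
  shows "(LINT x|lborel. \<phi> n x *\<^sub>R (x ^ n)) = (-1) ^ n * fact n * (LINT x|lborel. \<phi> 0 x)"
  using assms
proof (induction n arbitrary: \<phi>)
  case (Suc n)
  have d: "((\<lambda>x. x ^ Suc n) has_vector_derivative real (Suc n) * x ^ n) (at x)" for x :: real
    using DERIV_pow[of "Suc n" x] by (simp add: has_real_derivative_iff_has_vector_derivative)
  have "(LINT x|lborel. \<phi> (Suc n) x *\<^sub>R (x ^ Suc n)) = - (LINT x|lborel. \<phi> n x *\<^sub>R (real (Suc n) * x ^ n))"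
    by (rule jet_by_parts[OF Suc.prems _ d]) (auto intro!: continuous_intros)
  also have "(LINT x|lborel. \<phi> n x *\<^sub>R (real (Suc n) * x ^ n)) = real (Suc n) * (LINT x|lborel. \<phi> n x *\<^sub>R x ^ n)"
    by (subst integral_mult_right_zero[symmetric]) (simp add: algebra_simps)
  also have "(LINT x|lborel. \<phi> n x *\<^sub>R x ^ n) = (-1) ^ n * fact n * (LINT x|lborel. \<phi> 0 x)"
    by (rule Suc.IH[OF jet_le[OF Suc.prems]]) simp
  finally show ?case by (simp add: algebra_simps)
qed simp

text \<open>
  Subtracting from \<open>\<psi>\<close> a multiple of a fixed bump makes its integral vanish, so that it
  becomes the derivative of a compactly supported function; the multiple is a moment of \<open>\<psi> n\<close>.
\<close>

lemma du_Bois_Reymond_step: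
  fixes g :: "real \<Rightarrow> 'a::euclidean_space"
  assumes g: "continuous_on UNIV g"
    and "\<And>\<phi>. jet (Suc n) \<phi> \<Longrightarrow> (LINT x|lborel. \<phi> (Suc n) x *\<^sub>R g x) = 0"
  shows "\<exists>k. \<forall>\<psi>. jet n \<psi> \<longrightarrow> (LINT x|lborel. \<psi> n x *\<^sub>R (g x - (x ^ n) *\<^sub>R k)) = 0"
proof -
  obtain \<rho> where \<rho>: "jet n \<rho>" "\<And>x. 0 \<le> \<rho> 0 x" "\<rho> 0 0 = 1" using bump_jet by blast
  have c\<rho>: "continuous_on UNIV (\<rho> 0)" "integrable lborel (\<rho> 0)"
    using \<rho>(1) jet_integrable[OF \<rho>(1), of 0 "\<lambda>_. 1::real"] by (auto intro: jet_cont)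
  define r where "r = (LINT x|lborel. \<rho> 0 x)"
  \<comment> \<open>The bump is continuous and nonnegative with value 1 at 0, so its integral cannot
    vanish.\<close>
  have r: "r \<noteq> 0" unfolding r_def using integral_zero_continuous[OF c\<rho> \<rho>(2), of 0] \<rho>(3) by auto
  define G where "G = (LINT x|lborel. \<rho> n x *\<^sub>R g x)"
  \<comment> \<open>By \<open>jet_moment\<close>, this is the coefficient for which x^n
    \<open>k\<close> and \<open>g\<close> have the same pairing with the n-th derivative of the
    bump.\<close>
  define k where "k = (1 / (r * (-1) ^ n * fact n)) *\<^sub>R G"
  show ?thesis
  proof (intro exI[of _ k] allI impI)
    fix \<psi> assume \<psi>: "jet n \<psi>"
    define I where "I = (LINT x|lborel. \<psi> 0 x)"
    have i: "integrable lborel (\<psi> 0)" using jet_integrable[OF \<psi>, of 0 "\<lambda>_. 1::real"] by auto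
    let ?h = "\<lambda>k x. \<psi> k x - (I / r) * \<rho> k x"
    have jh: "jet n ?h"
      using \<psi> \<rho>(1) r by (auto simp: jet_def intro!: derivative_eq_intros continuous_intros csupp_combine[of "\<psi> 0" "\<rho> 0"])
    have "(LINT x|lborel. ?h 0 x) = 0" using i c\<rho>(2) r by (simp add: I_def r_def)
    then obtain H where H: "\<And>x. (H has_vector_derivative ?h 0 x) (at x)" "csupp H"
      using csupp_antiderivative[OF jet_cont[OF jh] jet_cs[OF jh], of 0] by auto
    \<comment> \<open>The corrected function has zero integral, so its antiderivative
      \<open>H\<close> is prepended and the orders shift by one, giving a jet to which the
      hypothesis applies.\<close>
    define \<phi> where "\<phi> j = (case j of 0 \<Rightarrow> H | Suc i \<Rightarrow> ?h i)" for j
    have "jet (Suc n) \<phi>"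
      unfolding jet_def
    proof (intro conjI allI impI)
      fix j x assume "j < Suc n"
      then show "(\<phi> j has_real_derivative \<phi> (Suc j) x) (at x)"
        using H(1) jet_deriv[OF jh] by (cases j) (auto simp: \<phi>_def has_real_derivative_iff_has_vector_derivative)
    qed (use H(2) jet_cont[OF jh] in \<open>auto simp: \<phi>_def\<close>)
    from assms(2)[OF this] have "0 = (LINT x|lborel. (\<psi> n x - (I / r) * \<rho> n x) *\<^sub>R g x)" by (simp add: \<phi>_def)
    also have "\<dots> = (LINT x|lborel. \<psi> n x *\<^sub>R g x - (I / r) *\<^sub>R (\<rho> n x *\<^sub>R g x))"
      by (simp add: scaleR_diff_left)
    also have "\<dots> = (LINT x|lborel. \<psi> n x *\<^sub>R g x) - (I / r) *\<^sub>R G"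
      using jet_integrable[OF \<psi> _ g, of n] jet_integrable[OF \<rho>(1) _ g, of n]
      by (simp add: G_def del: scaleR_scaleR)
    finally have 1: "(LINT x|lborel. \<psi> n x *\<^sub>R g x) = (I / r) *\<^sub>R G" by simp
    have "(LINT x|lborel. \<psi> n x *\<^sub>R ((x ^ n) *\<^sub>R k)) = (LINT x|lborel. (\<psi> n x *\<^sub>R (x ^ n)) *\<^sub>R k)" by simp
    also have "\<dots> = ((-1) ^ n * fact n * I) *\<^sub>R k"
    proof (subst integral_scaleR_left)
      show "integrable lborel (\<lambda>x. \<psi> n x *\<^sub>R (x ^ n))"
        by (intro jet_integrable[OF \<psi>] continuous_intros order_refl)
    qed (simp add: jet_moment[OF \<psi>, simplified] I_def)
    also have "\<dots> = (I / r) *\<^sub>R G" using r by (simp add: k_def)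
    finally have 2: "(LINT x|lborel. \<psi> n x *\<^sub>R ((x ^ n) *\<^sub>R k)) = (I / r) *\<^sub>R G" .
    have "(LINT x|lborel. \<psi> n x *\<^sub>R (g x - (x ^ n) *\<^sub>R k))
       = (LINT x|lborel. \<psi> n x *\<^sub>R g x) - (LINT x|lborel. \<psi> n x *\<^sub>R ((x ^ n) *\<^sub>R k))"
      unfolding scaleR_diff_right
      by (intro Bochner_Integration.integral_diff jet_integrable[OF \<psi>] g continuous_intros order_refl)
    then show "(LINT x|lborel. \<psi> n x *\<^sub>R (g x - (x ^ n) *\<^sub>R k)) = 0" unfolding 1 2 by simp
  qed
qed

text \<open>Each induction step removes the monomial of highest degree. At order 0 any continuous
  compactly supported function is a test function, and \<open>g\<close> can be tested against
  itself.\<close>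

lemma du_Bois_Reymond:
  fixes g :: "real \<Rightarrow> 'a::euclidean_space"
  assumes "continuous_on UNIV g"
    and "\<And>\<phi>. jet n \<phi> \<Longrightarrow> (LINT x|lborel. \<phi> n x *\<^sub>R g x) = 0"
  shows "\<exists>k. \<forall>x. g x = (\<Sum>j<n. (x ^ j) *\<^sub>R k j)"
  using assms
proof (induction n arbitrary: g)
  case 0
  have "g y = 0" for y
  proof (rule euclidean_eqI)
    fix b :: 'a assume b: "b \<in> Basis"
    \<comment> \<open>A tent with value 1 at y times a component of \<open>g\<close>: the integrand
      becomes the tent times the square of that component, hence nonnegative.\<close>
    define \<phi> where "\<phi> k x = max 0 (1 - \<bar>x - y\<bar>) * (g x \<bullet> b)" for k :: nat and x
    have "csupp (\<phi> 0)" by (rule csuppI[of "\<bar>y\<bar> + 1"]) (auto simp: \<phi>_def max_def)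
    then have j: "jet 0 \<phi>"
      by (auto simp: jet_def \<phi>_def intro!: continuous_intros 0)
    let ?f = "\<lambda>x. \<phi> 0 x *\<^sub>R g x \<bullet> b"
    have "(LINT x|lborel. ?f x) = (LINT x|lborel. \<phi> 0 x *\<^sub>R g x) \<bullet> b"
      by (rule integral_inner_left) (rule jet_integrable[OF j _ 0(1)], simp)
    then have "(LINT x|lborel. ?f x) = 0" using 0(2)[OF j] by simp
    moreover have "continuous_on UNIV ?f" by (intro continuous_intros jet_cont[OF j] 0) simp
    moreover have "integrable lborel ?f"
      by (intro integrable_inner_left jet_integrable[OF j _ 0(1)]) simp
    moreover have "0 \<le> ?f x" for x by (simp add: \<phi>_def mult.assoc)
    ultimately have "?f y = 0" by (intro integral_zero_continuous[of ?f]) auto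
    then show "g y \<bullet> b = 0 \<bullet> b" by (simp add: \<phi>_def)
  qed
  then show ?case by simp
next
  case (Suc n)
  obtain k where k: "\<And>\<psi>. jet n \<psi> \<Longrightarrow> (LINT x|lborel. \<psi> n x *\<^sub>R (g x - (x ^ n) *\<^sub>R k)) = 0"
    using du_Bois_Reymond_step[of g n] Suc.prems by blast
  have "continuous_on UNIV (\<lambda>x. g x - (x ^ n) *\<^sub>R k)" by (intro continuous_intros Suc.prems)
  then obtain l where l: "\<And>x. g x - (x ^ n) *\<^sub>R k = (\<Sum>j<n. (x ^ j) *\<^sub>R l j)"
    using Suc.IH[of "\<lambda>x. g x - (x ^ n) *\<^sub>R k"] k by blast
  have "g x = (\<Sum>j<Suc n. (x ^ j) *\<^sub>R (l(n := k)) j)" for x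
    using l[of x] by (simp add: algebra_simps)
  then show ?case by blast
qed

subsection \<open>Regularity and integrability\<close>

text \<open>The hypothesis is the weak form of a'''' - k1' + k0 = 0. A threefold antiderivative
  \<open>M3\<close> of k1 minus an antiderivative of k0 solves the same equation, so a - M3
  annihilates all fourth derivatives and is a cubic polynomial. The result is phrased through e =
  a''' - k1 because \<open>k1\<close> is only continuous here.\<close>

lemma weak_fourth_order_regularity:
  fixes a k1 k0 :: "real \<Rightarrow> 'a::euclidean_space"
  assumes cont: "continuous_on UNIV a" "continuous_on UNIV k1" "continuous_on UNIV k0"
    and weak: "\<And>\<phi>. jet 4 \<phi> \<Longrightarrow> (LINT x|lborel. \<phi> 4 x *\<^sub>R a x + \<phi> (Suc 0) x *\<^sub>R k1 x + \<phi> 0 x *\<^sub>R k0 x) = 0"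
  obtains a1 a2 e where "\<And>x. (a has_vector_derivative a1 x) (at x)" "\<And>x. (a1 has_vector_derivative a2 x) (at x)"
    "\<And>x. (a2 has_vector_derivative k1 x + e x) (at x)" "\<And>x. (e has_vector_derivative - k0 x) (at x)"
proof -
  have cd: "continuous_on UNIV f" if "\<And>x. (f has_vector_derivative f' x) (at x)" for f f' :: "real \<Rightarrow> 'a"
    using that by (meson continuous_at_imp_continuous_on has_vector_derivative_continuous)
  obtain K0 where K0: "\<And>x. (K0 has_vector_derivative k0 x) (at x)" using antiderivative[OF cont(3)] by blast
  \<comment> \<open>This is the third derivative expected of \<open>a\<close>, up to a
    constant.\<close>
  define m where "m x = k1 x - K0 x" for x
  have m: "continuous_on UNIV m" unfolding m_def by (intro continuous_intros cont cd[OF K0])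
  obtain M1 where M1: "\<And>x. (M1 has_vector_derivative m x) (at x)" using antiderivative[OF m] by blast
  obtain M2 where M2: "\<And>x. (M2 has_vector_derivative M1 x) (at x)" using antiderivative[OF cd[OF M1]] by blast
  obtain M3 where M3: "\<And>x. (M3 has_vector_derivative M2 x) (at x)" using antiderivative[OF cd[OF M2]] by blast
  have "(LINT x|lborel. \<phi> 4 x *\<^sub>R (a x - M3 x)) = 0" if j: "jet 4 \<phi>" for \<phi>
  proof -
    have i: "integrable lborel (\<lambda>x. \<phi> k x *\<^sub>R g x)" if "k \<le> 4" "continuous_on UNIV g" for k and g :: "real \<Rightarrow> 'a"
      by (rule jet_integrable[OF j that])
    have e1: "(LINT x|lborel. \<phi> (Suc 0) x *\<^sub>R K0 x) = - (LINT x|lborel. \<phi> 0 x *\<^sub>R k0 x)"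
      by (rule jet_by_parts[OF j _ K0 cont(3)]) simp
    have e2: "(LINT x|lborel. \<phi> (Suc 1) x *\<^sub>R M1 x) = - (LINT x|lborel. \<phi> 1 x *\<^sub>R m x)"
      by (rule jet_by_parts[OF j _ M1 m]) simp
    have e3: "(LINT x|lborel. \<phi> (Suc 2) x *\<^sub>R M2 x) = - (LINT x|lborel. \<phi> 2 x *\<^sub>R M1 x)"
      by (rule jet_by_parts[OF j _ M2 cd[OF M1]]) simp
    have e4: "(LINT x|lborel. \<phi> (Suc 3) x *\<^sub>R M3 x) = - (LINT x|lborel. \<phi> 3 x *\<^sub>R M2 x)"
      by (rule jet_by_parts[OF j _ M3 cd[OF M2]]) simp
    have e5: "(LINT x|lborel. \<phi> (Suc 0) x *\<^sub>R m x)
        = (LINT x|lborel. \<phi> (Suc 0) x *\<^sub>R k1 x) - (LINT x|lborel. \<phi> (Suc 0) x *\<^sub>R K0 x)"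
      unfolding m_def scaleR_diff_right by (intro Bochner_Integration.integral_diff i cont cd[OF K0]) auto
    have e6: "(LINT x|lborel. \<phi> 4 x *\<^sub>R (a x - M3 x))
        = (LINT x|lborel. \<phi> 4 x *\<^sub>R a x) - (LINT x|lborel. \<phi> 4 x *\<^sub>R M3 x)"
      unfolding scaleR_diff_right by (intro Bochner_Integration.integral_diff i cont cd[OF M3]) auto
    have e7: "(LINT x|lborel. \<phi> 4 x *\<^sub>R a x + \<phi> (Suc 0) x *\<^sub>R k1 x + \<phi> 0 x *\<^sub>R k0 x)
        = (LINT x|lborel. \<phi> 4 x *\<^sub>R a x) + (LINT x|lborel. \<phi> (Suc 0) x *\<^sub>R k1 x) + (LINT x|lborel. \<phi> 0 x *\<^sub>R k0 x)"
      using i[of 4 a] i[of "Suc 0" k1] i[of 0 k0] cont by simp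
    have s: "Suc 0 = 1" "Suc 1 = 2" "Suc 2 = 3" "Suc 3 = 4" by simp_all
    have "(LINT x|lborel. \<phi> 4 x *\<^sub>R (a x - M3 x))
        = (LINT x|lborel. \<phi> 4 x *\<^sub>R a x) + (LINT x|lborel. \<phi> 1 x *\<^sub>R k1 x) + (LINT x|lborel. \<phi> 0 x *\<^sub>R k0 x)"
      unfolding e6 e4[unfolded s] e3[unfolded s] e2[unfolded s] e5[unfolded s] e1[unfolded s] by simp
    also have "\<dots> = 0" using e7 weak[OF j] unfolding s by simp
    finally show ?thesis .
  qed
  then obtain k where k: "\<And>x. a x - M3 x = (\<Sum>j<4. (x ^ j) *\<^sub>R k j)"
    using du_Bois_Reymond[of "\<lambda>x. a x - M3 x" 4] continuous_on_diff[OF cont(1) cd[OF M3]] by blast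
  have a: "a x = M3 x + (k 0 + x *\<^sub>R k 1 + x\<^sup>2 *\<^sub>R k 2 + x ^ 3 *\<^sub>R k 3)" for x
  proof -
    have "(\<Sum>j<4. (x ^ j) *\<^sub>R k j) = k 0 + x *\<^sub>R k 1 + x\<^sup>2 *\<^sub>R k 2 + x ^ 3 *\<^sub>R k 3"
      by (simp add: eval_nat_numeral)
    then show ?thesis using k[of x] by (simp add: diff_eq_eq add.commute)
  qed
  show ?thesis
  proof (rule that[of "\<lambda>x. M2 x + (k 1 + (2 * x) *\<^sub>R k 2 + (3 * x\<^sup>2) *\<^sub>R k 3)" "\<lambda>x. M1 x + (2 *\<^sub>R k 2 + (6 * x) *\<^sub>R k 3)" "\<lambda>x. 6 *\<^sub>R k 3 - K0 x"])
    fix x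
    show "(a has_vector_derivative M2 x + (k 1 + (2 * x) *\<^sub>R k 2 + (3 * x\<^sup>2) *\<^sub>R k 3)) (at x)"
      unfolding a[abs_def] by (auto intro!: derivative_eq_intros M3 simp: power2_eq_square)
    show "((\<lambda>x. M2 x + (k 1 + (2 * x) *\<^sub>R k 2 + (3 * x\<^sup>2) *\<^sub>R k 3)) has_vector_derivative M1 x + (2 *\<^sub>R k 2 + (6 * x) *\<^sub>R k 3)) (at x)"
      by (auto intro!: derivative_eq_intros M2)
    show "((\<lambda>x. M1 x + (2 *\<^sub>R k 2 + (6 * x) *\<^sub>R k 3)) has_vector_derivative k1 x + (6 *\<^sub>R k 3 - K0 x)) (at x)"
      by (auto intro!: derivative_eq_intros M1 simp: m_def)
    show "((\<lambda>x. 6 *\<^sub>R k 3 - K0 x) has_vector_derivative - k0 x) (at x)"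
      by (auto intro!: derivative_eq_intros K0)
  qed
qed

section \<open>Cutoffs at large scale and energy estimates\<close>

lemma cutoff_sequence:
  obtains \<phi> :: "nat \<Rightarrow> nat \<Rightarrow> real \<Rightarrow> real" and C :: real where "0 < C" "\<And>n. jet 2 (\<phi> n)"
    "\<And>n x. 0 \<le> \<phi> n 0 x" "\<And>n x. \<phi> n 0 x \<le> 1" "\<And>n x. \<bar>\<phi> n (Suc 0) x\<bar> \<le> C / real (Suc n)"
    "\<And>n x. \<bar>\<phi> n 2 x\<bar> \<le> C / real (Suc n) ^ 2" "\<And>n x. C * real (Suc n) < \<bar>x\<bar> \<Longrightarrow> \<phi> n 2 x = 0"
    "\<And>x. (\<lambda>n. \<phi> n 0 x) \<longlonglongrightarrow> 1"
proof -
  obtain \<eta> where \<eta>: "jet 2 \<eta>" "\<And>x. 0 \<le> \<eta> 0 x" "\<And>x. \<eta> 0 x \<le> 1" "\<eta> 0 0 = 1" using bump_jet by blast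
  have bdd: "\<exists>C. \<forall>x. \<bar>\<eta> k x\<bar> \<le> C" if k: "k \<le> 2" for k
  proof -
    obtain R where R: "\<And>x. R < \<bar>x\<bar> \<Longrightarrow> \<eta> k x = 0" using csuppE[OF jet_cs[OF \<eta>(1) k]] by blast
    have "bounded (\<eta> k ` {-R..R})"
      using continuous_on_subset[OF jet_cont[OF \<eta>(1) k]] by (intro compact_imp_bounded compact_continuous_image) auto
    then obtain B where B: "\<And>x. x \<in> {-R..R} \<Longrightarrow> \<bar>\<eta> k x\<bar> \<le> B" unfolding bounded_iff by (metis imageI real_norm_def)
    have "\<bar>\<eta> k x\<bar> \<le> max B 0" for x
    proof (cases "R < \<bar>x\<bar>")
      case False
      then have "x \<in> {-R..R}" by auto
      then show ?thesis using B by (simp add: le_max_iff_disj)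
    qed (simp add: R)
    then show ?thesis by blast
  qed
  obtain C1 where C1: "\<And>x. \<bar>\<eta> 1 x\<bar> \<le> C1" using bdd[of 1] by auto
  obtain C2 where C2: "\<And>x. \<bar>\<eta> 2 x\<bar> \<le> C2" using bdd[of 2] by auto
  obtain R where R: "\<And>x. R < \<bar>x\<bar> \<Longrightarrow> \<eta> 2 x = 0" using csuppE[OF jet_cs[OF \<eta>(1), of 2]] by auto
  obtain R0 where R0: "\<And>x. R0 < \<bar>x\<bar> \<Longrightarrow> \<eta> 0 x = 0" using csuppE[OF jet_cs[OF \<eta>(1), of 0]] by auto
  \<comment> \<open>One constant serves both as a bound for the first two derivatives and as a
    support radius before scaling.\<close>
  define C where "C = max (max C1 C2) (max R 1)"
  \<comment> \<open>Dilations of one bump: every derivative gains a factor 1 / (n + 1), and the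
    functions tend to 1 because the bump is 1 at the origin.\<close>
  define \<phi> where "\<phi> n k x = \<eta> k (x / real (Suc n)) / real (Suc n) ^ k" for n k x
  show ?thesis
  proof (rule that[of C \<phi>])
    show "0 < C" by (simp add: C_def)
    fix n :: nat and x :: real
    have "csupp (\<phi> n 0)"
    proof (rule csuppI[of "R0 * real (Suc n)"])
      fix x assume "R0 * real (Suc n) < \<bar>x\<bar>"
      then have "R0 < \<bar>x / real (Suc n)\<bar>" by (simp add: pos_less_divide_eq del: of_nat_Suc)
      then show "\<phi> n 0 x = 0" by (simp add: \<phi>_def R0 del: of_nat_Suc)
    qed
    moreover have "(\<phi> n k has_real_derivative \<phi> n (Suc k) x) (at x)" if "k < 2" for k x
    proof -
      have "(\<eta> k has_real_derivative \<eta> (Suc k) (x / real (Suc n))) (at (x / real (Suc n)))"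
        using \<eta>(1) that unfolding jet_def by blast
      moreover have "((\<lambda>x. x / real (Suc n)) has_real_derivative 1 / real (Suc n)) (at x)"
        by (auto intro!: derivative_eq_intros simp del: of_nat_Suc)
      ultimately have "((\<lambda>x. \<eta> k (x / real (Suc n))) has_real_derivative \<eta> (Suc k) (x / real (Suc n)) * (1 / real (Suc n))) (at x)"
        by (rule DERIV_chain2)
      from DERIV_cdivide[OF this, of "real (Suc n) ^ k"] show ?thesis
        unfolding \<phi>_def by (rule DERIV_cong) (simp del: of_nat_Suc add: field_simps)
    qed
    moreover have "continuous_on UNIV (\<phi> n 2)"
      unfolding \<phi>_def by (intro continuous_intros continuous_on_compose2[OF jet_cont[OF \<eta>(1)]]) auto
    ultimately show "jet 2 (\<phi> n)" unfolding jet_def by blast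
    show "0 \<le> \<phi> n 0 x" "\<phi> n 0 x \<le> 1" unfolding \<phi>_def using \<eta> by auto
    have "C1 \<le> C" "C2 \<le> C" "R \<le> C" by (auto simp: C_def)
    then have *: "\<bar>\<eta> 1 y\<bar> \<le> C" "\<bar>\<eta> 2 y\<bar> \<le> C" for y using C1[of y] C2[of y] by auto
    show "\<bar>\<phi> n (Suc 0) x\<bar> \<le> C / real (Suc n)" "\<bar>\<phi> n 2 x\<bar> \<le> C / real (Suc n) ^ 2"
      unfolding \<phi>_def abs_divide using * by (auto intro!: divide_right_mono simp del: of_nat_Suc)
    show "\<phi> n 2 x = 0" if "C * real (Suc n) < \<bar>x\<bar>"
    proof -
      have "C < \<bar>x / real (Suc n)\<bar>" using that by (simp add: pos_less_divide_eq del: of_nat_Suc)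
      then show ?thesis using R[of "x / real (Suc n)"] \<open>R \<le> C\<close> by (simp add: \<phi>_def del: of_nat_Suc)
    qed
    have "(\<lambda>n. x / real (Suc n)) \<longlonglongrightarrow> 0"
      using tendsto_mult_right_zero[OF LIMSEQ_inverse_real_of_nat, of x] by (simp add: divide_inverse)
    moreover have "isCont (\<eta> 0) 0" using jet_cont[OF \<eta>(1), of 0] by (simp add: continuous_on_eq_continuous_at)
    ultimately have "(\<lambda>n. \<eta> 0 (x / real (Suc n))) \<longlonglongrightarrow> \<eta> 0 0"
      by (rule isCont_tendsto_compose[rotated])
    then show "(\<lambda>n. \<phi> n 0 x) \<longlonglongrightarrow> 1" unfolding \<phi>_def \<eta>(4) by simp
  qed
qed

text \<open>A Caccioppoli inequality: the derivative of \<phi>^2 f . f' integrates to 0, and the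
  mixed term 2 \<phi> \<phi>' f . f' is absorbed, half of \<phi>^2 |f'|^2 going back to the left
  side.\<close>

lemma cutoff_energy:
  fixes f :: "real \<Rightarrow> complex"
  assumes f: "\<And>x. (f has_vector_derivative f1 x) (at x)" "\<And>x. (f1 has_vector_derivative f2 x) (at x)"
    "continuous_on UNIV f2" and j: "jet 1 \<phi>"
  shows "(LINT x|lborel. (\<phi> 0 x)\<^sup>2 * (f1 x \<bullet> f1 x))
    \<le> 4 * (LINT x|lborel. (\<phi> (Suc 0) x)\<^sup>2 * (f x \<bullet> f x)) - 2 * (LINT x|lborel. (\<phi> 0 x)\<^sup>2 * (f x \<bullet> f2 x))"
proof -
  have cf: "continuous_on UNIV f" "continuous_on UNIV f1"
    using f by (meson continuous_at_imp_continuous_on has_vector_derivative_continuous)+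
  have c\<phi>: "continuous_on UNIV (\<phi> 0)" "continuous_on UNIV (\<phi> (Suc 0))" "csupp (\<phi> 0)" "csupp (\<phi> (Suc 0))"
    using jet_cont[OF j] jet_cs[OF j] by auto
  have d\<phi>: "(\<phi> 0 has_vector_derivative \<phi> (Suc 0) x) (at x)" for x using jet_deriv[OF j] by simp
  let ?A = "\<lambda>x. (\<phi> 0 x)\<^sup>2 * (f1 x \<bullet> f1 x)" and ?B = "\<lambda>x. (\<phi> (Suc 0) x)\<^sup>2 * (f x \<bullet> f x)"
    and ?C = "\<lambda>x. (\<phi> 0 x)\<^sup>2 * (f x \<bullet> f2 x)" and ?X = "\<lambda>x. 2 * \<phi> 0 x * \<phi> (Suc 0) x * (f x \<bullet> f1 x)"
  have i: "integrable lborel ?A" "integrable lborel ?B" "integrable lborel ?C" "integrable lborel ?X"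
    by (intro csupp_integrable continuous_intros cf f c\<phi> csupp_mono[OF c\<phi>(3)] csupp_mono[OF c\<phi>(4)]; simp)+
  have "(LINT x|lborel. ?X x + ?A x + ?C x) = 0"
  proof (rule csupp_integral_deriv[of "\<lambda>x. (\<phi> 0 x)\<^sup>2 * (f x \<bullet> f1 x)"])
    show "csupp (\<lambda>x. (\<phi> 0 x)\<^sup>2 * (f x \<bullet> f1 x))" by (rule csupp_mono[OF c\<phi>(3)]) simp
    show "((\<lambda>x. (\<phi> 0 x)\<^sup>2 * (f x \<bullet> f1 x)) has_vector_derivative ?X x + ?A x + ?C x) (at x)" for x
    proof (rule has_vector_derivative_eq_rhs)
      have "((\<lambda>x. (\<phi> 0 x)\<^sup>2) has_real_derivative 2 * \<phi> 0 x * \<phi> (Suc 0) x) (at x)"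
        using d\<phi>[of x] unfolding has_real_derivative_iff_has_vector_derivative[symmetric]
        by (auto intro!: derivative_eq_intros)
      then show "((\<lambda>x. (\<phi> 0 x)\<^sup>2 * (f x \<bullet> f1 x)) has_vector_derivative
          (\<phi> 0 x)\<^sup>2 * (f x \<bullet> f2 x + f1 x \<bullet> f1 x) + 2 * \<phi> 0 x * \<phi> (Suc 0) x * (f x \<bullet> f1 x)) (at x)"
        unfolding has_real_derivative_iff_has_vector_derivative
        by (intro has_vector_derivative_mult bounded_bilinear.has_vector_derivative[OF bounded_bilinear_inner] f)
    qed (simp add: algebra_simps)
    show "continuous_on UNIV (\<lambda>x. ?X x + ?A x + ?C x)" by (intro continuous_intros cf f c\<phi>)
  qed
  then have eq: "(LINT x|lborel. ?A x) = (LINT x|lborel. - ?X x) - (LINT x|lborel. ?C x)" using i by simp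
  have "(LINT x|lborel. - ?X x) \<le> (LINT x|lborel. ?A x / 2 + 2 * ?B x)"
  proof (rule integral_mono)
    fix x
    have "\<bar>(\<phi> 0 x *\<^sub>R f1 x) \<bullet> ((2 * \<phi> (Suc 0) x) *\<^sub>R f x)\<bar>
        \<le> ((\<phi> 0 x *\<^sub>R f1 x) \<bullet> (\<phi> 0 x *\<^sub>R f1 x) + ((2 * \<phi> (Suc 0) x) *\<^sub>R f x) \<bullet> ((2 * \<phi> (Suc 0) x) *\<^sub>R f x)) / 2"
      by (rule inner_le_half)
    then show "- ?X x \<le> ?A x / 2 + 2 * ?B x"
      by (simp add: power2_eq_square inner_commute[of "f1 x" "f x"] algebra_simps abs_le_iff)
  qed (use i in auto)
  also have "\<dots> = (LINT x|lborel. ?A x) / 2 + 2 * (LINT x|lborel. ?B x)" using i by simp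
  finally show ?thesis using eq by linarith
qed

text \<open>\<open>cutoff_energy\<close> bounds the truncated energies uniformly, and Fatou's lemma
  removes the cutoff. No decay of f or f' is presupposed.\<close>

lemma integrable_derivative:
  fixes f :: "real \<Rightarrow> complex"
  assumes f: "\<And>x. (f has_vector_derivative f1 x) (at x)" "\<And>x. (f1 has_vector_derivative f2 x) (at x)"
    "continuous_on UNIV f2" and i: "integrable lborel (\<lambda>x. f x \<bullet> f x)" "integrable lborel (\<lambda>x. f2 x \<bullet> f2 x)"
  shows "integrable lborel (\<lambda>x. f1 x \<bullet> f1 x)"
proof -
  obtain \<phi> C where \<phi>: "0 < C" "\<And>n. jet 2 (\<phi> n)" "\<And>n x. 0 \<le> \<phi> n 0 x" "\<And>n x. \<phi> n 0 x \<le> 1"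
     "\<And>n x. \<bar>\<phi> n (Suc 0) x\<bar> \<le> C / real (Suc n)" "\<And>x. (\<lambda>n. \<phi> n 0 x) \<longlonglongrightarrow> 1"
    by (rule cutoff_sequence) blast
  have j: "jet 1 (\<phi> n)" for n by (rule jet_le[OF \<phi>(2)]) simp
  have cf: "continuous_on UNIV f" "continuous_on UNIV f1"
    using f by (meson continuous_at_imp_continuous_on has_vector_derivative_continuous)+
  have c\<phi>: "continuous_on UNIV (\<phi> n 0)" "continuous_on UNIV (\<phi> n (Suc 0))" "csupp (\<phi> n 0)" "csupp (\<phi> n (Suc 0))" for n
    using jet_cont[OF j] jet_cs[OF j] by auto
  have sq1: "(\<phi> n 0 x)\<^sup>2 \<le> 1" for n x using \<phi>(3,4) by (simp add: power_le_one)
  have sq2: "(\<phi> n (Suc 0) x)\<^sup>2 \<le> C\<^sup>2" for n x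
  proof -
    have "C / real (Suc n) \<le> C" using \<phi>(1) by (simp add: divide_le_eq del: of_nat_Suc)
    then have "\<bar>\<phi> n (Suc 0) x\<bar> \<le> C" using \<phi>(5)[of n x] by linarith
    then show ?thesis by (metis abs_ge_zero power2_abs power_mono)
  qed
  show ?thesis
  proof (rule fatou_bound(1)[of _ "\<lambda>n x. (\<phi> n 0 x)\<^sup>2 * (f1 x \<bullet> f1 x)"
        "4 * (C\<^sup>2 * (LINT x|lborel. f x \<bullet> f x)) + (LINT x|lborel. f x \<bullet> f x) + (LINT x|lborel. f2 x \<bullet> f2 x)"])
    fix n x
    show "integrable lborel (\<lambda>x. (\<phi> n 0 x)\<^sup>2 * (f1 x \<bullet> f1 x))"
      by (intro csupp_integrable continuous_intros cf c\<phi> csupp_mono[OF c\<phi>(3)[of n]]) simp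
    show "0 \<le> (\<phi> n 0 x)\<^sup>2 * (f1 x \<bullet> f1 x)" by simp
    have "(\<lambda>n. (\<phi> n 0 x)\<^sup>2 * (f1 x \<bullet> f1 x)) \<longlonglongrightarrow> 1\<^sup>2 * (f1 x \<bullet> f1 x)" by (intro tendsto_intros \<phi>)
    then show "(\<lambda>n. (\<phi> n 0 x)\<^sup>2 * (f1 x \<bullet> f1 x)) \<longlonglongrightarrow> f1 x \<bullet> f1 x" by simp
    have "(LINT x|lborel. (\<phi> n (Suc 0) x)\<^sup>2 * (f x \<bullet> f x)) \<le> (LINT x|lborel. C\<^sup>2 * (f x \<bullet> f x))"
      using i sq2 by (intro integral_mono mult_right_mono)
        (auto intro!: csupp_integrable continuous_intros cf c\<phi> csupp_mono[OF c\<phi>(4)[of n]])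
    also have "\<dots> = C\<^sup>2 * (LINT x|lborel. f x \<bullet> f x)" by simp
    finally have 1: "(LINT x|lborel. (\<phi> n (Suc 0) x)\<^sup>2 * (f x \<bullet> f x)) \<le> \<dots>" .
    have "(LINT x|lborel. - 2 * ((\<phi> n 0 x)\<^sup>2 * (f x \<bullet> f2 x))) \<le> (LINT x|lborel. f x \<bullet> f x + f2 x \<bullet> f2 x)"
    proof (rule integral_mono)
      show "integrable lborel (\<lambda>x. - 2 * ((\<phi> n 0 x)\<^sup>2 * (f x \<bullet> f2 x)))"
        by (intro csupp_integrable continuous_intros cf f c\<phi> csupp_mono[OF c\<phi>(3)[of n]]) simp
      fix x
      have "- 2 * ((\<phi> n 0 x)\<^sup>2 * (f x \<bullet> f2 x)) \<le> (\<phi> n 0 x)\<^sup>2 * (f x \<bullet> f x + f2 x \<bullet> f2 x)"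
        using mult_left_mono[of "- 2 * (f x \<bullet> f2 x)" "f x \<bullet> f x + f2 x \<bullet> f2 x" "(\<phi> n 0 x)\<^sup>2"]
          inner_le_half[of "f x" "f2 x"] by (simp add: abs_le_iff algebra_simps)
      also have "\<dots> \<le> 1 * (f x \<bullet> f x + f2 x \<bullet> f2 x)" using sq1 by (intro mult_right_mono) auto
      finally show "- 2 * ((\<phi> n 0 x)\<^sup>2 * (f x \<bullet> f2 x)) \<le> f x \<bullet> f x + f2 x \<bullet> f2 x" by simp
    qed (use i in auto)
    also have "\<dots> = (LINT x|lborel. f x \<bullet> f x) + (LINT x|lborel. f2 x \<bullet> f2 x)" using i by simp
    finally have 2: "- 2 * (LINT x|lborel. (\<phi> n 0 x)\<^sup>2 * (f x \<bullet> f2 x)) \<le> \<dots>" by simp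
    show "(LINT x|lborel. (\<phi> n 0 x)\<^sup>2 * (f1 x \<bullet> f1 x))
      \<le> 4 * (C\<^sup>2 * (LINT x|lborel. f x \<bullet> f x)) + (LINT x|lborel. f x \<bullet> f x) + (LINT x|lborel. f2 x \<bullet> f2 x)"
      using cutoff_energy[OF f j[of n]] 1 2 by linarith
  qed
qed

text \<open>Orthogonality removes the last term of \<open>cutoff_energy\<close>; the other one
  carries the squared derivative of the cutoff and tends to 0 as the scale grows, so f' vanishes. A
  cutoff is needed because boundary terms at infinity are not known to vanish.\<close>

lemma L2_solution_zero:
  fixes f :: "real \<Rightarrow> complex"
  assumes f: "\<And>x. (f has_vector_derivative f1 x) (at x)" "\<And>x. (f1 has_vector_derivative f2 x) (at x)"
    "continuous_on UNIV f2" and i: "integrable lborel (\<lambda>x. f x \<bullet> f x)" and orth: "\<And>x. f x \<bullet> f2 x = 0"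
  shows "f x = 0"
proof -
  obtain \<phi> C where \<phi>: "0 < C" "\<And>n. jet 2 (\<phi> n)" "\<And>n x. 0 \<le> \<phi> n 0 x" "\<And>n x. \<phi> n 0 x \<le> 1"
     "\<And>n x. \<bar>\<phi> n (Suc 0) x\<bar> \<le> C / real (Suc n)" "\<And>x. (\<lambda>n. \<phi> n 0 x) \<longlonglongrightarrow> 1"
    by (rule cutoff_sequence) blast
  have j: "jet 1 (\<phi> n)" for n by (rule jet_le[OF \<phi>(2)]) simp
  have cf: "continuous_on UNIV f" "continuous_on UNIV f1"
    using f by (meson continuous_at_imp_continuous_on has_vector_derivative_continuous)+
  have c\<phi>: "continuous_on UNIV (\<phi> n 0)" "continuous_on UNIV (\<phi> n (Suc 0))" "csupp (\<phi> n 0)" "csupp (\<phi> n (Suc 0))" for n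
    using jet_cont[OF j] jet_cs[OF j] by auto
  let ?u = "\<lambda>n x. (\<phi> n 0 x)\<^sup>2 * (f1 x \<bullet> f1 x)"
  have iu: "integrable lborel (?u n)" for n
    by (intro csupp_integrable continuous_intros cf c\<phi> csupp_mono[OF c\<phi>(3)[of n]]) simp
  have lim: "(\<lambda>n. ?u n x) \<longlonglongrightarrow> f1 x \<bullet> f1 x" for x
  proof -
    have "(\<lambda>n. ?u n x) \<longlonglongrightarrow> 1\<^sup>2 * (f1 x \<bullet> f1 x)" by (intro tendsto_intros \<phi>)
    then show ?thesis by simp
  qed
  have bound: "(LINT x|lborel. ?u n x) \<le> 4 * C\<^sup>2 * (LINT x|lborel. f x \<bullet> f x) * inverse (real (Suc n))" for n
  proof -
    have "(LINT x|lborel. (\<phi> n (Suc 0) x)\<^sup>2 * (f x \<bullet> f x)) \<le> (LINT x|lborel. (C\<^sup>2 * inverse (real (Suc n))) * (f x \<bullet> f x))"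
    proof (intro integral_mono mult_right_mono)
      show "integrable lborel (\<lambda>x. (\<phi> n (Suc 0) x)\<^sup>2 * (f x \<bullet> f x))"
        by (intro csupp_integrable continuous_intros cf c\<phi> csupp_mono[OF c\<phi>(4)[of n]]) simp
      fix x
      have "(\<phi> n (Suc 0) x)\<^sup>2 \<le> (C / real (Suc n))\<^sup>2"
        using power_mono[OF \<phi>(5)[of n x], of 2] by simp
      also have "\<dots> = C\<^sup>2 * (inverse (real (Suc n)) * inverse (real (Suc n)))" by (simp add: power2_eq_square divide_inverse)
      also have "\<dots> \<le> C\<^sup>2 * (inverse (real (Suc n)) * 1)"
        by (intro mult_left_mono) (auto simp: inverse_eq_divide)
      finally show "(\<phi> n (Suc 0) x)\<^sup>2 \<le> C\<^sup>2 * inverse (real (Suc n))" by simp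
    qed (use i in auto)
    then have "4 * (LINT x|lborel. (\<phi> n (Suc 0) x)\<^sup>2 * (f x \<bullet> f x))
        \<le> 4 * (C\<^sup>2 * inverse (real (Suc n)) * (LINT x|lborel. f x \<bullet> f x))" by simp
    with cutoff_energy[OF f j[of n]] orth show ?thesis by (simp add: mult_ac)
  qed
  have int1: "integrable lborel (\<lambda>x. f1 x \<bullet> f1 x)"
  proof (rule fatou_bound(1)[OF iu _ _ lim])
    fix n
    have "4 * C\<^sup>2 * (LINT x|lborel. f x \<bullet> f x) * inverse (real (Suc n)) \<le> 4 * C\<^sup>2 * (LINT x|lborel. f x \<bullet> f x) * 1"
      by (intro mult_left_mono) (auto simp: inverse_eq_divide intro!: integral_nonneg_AE)
    then show "(LINT x|lborel. ?u n x) \<le> 4 * C\<^sup>2 * (LINT x|lborel. f x \<bullet> f x)" using bound[of n] by linarith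
  qed simp
  have "(\<lambda>n. LINT x|lborel. ?u n x) \<longlonglongrightarrow> (LINT x|lborel. f1 x \<bullet> f1 x)"
  proof (rule integral_dominated_convergence[where w = "\<lambda>x. f1 x \<bullet> f1 x"])
    show "AE x in lborel. norm (?u n x) \<le> f1 x \<bullet> f1 x" for n
    proof (rule AE_I2)
      fix x
      have "(\<phi> n 0 x)\<^sup>2 * (f1 x \<bullet> f1 x) \<le> 1 * (f1 x \<bullet> f1 x)"
        using \<phi>(3,4) by (intro mult_right_mono) (simp_all add: power_le_one)
      then show "norm (?u n x) \<le> f1 x \<bullet> f1 x" by simp
    qed
  qed (use iu lim int1 in auto)
  moreover have "(\<lambda>n. 4 * C\<^sup>2 * (LINT x|lborel. f x \<bullet> f x) * inverse (real (Suc n))) \<longlonglongrightarrow> 0"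
    by (rule tendsto_mult_right_zero[OF LIMSEQ_inverse_real_of_nat])
  ultimately have "(LINT x|lborel. f1 x \<bullet> f1 x) \<le> 0"
    using bound by (intro LIMSEQ_le) auto
  then have "(LINT x|lborel. f1 x \<bullet> f1 x) = 0"
    by (intro antisym integral_nonneg_AE) auto
  then have f1: "f1 y = 0" for y
    using integral_zero_continuous[of "\<lambda>x. f1 x \<bullet> f1 x" y] int1 cf by (auto intro!: continuous_intros)
  \<comment> \<open>A constant that is square-integrable over the whole line must be 0.\<close>
  have "(\<lambda>y. f y \<bullet> f y) = (\<lambda>_. f x \<bullet> f x)"
  proof
    fix y
    have "f y = f x" using vector_derivative_bound[of f f1 0 y x] f(1) f1 by simp
    then show "f y \<bullet> f y = f x \<bullet> f x" by simp
  qed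
  with i have "integrable lborel (\<lambda>_::real. f x \<bullet> f x)" by (simp only:)
  then show ?thesis by (auto simp: integrable_iff_bounded ennreal_mult_less_top emeasure_lborel_UNIV)
qed

section \<open>From the sign condition to an eigenpair of D* D\<close>

context wall
begin

text \<open>As the cutoff widens, the potential term tends to c^2 times the given negative integral,
  while the second-derivative term tends to 0. Hence some cutoff lies strictly below c^2.\<close>

lemma trial_function:
  assumes int: "integrable lborel (\<lambda>x. (chi x)\<^sup>2 - 1)" and neg: "(LINT x|lborel. ((chi x)\<^sup>2 - 1)) < 0"
  obtains f f1 f2 where "C2c f f1 f2" "Q f f2 < c\<^sup>2 * N f"
proof -
  obtain \<phi> C where \<phi>: "0 < C" "\<And>n. jet 2 (\<phi> n)" "\<And>n x. 0 \<le> \<phi> n 0 x" "\<And>n x. \<phi> n 0 x \<le> 1"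
     "\<And>n x. \<bar>\<phi> n 2 x\<bar> \<le> C / real (Suc n) ^ 2" "\<And>n x. C * real (Suc n) < \<bar>x\<bar> \<Longrightarrow> \<phi> n 2 x = 0"
     "\<And>x. (\<lambda>n. \<phi> n 0 x) \<longlonglongrightarrow> 1"
    by (rule cutoff_sequence) blast
  let ?f = "\<lambda>n k x. complex_of_real (\<phi> n k x)"
  have C: "C2c (?f n 0) (?f n (Suc 0)) (?f n 2)" for n
  proof -
    have d: "((\<lambda>x. complex_of_real (\<phi> n k x)) has_vector_derivative complex_of_real (\<phi> n (Suc k) x)) (at x)"
      if "k < 2" for k x
      by (rule bounded_linear.has_vector_derivative[OF bounded_linear_of_real jet_deriv[OF \<phi>(2) that]])
    have "csupp (?f n 0)" by (rule csupp_mono[OF jet_cs[OF \<phi>(2), of 0 n]]) auto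
    then show ?thesis
      unfolding C2c_def using d[of 0] d[of "Suc 0"] jet_cont[OF \<phi>(2), of 2 n]
      by (auto simp: numeral_2_eq_2 intro!: continuous_intros)
  qed
  have c0: "continuous_on UNIV (\<phi> n 0)" "continuous_on UNIV (\<phi> n 2)" "csupp (\<phi> n 0)" "csupp (\<phi> n 2)" for n
    using jet_cont[OF \<phi>(2)] jet_cs[OF \<phi>(2)] by auto
  have [measurable]: "\<phi> n 0 \<in> borel_measurable borel" for n by (rule borel_measurable_continuous_onI[OF c0(1)])
  have NN: "N (?f n 0) = (LINT x|lborel. (\<phi> n 0 x)\<^sup>2)" for n
    by (simp add: inner_complex_def power2_eq_square)
  have QQ: "Q (?f n 0) (?f n 2) - c\<^sup>2 * N (?f n 0)
      = c\<^sup>2 * (LINT x|lborel. (\<phi> n 0 x)\<^sup>2 * ((chi x)\<^sup>2 - 1)) + (LINT x|lborel. (\<phi> n 2 x)\<^sup>2)" for n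
  proof -
    have i: "integrable lborel (\<lambda>x. (\<phi> n 0 x)\<^sup>2 * ((chi x)\<^sup>2 - 1))" "integrable lborel (\<lambda>x. (\<phi> n 2 x)\<^sup>2)"
      "integrable lborel (\<lambda>x. (\<phi> n 0 x)\<^sup>2)"
      by (intro csupp_integrable continuous_intros c0 chi_cont csupp_mono[OF c0(3)[of n]] csupp_mono[OF c0(4)[of n]]; simp)+
    have "Q (?f n 0) (?f n 2) = (LINT x|lborel. c\<^sup>2 * ((\<phi> n 0 x)\<^sup>2 * ((chi x)\<^sup>2 - 1)) + c\<^sup>2 * (\<phi> n 0 x)\<^sup>2 + (\<phi> n 2 x)\<^sup>2)"
      by (intro Bochner_Integration.integral_cong)
         (auto simp: DD_def inner_complex_def power2_eq_square algebra_simps)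
    then show ?thesis unfolding NN using i by simp
  qed
  have "(\<lambda>n. LINT x|lborel. (\<phi> n 0 x)\<^sup>2 * ((chi x)\<^sup>2 - 1)) \<longlonglongrightarrow> (LINT x|lborel. ((chi x)\<^sup>2 - 1))"
  proof (rule integral_dominated_convergence[where w = "\<lambda>x. \<bar>(chi x)\<^sup>2 - 1\<bar>"])
    show "AE x in lborel. (\<lambda>n. (\<phi> n 0 x)\<^sup>2 * ((chi x)\<^sup>2 - 1)) \<longlonglongrightarrow> (chi x)\<^sup>2 - 1"
    proof (rule AE_I2)
      fix x
      have "(\<lambda>n. (\<phi> n 0 x)\<^sup>2 * ((chi x)\<^sup>2 - 1)) \<longlonglongrightarrow> 1\<^sup>2 * ((chi x)\<^sup>2 - 1)" by (intro tendsto_intros \<phi>)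
      then show "(\<lambda>n. (\<phi> n 0 x)\<^sup>2 * ((chi x)\<^sup>2 - 1)) \<longlonglongrightarrow> (chi x)\<^sup>2 - 1" by simp
    qed
    show "AE x in lborel. norm ((\<phi> n 0 x)\<^sup>2 * ((chi x)\<^sup>2 - 1)) \<le> \<bar>(chi x)\<^sup>2 - 1\<bar>" for n
    proof (rule AE_I2)
      fix x
      have "(\<phi> n 0 x)\<^sup>2 * \<bar>(chi x)\<^sup>2 - 1\<bar> \<le> 1 * \<bar>(chi x)\<^sup>2 - 1\<bar>"
        using \<phi>(3,4) by (intro mult_right_mono) (simp_all add: power_le_one)
      then show "norm ((\<phi> n 0 x)\<^sup>2 * ((chi x)\<^sup>2 - 1)) \<le> \<bar>(chi x)\<^sup>2 - 1\<bar>" by (simp add: abs_mult)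
    qed
  qed (use int in auto)
  moreover have "(\<lambda>n. LINT x|lborel. (\<phi> n 2 x)\<^sup>2) \<longlonglongrightarrow> 0"
  proof (rule Lim_null_comparison)
    have "norm (LINT x|lborel. (\<phi> n 2 x)\<^sup>2) \<le> 2 * C ^ 3 * inverse (real (Suc n))" for n
    proof -
      define m where "m = real (Suc n)"
      have m: "m \<ge> 1" by (simp add: m_def)
      \<comment> \<open>The support has length at most 2 C m and the integrand is at most C^2 / m^4,
        so the integral is of order m^(-3); the bound kept in the end is of order 1 / m.\<close>
      have "(LINT x|lborel. (\<phi> n 2 x)\<^sup>2) \<le> (LINT x|lborel. indicator {- (C * m)..C * m} x *\<^sub>R ((C / m\<^sup>2)\<^sup>2))"
      proof (rule integral_mono)
        show "integrable lborel (\<lambda>x. (\<phi> n 2 x)\<^sup>2)"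
          by (intro csupp_integrable continuous_intros c0 csupp_mono[OF c0(4)[of n]]) simp
        show "integrable lborel (\<lambda>x. indicator {- (C * m)..C * m} x *\<^sub>R ((C / m\<^sup>2)\<^sup>2))"
          by (intro borel_integrable_compact) auto
        fix x
        show "(\<phi> n 2 x)\<^sup>2 \<le> indicator {- (C * m)..C * m} x *\<^sub>R ((C / m\<^sup>2)\<^sup>2)"
        proof (cases "C * m < \<bar>x\<bar>")
          case True
          then show ?thesis using \<phi>(6)[of n x] by (simp add: m_def)
        next
          case False
          then have "x \<in> {- (C * m)..C * m}" by auto
          moreover have "(\<phi> n 2 x)\<^sup>2 \<le> (C / m\<^sup>2)\<^sup>2"
            using power_mono[OF \<phi>(5)[of n x], of 2] unfolding m_def by simp
          ultimately show ?thesis by simp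
        qed
      qed
      also have "\<dots> = 2 * (C * m) * ((C / m\<^sup>2)\<^sup>2)"
        using \<phi>(1) m by simp
      also have "\<dots> = 2 * C ^ 3 * (inverse m * (inverse m)\<^sup>2)"
        using m by (simp add: field_simps eval_nat_numeral)
      also have "\<dots> \<le> 2 * C ^ 3 * (inverse m * 1)"
        using m \<phi>(1) by (intro mult_left_mono) (auto simp: power_le_one inverse_le_1_iff)
      finally show ?thesis by (simp add: m_def)
    qed
    then show "\<forall>\<^sub>F n in sequentially. norm (LINT x|lborel. (\<phi> n 2 x)\<^sup>2) \<le> 2 * C ^ 3 * inverse (real (Suc n))"
      by simp
    show "(\<lambda>n. 2 * C ^ 3 * inverse (real (Suc n))) \<longlonglongrightarrow> 0"
      by (rule tendsto_mult_right_zero[OF LIMSEQ_inverse_real_of_nat])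
  qed
  ultimately have "(\<lambda>n. c\<^sup>2 * (LINT x|lborel. (\<phi> n 0 x)\<^sup>2 * ((chi x)\<^sup>2 - 1)) + (LINT x|lborel. (\<phi> n 2 x)\<^sup>2))
      \<longlonglongrightarrow> c\<^sup>2 * (LINT x|lborel. ((chi x)\<^sup>2 - 1)) + 0"
    by (intro tendsto_add tendsto_mult_left)
  moreover have "c\<^sup>2 * (LINT x|lborel. ((chi x)\<^sup>2 - 1)) + 0 < 0"
    using neg c by (simp add: mult_pos_neg)
  ultimately have "\<forall>\<^sub>F n in sequentially. Q (?f n 0) (?f n 2) - c\<^sup>2 * N (?f n 0) < 0"
    unfolding QQ by (intro order_tendstoD)
  then obtain n where "Q (?f n 0) (?f n 2) - c\<^sup>2 * N (?f n 0) < 0"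
    by (auto simp: eventually_sequentially)
  then show ?thesis using that[OF C[of n]] by simp
qed

text \<open>For scalar multiples of a jet, D* D expands to the fourth derivative minus 2 i c chi'
  times the first derivative plus terms of order zero: the two contributions with chi times the
  second derivative cancel. The equation thus has the shape of
  \<open>weak_fourth_order_regularity\<close>, and b = D a is twice differentiable in its own
  right.\<close>

lemma classical_solution:
  assumes ca: "continuous_on UNIV a"
    and EL: "\<And>p p1 p2 g1 g2. C2c p p1 p2 \<Longrightarrow> C2c (Dop p p2) g1 g2 \<Longrightarrow>
       (LINT x|lborel. a x \<bullet> Dstar (Dop p p2) g2 x) = l * (LINT x|lborel. a x \<bullet> p x)"
  obtains a1 a2 b b1 b2 where "\<And>x. (a has_vector_derivative a1 x) (at x)" "\<And>x. (a1 has_vector_derivative a2 x) (at x)"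
    "\<And>x. (b has_vector_derivative b1 x) (at x)" "\<And>x. (b1 has_vector_derivative b2 x) (at x)"
    "\<And>x. a2 x = (c * chi x) *\<^sub>R (\<i> * a x) - b x"
    "\<And>x. b2 x = - ((c * chi x) *\<^sub>R (\<i> * b x)) - l *\<^sub>R a x"
proof -
  \<comment> \<open>These are the lower-order coefficients of D* D - l after i has been moved from
    the test function to \<open>a\<close>, which flips the sign of the terms with chi' and
    chi''.\<close>
  define k1 where "k1 x = (2 * c * chi1 x) *\<^sub>R (\<i> * a x)" for x
  define k0 where "k0 x = (c\<^sup>2 * (chi x)\<^sup>2 - l) *\<^sub>R a x + (c * chi2 x) *\<^sub>R (\<i> * a x)" for x
  have ck: "continuous_on UNIV k1" "continuous_on UNIV k0"
    unfolding k1_def k0_def by (intro continuous_intros ca chi_cont chi2)+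
  have "(LINT x|lborel. \<phi> 4 x *\<^sub>R a x + \<phi> (Suc 0) x *\<^sub>R k1 x + \<phi> 0 x *\<^sub>R k0 x) = 0" if j: "jet 4 \<phi>" for \<phi>
  proof -
    let ?I = "\<lambda>x. \<phi> 4 x *\<^sub>R a x + \<phi> (Suc 0) x *\<^sub>R k1 x + \<phi> 0 x *\<^sub>R k0 x"
    have iI: "integrable lborel ?I"
      by (intro Bochner_Integration.integrable_add jet_integrable[OF j] ca ck) auto
    have cj: "continuous_on UNIV (\<phi> k)" if "k \<le> 4" for k by (rule jet_cont[OF j that])
    have dj: "(\<phi> k has_real_derivative \<phi> (Suc k) x) (at x)" if "k < 4" for k x
      using j that unfolding jet_def by blast
    have csj: "csupp (\<lambda>x. \<phi> 0 x *\<^sub>R w)" for w :: complex by (rule csupp_mono[OF jet_cs[OF j, of 0]]) auto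
    have dz: "((\<lambda>x. f x *\<^sub>R w) has_vector_derivative f' *\<^sub>R w) (at x)"
      if "(f has_real_derivative f') (at x)" for f f' x and w :: complex
      using has_vector_derivative_scaleR[OF that has_vector_derivative_const] by simp
    have djz: "((\<lambda>x. \<phi> k x *\<^sub>R w) has_vector_derivative \<phi> (Suc k) x *\<^sub>R w) (at x)" if "k < 4" for k x and w :: complex
      by (rule dz[OF dj[OF that]])
    have "(LINT x|lborel. ?I x) \<bullet> z = 0" for z
    proof -
      have p: "C2c (\<lambda>x. \<phi> 0 x *\<^sub>R z) (\<lambda>x. \<phi> (Suc 0) x *\<^sub>R z) (\<lambda>x. \<phi> (Suc (Suc 0)) x *\<^sub>R z)"
        unfolding C2c_def using djz[of 0] djz[of "Suc 0"] cj[of "Suc (Suc 0)"] csj by (auto intro!: continuous_intros)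
      let ?g = "Dop (\<lambda>x. \<phi> 0 x *\<^sub>R z) (\<lambda>x. \<phi> (Suc (Suc 0)) x *\<^sub>R z)"
      let ?g1 = "\<lambda>x. (c * (chi1 x * \<phi> 0 x + chi x * \<phi> (Suc 0) x)) *\<^sub>R (\<i> * z) - \<phi> (Suc (Suc (Suc 0))) x *\<^sub>R z"
      let ?g2 = "\<lambda>x. (c * (chi2 x * \<phi> 0 x + 2 * (chi1 x * \<phi> (Suc 0) x) + chi x * \<phi> (Suc (Suc 0)) x)) *\<^sub>R (\<i> * z) - \<phi> 4 x *\<^sub>R z"
      have gx: "?g = (\<lambda>x. (c * (chi x * \<phi> 0 x)) *\<^sub>R (\<i> * z) - \<phi> (Suc (Suc 0)) x *\<^sub>R z)"
        by (auto simp: DD_def fun_eq_iff algebra_simps)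
      have g: "C2c ?g ?g1 ?g2"
        unfolding C2c_def
      proof (intro conjI allI)
        fix x
        have "((\<lambda>x. c * (chi x * \<phi> 0 x)) has_real_derivative c * (chi1 x * \<phi> 0 x + chi x * \<phi> (Suc 0) x)) (at x)"
          by (auto intro!: derivative_eq_intros chi dj)
        from has_vector_derivative_diff[OF dz[OF this, of "\<i> * z"] djz[where k = "Suc (Suc 0)" and w = z]]
        show "(?g has_vector_derivative ?g1 x) (at x)" unfolding gx by simp
        have "((\<lambda>x. c * (chi1 x * \<phi> 0 x + chi x * \<phi> (Suc 0) x)) has_real_derivative
            c * (chi2 x * \<phi> 0 x + 2 * (chi1 x * \<phi> (Suc 0) x) + chi x * \<phi> (Suc (Suc 0)) x)) (at x)"
          by (auto intro!: derivative_eq_intros chi chi1 dj simp: algebra_simps)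
        from has_vector_derivative_diff[OF dz[OF this, of "\<i> * z"] djz[where k = "Suc (Suc (Suc 0))" and w = z]]
        show "(?g1 has_vector_derivative ?g2 x) (at x)" by (simp add: eval_nat_numeral)
      next
        show "continuous_on UNIV ?g2" by (intro continuous_intros chi_cont chi2 cj) auto
        show "csupp ?g" by (rule DD_cont(2)[OF p])
      qed
      have pw: "a x \<bullet> Dstar ?g ?g2 x = ?I x \<bullet> z + l * (a x \<bullet> (\<phi> 0 x *\<^sub>R z))" for x
        unfolding gx Dstar_def k1_def k0_def inner_complex_def
        by (simp add: algebra_simps power2_eq_square)
      have ip: "integrable lborel (\<lambda>x. a x \<bullet> (\<phi> 0 x *\<^sub>R z))"
        by (intro int_inner ca C2cD[OF p] disjI2)
      have "(LINT x|lborel. ?I x) \<bullet> z + l * (LINT x|lborel. a x \<bullet> (\<phi> 0 x *\<^sub>R z))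
          = (LINT x|lborel. ?I x \<bullet> z + l * (a x \<bullet> (\<phi> 0 x *\<^sub>R z)))"
        using iI ip by (simp del: inner_scaleR_right inner_add_left)
      also have "\<dots> = l * (LINT x|lborel. a x \<bullet> (\<phi> 0 x *\<^sub>R z))"
        using EL[OF p g] unfolding pw .
      finally show ?thesis by simp
    qed
    \<comment> \<open>Taking the integral itself as \<open>z\<close> makes it orthogonal to
      itself.\<close>
    from this[of "LINT x|lborel. ?I x"] show ?thesis by simp
  qed
  then obtain a1 a2 e where A: "\<And>x. (a has_vector_derivative a1 x) (at x)" "\<And>x. (a1 has_vector_derivative a2 x) (at x)"
    "\<And>x. (a2 has_vector_derivative k1 x + e x) (at x)" "\<And>x. (e has_vector_derivative - k0 x) (at x)"
    using weak_fourth_order_regularity[OF ca ck] by blast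
  have iv: "((\<lambda>x. \<i> * f x) has_vector_derivative \<i> * f') (at x)" if "(f has_vector_derivative f') (at x)" for f f' x
    by (rule has_vector_derivative_mult_right[OF that])
  show ?thesis
  \<comment> \<open>The middle function is the derivative of i c chi a - a'' with a''' = k1 + e
    inserted. Since k1 = 2 i c chi' a, the terms with chi' combine to a single one of opposite sign,
    and e' = -k0 gives the next derivative.\<close>
  proof (rule that[of a1 a2 "\<lambda>x. (c * chi x) *\<^sub>R (\<i> * a x) - a2 x"
        "\<lambda>x. (c * chi x) *\<^sub>R (\<i> * a1 x) - (c * chi1 x) *\<^sub>R (\<i> * a x) - e x"
        "\<lambda>x. (c * chi x) *\<^sub>R (\<i> * a2 x) - (c * chi2 x) *\<^sub>R (\<i> * a x) + k0 x", OF A(1) A(2)])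
    fix x
    have d: "((\<lambda>x. c * chi x) has_real_derivative c * chi1 x) (at x)"
      "((\<lambda>x. c * chi1 x) has_real_derivative c * chi2 x) (at x)"
      by (auto intro!: derivative_eq_intros chi chi1)
    from has_vector_derivative_diff[OF has_vector_derivative_scaleR[OF d(1) iv[OF A(1)]] A(3)]
    show "((\<lambda>x. (c * chi x) *\<^sub>R (\<i> * a x) - a2 x) has_vector_derivative
       (c * chi x) *\<^sub>R (\<i> * a1 x) - (c * chi1 x) *\<^sub>R (\<i> * a x) - e x) (at x)"
      by (rule has_vector_derivative_eq_rhs) (simp add: k1_def algebra_simps flip: scaleR_add_left)
    from has_vector_derivative_diff[OF has_vector_derivative_diff[OF has_vector_derivative_scaleR[OF d(1) iv[OF A(2)]]
        has_vector_derivative_scaleR[OF d(2) iv[OF A(1)]]] A(4)]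
    show "((\<lambda>x. (c * chi x) *\<^sub>R (\<i> * a1 x) - (c * chi1 x) *\<^sub>R (\<i> * a x) - e x) has_vector_derivative
       (c * chi x) *\<^sub>R (\<i> * a2 x) - (c * chi2 x) *\<^sub>R (\<i> * a x) + k0 x) (at x)"
      by (rule has_vector_derivative_eq_rhs) simp
    show "a2 x = (c * chi x) *\<^sub>R (\<i> * a x) - ((c * chi x) *\<^sub>R (\<i> * a x) - a2 x)" by simp
    show "(c * chi x) *\<^sub>R (\<i> * a2 x) - (c * chi2 x) *\<^sub>R (\<i> * a x) + k0 x
        = - ((c * chi x) *\<^sub>R (\<i> * ((c * chi x) *\<^sub>R (\<i> * a x) - a2 x))) - l *\<^sub>R a x"
      by (simp add: k0_def complex_eq_iff algebra_simps power2_eq_square)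
  qed
qed

text \<open>Two points remain after regularity: b = D a is square-integrable, and lam is not
  0.\<close>

lemma eigenpair:
  assumes int: "integrable lborel (\<lambda>x. (chi x)\<^sup>2 - 1)" and neg: "(LINT x|lborel. ((chi x)\<^sup>2 - 1)) < 0"
  obtains a a1 a2 b b1 b2 l where
    "\<And>x. (a has_vector_derivative a1 x) (at x)" "\<And>x. (a1 has_vector_derivative a2 x) (at x)"
    "\<And>x. (b has_vector_derivative b1 x) (at x)" "\<And>x. (b1 has_vector_derivative b2 x) (at x)"
    "\<And>x. a2 x = (c * chi x) *\<^sub>R (\<i> * a x) - b x"
    "\<And>x. b2 x = - ((c * chi x) *\<^sub>R (\<i> * b x)) - l *\<^sub>R a x"
    "0 < l" "l < c\<^sup>2" "\<exists>x. a x \<noteq> 0"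
    "integrable lborel (\<lambda>x. a x \<bullet> a x)" "integrable lborel (\<lambda>x. b x \<bullet> b x)"
proof -
  obtain f f1 f2 where f: "C2c f f1 f2" "Q f f2 < c\<^sup>2 * N f" using trial_function[OF int neg] by blast
  obtain a B where a: "0 \<le> lam" "lam < c\<^sup>2" "continuous_on UNIV a" "integrable lborel (\<lambda>x. a x \<bullet> a x)"
    "\<exists>x. a x \<noteq> 0"
    and EL: "\<And>p p1 p2 g1 g2. C2c p p1 p2 \<Longrightarrow> C2c (Dop p p2) g1 g2 \<Longrightarrow>
       (LINT x|lborel. a x \<bullet> Dstar (Dop p p2) g2 x) = lam * (LINT x|lborel. a x \<bullet> p x)"
    and B: "\<And>g g1 g2. C2c g g1 g2 \<Longrightarrow> (LINT x|lborel. a x \<bullet> Dstar g g2 x) \<le> (B + N g) / 2"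
    by (rule minimiser[OF f]) (rule that)
  obtain a1 a2 b b1 b2 where A: "\<And>x. (a has_vector_derivative a1 x) (at x)" "\<And>x. (a1 has_vector_derivative a2 x) (at x)"
    "\<And>x. (b has_vector_derivative b1 x) (at x)" "\<And>x. (b1 has_vector_derivative b2 x) (at x)"
    "\<And>x. a2 x = (c * chi x) *\<^sub>R (\<i> * a x) - b x"
    "\<And>x. b2 x = - ((c * chi x) *\<^sub>R (\<i> * b x)) - lam *\<^sub>R a x"
    by (rule classical_solution[OF a(3) EL]) (assumption | rule that)+
  have cb: "continuous_on UNIV b" "continuous_on UNIV b1"
    using A(3,4) by (meson continuous_at_imp_continuous_on has_vector_derivative_continuous)+
  have ca2: "continuous_on UNIV a2" unfolding A(5)[abs_def] by (intro continuous_intros chi_cont a cb)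
  have cb2: "continuous_on UNIV b2" unfolding A(6)[abs_def] by (intro continuous_intros chi_cont a cb)
  have ib: "integrable lborel (\<lambda>x. b x \<bullet> b x)"
  proof -
    obtain \<phi> and C :: real where \<phi>: "0 < C" "\<And>n. jet 2 (\<phi> n)" "\<And>n x. 0 \<le> \<phi> n 0 x" "\<And>n x. \<phi> n 0 x \<le> 1"
       "\<And>x. (\<lambda>n. \<phi> n 0 x) \<longlonglongrightarrow> 1"
      by (rule cutoff_sequence) blast
    have c0: "continuous_on UNIV (\<phi> n 0)" "csupp (\<phi> n 0)" for n
      using jet_cont[OF \<phi>(2)] jet_cs[OF \<phi>(2)] by auto
    show ?thesis
    proof (rule fatou_bound(1)[of _ "\<lambda>n x. \<phi> n 0 x * (b x \<bullet> b x)" B])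
      fix n x
      show i1: "integrable lborel (\<lambda>x. \<phi> n 0 x * (b x \<bullet> b x))"
        by (intro csupp_integrable continuous_intros c0 cb csupp_mono[OF c0(2)[of n]]) simp
      show "0 \<le> \<phi> n 0 x * (b x \<bullet> b x)" using \<phi>(3) by simp
      have "(\<lambda>n. \<phi> n 0 x * (b x \<bullet> b x)) \<longlonglongrightarrow> 1 * (b x \<bullet> b x)" by (intro tendsto_intros \<phi>)
      then show "(\<lambda>n. \<phi> n 0 x * (b x \<bullet> b x)) \<longlonglongrightarrow> b x \<bullet> b x" by simp
      \<comment> \<open>Testing the dual bound with a truncation of b = D a makes the pairing equal
        to the integral of \<phi> |b|^2.\<close>
      let ?g = "\<lambda>x. \<phi> n 0 x *\<^sub>R b x"
      let ?g1 = "\<lambda>x. \<phi> n 0 x *\<^sub>R b1 x + \<phi> n (Suc 0) x *\<^sub>R b x"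
      let ?g2 = "\<lambda>x. \<phi> n 0 x *\<^sub>R b2 x + \<phi> n (Suc 0) x *\<^sub>R b1 x + (\<phi> n (Suc 0) x *\<^sub>R b1 x + \<phi> n (Suc (Suc 0)) x *\<^sub>R b x)"
      have d: "(\<phi> n k has_real_derivative \<phi> n (Suc k) x) (at x)" if "k < 2" for k x
        using \<phi>(2)[of n] that unfolding jet_def by blast
      have g: "C2c ?g ?g1 ?g2"
        unfolding C2c_def
      proof (intro conjI allI)
        show "(?g has_vector_derivative ?g1 x) (at x)" for x
          by (rule has_vector_derivative_scaleR[OF d A(3)]) simp
        show "(?g1 has_vector_derivative ?g2 x) (at x)" for x
          by (intro has_vector_derivative_add has_vector_derivative_scaleR d A) simp_all
        show "continuous_on UNIV ?g2"
          using jet_cont[OF \<phi>(2), of "Suc 0" n] jet_cont[OF \<phi>(2), of "Suc (Suc 0)" n]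
          by (intro continuous_intros c0 cb cb2) auto
        show "csupp ?g" by (rule csupp_mono[OF c0(2)[of n]]) simp
      qed
      have "(LINT x|lborel. \<phi> n 0 x * (b x \<bullet> b x)) = (LINT x|lborel. Dop a a2 x \<bullet> ?g x)"
        by (simp add: DD_def A(5))
      also have "\<dots> = (LINT x|lborel. a x \<bullet> Dstar ?g ?g2 x)"
        by (rule Dstar_adjoint[OF A(1,2) ca2 g])
      also have "\<dots> \<le> (B + N ?g) / 2" by (rule B[OF g])
      finally have 1: "(LINT x|lborel. \<phi> n 0 x * (b x \<bullet> b x)) \<le> (B + N ?g) / 2" .
      have "N ?g \<le> (LINT x|lborel. \<phi> n 0 x * (b x \<bullet> b x))"
      proof (rule integral_mono[OF int_N(1)[OF g] i1])
        fix x
        have "\<phi> n 0 x * (\<phi> n 0 x * (b x \<bullet> b x)) \<le> 1 * (\<phi> n 0 x * (b x \<bullet> b x))"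
          using \<phi>(3,4) by (intro mult_right_mono) auto
        then show "?g x \<bullet> ?g x \<le> \<phi> n 0 x * (b x \<bullet> b x)" by simp
      qed
      \<comment> \<open>Since \<phi>^2 is at most \<phi>, half of the integral reappears on the
        right and is absorbed; this is why the dual bound carries the factor 1/2 in front of N
        g.\<close>
      moreover have "u \<le> B" if "u \<le> (B + v) / 2" "v \<le> u" for u v using that by auto
      ultimately show "(LINT x|lborel. \<phi> n 0 x * (b x \<bullet> b x)) \<le> B" using 1 by blast
    qed
  qed
  \<comment> \<open>For lam = 0 the two equations decouple: D* b = 0 forces b = 0, and then D a = 0
    forces a = 0.\<close>
  have "lam \<noteq> 0"
  proof
    assume 0: "lam = 0"
    have b0: "b x = 0" for x
      by (rule L2_solution_zero[OF A(3,4) cb2 ib]) (simp add: A(6) 0)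
    have "a x = 0" for x
      by (rule L2_solution_zero[OF A(1,2) ca2 a(4)]) (simp add: A(5) b0)
    then show False using a(5) by simp
  qed
  then have "0 < lam" using a(1) by simp
  then show ?thesis using that[OF A _ a(2) a(5) a(4) ib] by blast
qed

end

subsection \<open>Smooth test functions\<close>

text \<open>Derivatives are existential witnesses here, so closure under sums, products and affine
  substitution is an induction on witnesses with no iterated \<open>deriv\<close> to
  compute.\<close>

primrec times_differentiable :: "nat \<Rightarrow> (real \<Rightarrow> real) \<Rightarrow> bool" where
  "times_differentiable 0 f \<longleftrightarrow> True"
| "times_differentiable (Suc n) f \<longleftrightarrow>
     (\<exists>f'. (\<forall>x. (f has_real_derivative f' x) (at x)) \<and> times_differentiable n f')"

lemma times_differentiable_Suc_imp: "times_differentiable (Suc n) f \<Longrightarrow> times_differentiable n f"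
  by (induction n arbitrary: f) auto

lemma times_differentiable_imp_deriv:
  "times_differentiable (Suc n) f \<Longrightarrow> (deriv ^^ n) f differentiable (at x)"
proof (induction n arbitrary: f)
  case 0
  then show ?case by (auto simp: real_differentiable_def)
next
  case (Suc n)
  then obtain f' where f': "\<And>x. (f has_real_derivative f' x) (at x)" "times_differentiable (Suc n) f'"
    by auto
  have "deriv f = f'" using f'(1) by (auto intro: DERIV_imp_deriv)
  then show ?case using Suc.IH[OF f'(2)] by (simp add: funpow_swap1)
qed

lemma times_differentiable_imp_smooth: "(\<And>n. times_differentiable n f) \<Longrightarrow> smooth f"
  unfolding smooth_def using times_differentiable_imp_deriv by blast

lemma times_differentiable_add:
  "times_differentiable n f \<Longrightarrow> times_differentiable n g \<Longrightarrow> times_differentiable n (\<lambda>x. f x + g x)"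
proof (induction n arbitrary: f g)
  case (Suc n)
  then obtain f' g' where "\<And>x. (f has_real_derivative f' x) (at x)" "times_differentiable n f'"
    "\<And>x. (g has_real_derivative g' x) (at x)" "times_differentiable n g'" by auto
  then show ?case
    using Suc.IH by (auto intro!: exI[of _ "\<lambda>x. f' x + g' x"] derivative_intros)
qed simp

lemma times_differentiable_mult:
  "times_differentiable n f \<Longrightarrow> times_differentiable n g \<Longrightarrow> times_differentiable n (\<lambda>x. f x * g x)"
proof (induction n arbitrary: f g)
  case (Suc n)
  then obtain f' g' where d: "\<And>x. (f has_real_derivative f' x) (at x)" "times_differentiable n f'"
    "\<And>x. (g has_real_derivative g' x) (at x)" "times_differentiable n g'" by auto
  have "times_differentiable n (\<lambda>x. f' x * g x + f x * g' x)"
    using times_differentiable_Suc_imp[OF Suc.prems(1)] times_differentiable_Suc_imp[OF Suc.prems(2)] d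
    by (intro times_differentiable_add Suc.IH) auto
  moreover have "((\<lambda>x. f x * g x) has_real_derivative f' x * g x + f x * g' x) (at x)" for x
    by (rule DERIV_cong[OF DERIV_mult[OF d(1) d(3)]]) (simp add: algebra_simps)
  ultimately show ?case
    unfolding times_differentiable.simps by (intro exI[of _ "\<lambda>x. f' x * g x + f x * g' x"] conjI allI)
qed simp

lemma times_differentiable_affine:
  "times_differentiable n f \<Longrightarrow> times_differentiable n (\<lambda>x. f (k * x + m))"
proof (induction n arbitrary: f)
  case (Suc n)
  then obtain f' where f': "\<And>x. (f has_real_derivative f' x) (at x)" "times_differentiable n f'" by auto
  have const: "times_differentiable n (\<lambda>_. k)" for n k
    by (induction n arbitrary: k) (auto intro!: exI[of _ "\<lambda>_. 0"])
  have "((\<lambda>x. f (k * x + m)) has_real_derivative f' (k * x + m) * k) (at x)" for x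
    by (rule DERIV_chain2[OF f'(1)]) (auto intro!: derivative_eq_intros)
  moreover have "times_differentiable n (\<lambda>x. f' (k * x + m) * k)"
    by (rule times_differentiable_mult[OF Suc.IH[OF f'(2)] const])
  ultimately show ?case
    unfolding times_differentiable.simps by (intro exI[of _ "\<lambda>x. f' (k * x + m) * k"] conjI allI)
qed simp

text \<open>\<open>flat 1\<close> is the standard smooth function exp(-1/x) glued to 0. The
  polynomial in 1/x makes the family closed under differentiation.\<close>

definition flat :: "real poly \<Rightarrow> real \<Rightarrow> real" where
  "flat q x = (if x > 0 then poly q (1 / x) * exp (- (1 / x)) else 0)"

lemma poly_times_exp_tendsto_0: "((\<lambda>t::real. poly q t * exp (- t)) \<longlongrightarrow> 0) at_top"
proof -
  have "((\<lambda>t. \<Sum>i\<le>degree q. coeff q i * (t ^ i / exp t)) \<longlongrightarrow> (\<Sum>i\<le>degree q. coeff q i * 0)) at_top"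
    by (intro tendsto_intros tendsto_power_div_exp_0)
  then show ?thesis
    by (simp add: poly_altdef sum_distrib_right exp_minus divide_inverse mult.assoc)
qed

text \<open>With t = 1/x, the derivative of q(t) exp(-t) is -t^2 (q'(t) - q(t)) exp(-t), which
  explains the factor \<open>[:0, 0, 1:]\<close>. At the origin the exponential beats every
  polynomial.\<close>

lemma flat_has_derivative:
  "(flat q has_real_derivative flat ([:0, 0, 1:] * (q - pderiv q)) x) (at x)"
proof -
  consider "x > 0" | "x < 0" | "x = 0" by linarith
  then show ?thesis
  proof cases
    case 1
    have inv: "((\<lambda>x. 1 / x) has_real_derivative - (1 / x\<^sup>2)) (at x)"
      using 1 by (auto intro!: derivative_eq_intros simp: power2_eq_square)
    have "((\<lambda>x. poly q (1 / x) * exp (- (1 / x))) has_real_derivative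
        poly (pderiv q) (1 / x) * (- (1 / x\<^sup>2)) * exp (- (1 / x)) + poly q (1 / x) * (exp (- (1 / x)) * (- (- (1 / x\<^sup>2))))) (at x)"
      by (rule DERIV_cong[OF DERIV_mult[OF DERIV_chain2[OF poly_DERIV inv] DERIV_fun_exp[OF DERIV_minus[OF inv]]]]) simp
    then have "((\<lambda>x. poly q (1 / x) * exp (- (1 / x))) has_real_derivative flat ([:0, 0, 1:] * (q - pderiv q)) x) (at x)"
      by (rule DERIV_cong) (use 1 in \<open>simp add: flat_def field_simps power2_eq_square\<close>)
    then show ?thesis
      by (rule has_field_derivative_transform_within_open[where S = "{0<..}"]) (use 1 in \<open>auto simp: flat_def\<close>)
  next
    case 2
    have "((\<lambda>_. 0) has_real_derivative flat ([:0, 0, 1:] * (q - pderiv q)) x) (at x)"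
      using 2 by (simp add: flat_def)
    then show ?thesis
      by (rule has_field_derivative_transform_within_open[where S = "{..<0}"]) (use 2 in \<open>auto simp: flat_def\<close>)
  next
    case 3
    have "((\<lambda>h. flat q h / h) \<longlongrightarrow> 0) (at_left 0)"
      by (rule tendsto_eventually) (auto simp: eventually_at_filter flat_def)
    \<comment> \<open>The substitution h = 1/t turns the difference quotient into t q(t) exp(-t) at
      infinity.\<close>
    moreover have "((\<lambda>h. flat q h / h) \<longlongrightarrow> 0) (at_right 0)"
      unfolding at_right_to_top
    proof (rule filterlim_filtermap[THEN iffD2], rule Lim_transform_eventually)
      show "((\<lambda>t. poly ([:0, 1:] * q) t * exp (- t)) \<longlongrightarrow> 0) at_top" by (rule poly_times_exp_tendsto_0)
      show "\<forall>\<^sub>F t in at_top. poly ([:0, 1:] * q) t * exp (- t) = flat q (inverse t) / inverse t"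
        using eventually_gt_at_top[of 0] by eventually_elim (simp add: flat_def field_simps)
    qed
    ultimately have "((\<lambda>h. flat q h / h) \<longlongrightarrow> 0) (at 0)" by (simp add: filterlim_split_at)
    then show ?thesis unfolding 3 DERIV_def by (simp add: flat_def)
  qed
qed

lemma times_differentiable_flat: "times_differentiable n (flat q)"
  by (induction n arbitrary: q) (use flat_has_derivative in auto)

text \<open>Products of two flat functions steepened by n + 1 rise to the indicator from below,
  since exp(-1 / ((n + 1) y)) tends to 1 for positive y. They convert pairings with smooth test
  functions into interval integrals.\<close>

lemma test_function_approximating_interval:
  fixes a b :: real
  obtains \<phi> where "\<And>n::nat. test_function (\<phi> n)" "\<And>n x. 0 \<le> \<phi> n x" "\<And>n x. \<phi> n x \<le> indicator {a<..<b} x"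
    "\<And>x. (\<lambda>n. \<phi> n x) \<longlonglongrightarrow> indicator {a<..<b} x"
proof -
  define \<phi> where "\<phi> n x = flat 1 (real (Suc n) * (x - a)) * flat 1 (real (Suc n) * (b - x))" for n x
  have f01: "0 \<le> flat 1 x" "flat 1 x \<le> 1" for x by (auto simp: flat_def)
  have sz: "\<phi> n x = 0" if "x \<notin> {a<..<b}" for n x
    using that by (auto simp: \<phi>_def flat_def zero_less_mult_iff simp del: of_nat_Suc)
  have "smooth (\<phi> n)" for n
  proof (rule times_differentiable_imp_smooth)
    fix k
    have "times_differentiable k (\<lambda>x. flat 1 (real (Suc n) * x + - (real (Suc n) * a)) * flat 1 (- real (Suc n) * x + real (Suc n) * b))"
      by (intro times_differentiable_mult times_differentiable_affine times_differentiable_flat)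
    moreover have "\<phi> n = (\<lambda>x. flat 1 (real (Suc n) * x + - (real (Suc n) * a)) * flat 1 (- real (Suc n) * x + real (Suc n) * b))"
      unfolding \<phi>_def by (rule ext) (simp add: right_diff_distrib add.commute del: of_nat_Suc)
    ultimately show "times_differentiable k (\<phi> n)" by simp
  qed
  moreover have "compact (closure {x. \<phi> n x \<noteq> 0})" for n
  proof -
    have "{x. \<phi> n x \<noteq> 0} \<subseteq> {a<..<b}" using sz by blast
    also have "\<dots> \<subseteq> {a..b}" by auto
    finally have "{x. \<phi> n x \<noteq> 0} \<subseteq> {a..b}" .
    then have "bounded {x. \<phi> n x \<noteq> 0}" using bounded_subset[OF bounded_closed_interval] by blast
    then show ?thesis by (simp add: compact_closure)
  qed
  ultimately have 1: "test_function (\<phi> n)" for n by (simp add: test_function_def)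
  have 2: "0 \<le> \<phi> n x" "\<phi> n x \<le> indicator {a<..<b} x" for n x
  proof -
    show "0 \<le> \<phi> n x" using f01 by (simp add: \<phi>_def)
    show "\<phi> n x \<le> indicator {a<..<b} x"
    proof (cases "x \<in> {a<..<b}")
      case True
      then show ?thesis using f01 by (simp add: \<phi>_def mult_le_one)
    qed (simp add: sz)
  qed
  have "(\<lambda>n. \<phi> n x) \<longlonglongrightarrow> indicator {a<..<b} x" for x
  proof (cases "x \<in> {a<..<b}")
    case True
    have f: "(\<lambda>n. flat 1 (real (Suc n) * y)) \<longlonglongrightarrow> 1" if "y > 0" for y
    proof -
      have "(\<lambda>n. exp (- (inverse (real (Suc n)) * (1 / y)))) \<longlonglongrightarrow> exp (- (0 * (1 / y)))"
        by (intro tendsto_intros LIMSEQ_inverse_real_of_nat)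
      moreover have "flat 1 (real (Suc n) * y) = exp (- (inverse (real (Suc n)) * (1 / y)))" for n
        using that by (simp add: flat_def divide_inverse del: of_nat_Suc)
      ultimately show ?thesis by simp
    qed
    have "(\<lambda>n. \<phi> n x) \<longlonglongrightarrow> 1 * 1"
      unfolding \<phi>_def by (intro tendsto_mult f) (use True in auto)
    then show ?thesis using True by simp
  qed (simp add: sz)
  with 1 2 show ?thesis using that by blast
qed

text \<open>Open intervals form an intersection-stable generator, so after restriction to (-n, n)
  the integral vanishes over every Borel set. The restriction makes the function integrable, and its
  total integral is itself an interval integral, which handles complements.\<close>

lemma AE_zero_if_interval_integrals_zero:
  fixes h :: "real \<Rightarrow> 'a::{second_countable_topology, banach}"
  assumes h: "\<And>a b. set_integrable lborel {a..b} h"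
    and zero: "\<And>a b. (LINT x|lborel. indicator {a<..<b} x *\<^sub>R h x) = 0"
  shows "AE x in lborel. h x = 0"
proof -
  have "AE x in lborel. indicator {- real n<..<real n} x *\<^sub>R h x = 0" for n :: nat
  proof -
    let ?h = "\<lambda>x. indicator {- real n<..<real n} x *\<^sub>R h x"
    have ih: "integrable lborel ?h"
    proof -
      have "{- real n<..<real n} \<subseteq> {- real n..real n}" by auto
      from set_integrable_subset[OF h _ this] show ?thesis by (simp add: set_integrable_def)
    qed
    have ihA: "integrable lborel (\<lambda>x. indicator A x *\<^sub>R ?h x)" if "A \<in> sets borel" for A
      by (rule integrable_mult_indicator[OF _ ih]) (use that in simp)
    let ?G = "range (\<lambda>(a, b). {a<..<b :: real})"
    have borel: "sets borel = sigma_sets UNIV ?G"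
    proof -
      have "borel = sigma UNIV ?G" using borel_eq_box[where 'a = real] by (simp only: box_real)
      then show ?thesis by (metis sets_measure_of top_greatest Pow_UNIV)
    qed
    have "(LINT x|lborel. indicator A x *\<^sub>R ?h x) = 0" if "A \<in> sigma_sets UNIV ?G" for A
    proof (rule sigma_sets_induct_disjoint[OF _ _ that])
      show "Int_stable ?G"
        unfolding Int_stable_def
      proof (intro ballI)
        fix A B assume "A \<in> ?G" "B \<in> ?G"
        then obtain a b c d where "A = {a<..<b}" "B = {c<..<d}" by auto
        then have "A \<inter> B = (\<lambda>(a, b). {a<..<b}) (max a c, min b d)" by (simp add: Int_greaterThanLessThan)
        then show "A \<inter> B \<in> ?G" by blast
      qed
      fix A assume "A \<in> ?G"
      then obtain a b where "A = {a<..<b}" by auto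
      \<comment> \<open>Intersecting with (-n, n) gives another open interval, possibly
        empty.\<close>
      then have eq: "indicator A x *\<^sub>R ?h x = indicator {max a (- real n)<..<min b (real n)} x *\<^sub>R h x" for x
        by (auto simp: indicator_def)
      show "(LINT x|lborel. indicator A x *\<^sub>R ?h x) = 0" unfolding eq by (rule zero)
    next
      fix A assume A: "A \<in> sigma_sets UNIV ?G" "(LINT x|lborel. indicator A x *\<^sub>R ?h x) = 0"
      have "(LINT x|lborel. indicator (UNIV - A) x *\<^sub>R ?h x) = (LINT x|lborel. ?h x - indicator A x *\<^sub>R ?h x)"
      proof (rule Bochner_Integration.integral_cong[OF refl])
        show "indicator (UNIV - A) x *\<^sub>R ?h x = ?h x - indicator A x *\<^sub>R ?h x" for x by (cases "x \<in> A") simp_all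
      qed
      also have "\<dots> = 0" using A ih ihA[of A] zero by (simp add: borel)
      finally show "(LINT x|lborel. indicator (UNIV - A) x *\<^sub>R ?h x) = 0" .
    next
      fix A :: "nat \<Rightarrow> real set"
      assume A: "disjoint_family A" "range A \<subseteq> sigma_sets UNIV ?G" "\<And>i. (LINT x|lborel. indicator (A i) x *\<^sub>R ?h x) = 0"
      have "(LINT x:(\<Union>i. A i)|lborel. ?h x) = (\<Sum>i. (LINT x:(A i)|lborel. ?h x))"
      proof (rule lebesgue_integral_countable_add)
        show "A i \<in> sets lborel" for i using A(2) borel by auto
        show "A i \<inter> A j = {}" if "i \<noteq> j" for i j using A(1) that by (auto simp: disjoint_family_on_def)
        have "(\<Union>i. A i) \<in> sets borel" using A(2) unfolding borel[symmetric] by auto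
        then show "set_integrable lborel (\<Union>i. A i) ?h" unfolding set_integrable_def by (rule ihA)
      qed
      then show "(LINT x|lborel. indicator (\<Union>i. A i) x *\<^sub>R ?h x) = 0"
        using A(3) by (simp add: set_lebesgue_integral_def)
    qed (auto simp: zero)
    then have "set_lebesgue_integral lborel A ?h = 0" if "A \<in> sets lborel" for A
      using that borel by (simp add: set_lebesgue_integral_def)
    then show ?thesis by (intro sigma_finite_measure.density_zero[OF sigma_finite_lborel ih]) auto
  qed
  then have "AE x in lborel. \<forall>n::nat. indicator {- real n<..<real n} x *\<^sub>R h x = 0"
    unfolding AE_all_countable by blast
  then show ?thesis
  proof eventually_elim
    case (elim x)
    obtain n :: nat where "\<bar>x\<bar> < real n" using reals_Archimedean2 by blast
    then have "x \<in> {- real n<..<real n}" by auto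
    then show ?case using elim[rule_format, of n] by simp
  qed
qed

subsection \<open>Weak derivatives\<close>

lemma test_functionD:
  assumes "test_function \<phi>"
  shows "(\<phi> has_vector_derivative deriv \<phi> x) (at x)" "continuous_on UNIV \<phi>" "continuous_on UNIV (deriv \<phi>)"
    "csupp \<phi>" "csupp (deriv \<phi>)"
proof -
  have sm: "(deriv ^^ n) \<phi> differentiable (at x)" for n x
    using assms unfolding test_function_def smooth_def by blast
  show d: "(\<phi> has_vector_derivative deriv \<phi> x) (at x)" for x
    using sm[of 0 x] by (simp add: DERIV_deriv_iff_real_differentiable flip: has_real_derivative_iff_has_vector_derivative)
  show "continuous_on UNIV \<phi>" "continuous_on UNIV (deriv \<phi>)"
    using sm[of 0] sm[of 1] by (auto simp: continuous_on_eq_continuous_at intro: differentiable_imp_continuous_within)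
  have "bounded (closure {x. \<phi> x \<noteq> 0})"
    using assms unfolding test_function_def by (intro compact_imp_bounded) auto
  then obtain R where R: "\<And>x. x \<in> closure {x. \<phi> x \<noteq> 0} \<Longrightarrow> \<bar>x\<bar> \<le> R"
    unfolding bounded_iff by (metis real_norm_def)
  show "csupp \<phi>"
  proof (rule csuppI[of R])
    fix x assume x: "R < \<bar>x\<bar>"
    show "\<phi> x = 0"
    proof (rule ccontr)
      assume "\<phi> x \<noteq> 0"
      then have "x \<in> closure {x. \<phi> x \<noteq> 0}" by (intro subsetD[OF closure_subset]) simp
      then show False using R x by fastforce
    qed
  qed
  then show "csupp (deriv \<phi>)" using csupp_deriv d by blast
qed

lemma locally_integrable_mult:
  assumes k: "continuous_on UNIV k" "csupp k" and g: "locally_integrable g"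
  shows "integrable lborel (\<lambda>x. k x *\<^sub>R g x)"
proof -
  obtain R where R: "\<And>x. R < \<bar>x\<bar> \<Longrightarrow> k x = 0" using csuppE[OF k(2)] by blast
  have "bounded (k ` {-R..R})"
    using continuous_on_subset[OF k(1)] by (intro compact_imp_bounded compact_continuous_image) auto
  then obtain C where C: "\<And>x. x \<in> {-R..R} \<Longrightarrow> \<bar>k x\<bar> \<le> C" unfolding bounded_iff by (metis imageI real_norm_def)
  let ?g = "\<lambda>x. indicator {-R..R} x *\<^sub>R g x"
  have ig: "integrable lborel ?g" using g unfolding locally_integrable_def set_integrable_def by blast
  have [measurable]: "k \<in> borel_measurable borel" by (rule borel_measurable_continuous_onI[OF k(1)])
  have eq: "k x *\<^sub>R g x = k x *\<^sub>R ?g x" for x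
    using R[of x] by (cases "x \<in> {-R..R}") (auto simp: abs_if split: if_splits)
  have "integrable lborel (\<lambda>x. k x *\<^sub>R ?g x)"
  proof (rule Bochner_Integration.integrable_bound)
    show "integrable lborel (\<lambda>x. C *\<^sub>R ?g x)"
      by (rule integrable_scaleR_right) (rule ig)
    show "(\<lambda>x. k x *\<^sub>R ?g x) \<in> borel_measurable lborel"
      using borel_measurable_integrable[OF ig] by measurable
    show "AE x in lborel. norm (k x *\<^sub>R ?g x) \<le> norm (C *\<^sub>R ?g x)"
    proof (rule AE_I2)
      fix x show "norm (k x *\<^sub>R ?g x) \<le> norm (C *\<^sub>R ?g x)"
        using C[of x] by (cases "x \<in> {-R..R}") (auto intro!: mult_right_mono)
    qed
  qed
  then show ?thesis unfolding eq .
qed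

lemma locally_integrable_continuous: "continuous_on UNIV g \<Longrightarrow> locally_integrable g"
  unfolding locally_integrable_def
  by (auto intro!: borel_integrable_atLeastAtMost' intro: continuous_on_subset)

lemma C1_has_weak_deriv:
  assumes "\<And>x. (f has_vector_derivative f' x) (at x)" "continuous_on UNIV f'"
  shows "has_weak_deriv f f'"
proof -
  have "continuous_on UNIV f"
    using assms by (meson continuous_at_imp_continuous_on has_vector_derivative_continuous)
  then show ?thesis
    unfolding has_weak_deriv_def
    using assms by (auto intro!: locally_integrable_continuous integral_by_parts_scaleR test_functionD)
qed

text \<open>\<open>weak_deriv\<close> is an arbitrary choice, so this uniqueness is what lets it be
  computed on classical functions.\<close>

lemma has_weak_deriv_unique:
  assumes "has_weak_deriv f g" "has_weak_deriv f g'"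
  shows "AE x in lborel. g x = g' x"
proof -
  have lg: "locally_integrable g" "locally_integrable g'"
    using assms unfolding has_weak_deriv_def by auto
  have sh: "set_integrable lborel {a..b} (\<lambda>x. g x - g' x)" for a b
    using lg unfolding locally_integrable_def by (intro set_integral_diff) auto
  have "(LINT x|lborel. indicator {a<..<b} x *\<^sub>R (g x - g' x)) = 0" for a b
  proof -
    obtain \<phi> where \<phi>: "\<And>n::nat. test_function (\<phi> n)" "\<And>n x. 0 \<le> \<phi> n x" "\<And>n x. \<phi> n x \<le> indicator {a<..<b} x"
      "\<And>x. (\<lambda>n. \<phi> n x) \<longlonglongrightarrow> indicator {a<..<b} x"
      by (rule test_function_approximating_interval[of a b]) blast
    have i: "integrable lborel (\<lambda>x. \<phi> n x *\<^sub>R g x)" "integrable lborel (\<lambda>x. \<phi> n x *\<^sub>R g' x)" for n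
      using \<phi>(1) lg by (auto intro!: locally_integrable_mult test_functionD)
    have "(LINT x|lborel. \<phi> n x *\<^sub>R g x) = (LINT x|lborel. \<phi> n x *\<^sub>R g' x)" for n
    proof -
      have "(LINT x|lborel. deriv (\<phi> n) x *\<^sub>R f x) = - (LINT x|lborel. \<phi> n x *\<^sub>R g x)"
        "(LINT x|lborel. deriv (\<phi> n) x *\<^sub>R f x) = - (LINT x|lborel. \<phi> n x *\<^sub>R g' x)"
        using assms \<phi>(1)[of n] unfolding has_weak_deriv_def by blast+
      then show ?thesis by simp
    qed
    then have z: "(LINT x|lborel. \<phi> n x *\<^sub>R (g x - g' x)) = 0" for n
      using i[of n] by (simp add: scaleR_diff_right)
    \<comment> \<open>Local integrability is phrased for closed intervals, which also provides the
      majorant for dominated convergence.\<close>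
    have s: "indicator {a<..<b} x *\<^sub>R (g x - g' x) = indicator {a<..<b} x *\<^sub>R (indicator {a..b} x *\<^sub>R (g x - g' x))" for x
      by (auto simp: indicator_def)
    have ih: "integrable lborel (\<lambda>x. indicator {a..b} x *\<^sub>R (g x - g' x))" using sh unfolding set_integrable_def .
    have "(\<lambda>n. LINT x|lborel. \<phi> n x *\<^sub>R (g x - g' x)) \<longlonglongrightarrow> (LINT x|lborel. indicator {a<..<b} x *\<^sub>R (g x - g' x))"
    proof (rule integral_dominated_convergence[where w = "\<lambda>x. norm (indicator {a..b} x *\<^sub>R (g x - g' x))"])
      show "(\<lambda>x. indicator {a<..<b} x *\<^sub>R (g x - g' x)) \<in> borel_measurable lborel"
        unfolding s using borel_measurable_integrable[OF ih] by measurable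
      show "(\<lambda>x. \<phi> n x *\<^sub>R (g x - g' x)) \<in> borel_measurable lborel" for n
        using i[of n] by (simp add: scaleR_diff_right)
      show "AE x in lborel. (\<lambda>n. \<phi> n x *\<^sub>R (g x - g' x)) \<longlonglongrightarrow> indicator {a<..<b} x *\<^sub>R (g x - g' x)"
        by (intro AE_I2 tendsto_intros \<phi>)
      show "AE x in lborel. norm (\<phi> n x *\<^sub>R (g x - g' x)) \<le> norm (indicator {a..b} x *\<^sub>R (g x - g' x))" for n
      proof (rule AE_I2)
        fix x
        have "indicator {a<..<b} x \<le> (indicator {a..b} x :: real)" by (auto simp: indicator_def)
        then have "\<bar>\<phi> n x\<bar> \<le> indicator {a..b} x" using \<phi>(2,3)[of n x] by simp
        then show "norm (\<phi> n x *\<^sub>R (g x - g' x)) \<le> norm (indicator {a..b} x *\<^sub>R (g x - g' x))"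
          by (simp add: mult_right_mono)
      qed
    qed (rule integrable_norm[OF ih])
    then show ?thesis unfolding z by (simp add: LIMSEQ_const_iff)
  qed
  then have "AE x in lborel. g x - g' x = 0" by (intro AE_zero_if_interval_integrals_zero sh)
  then show ?thesis by simp
qed

lemma weak_deriv_AE:
  assumes "has_weak_deriv f g"
  shows "has_weak_deriv f (weak_deriv f)" "AE x in lborel. weak_deriv f x = g x"
proof -
  show *: "has_weak_deriv f (weak_deriv f)" unfolding weak_deriv_def by (rule someI[of "has_weak_deriv f", OF assms])
  show "AE x in lborel. weak_deriv f x = g x" by (rule has_weak_deriv_unique[OF * assms])
qed

text \<open>A second weak derivative is taken of a function known only almost everywhere, namely of
  a chosen representative of the first.\<close>

lemma has_weak_deriv_cong_AE:
  assumes f: "has_weak_deriv f g" and f': "locally_integrable f'" and AE: "AE x in lborel. f' x = f x"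
  shows "has_weak_deriv f' g"
  unfolding has_weak_deriv_def
proof (intro conjI allI impI)
  fix \<phi> assume \<phi>: "test_function \<phi>"
  have lf: "locally_integrable f" using f unfolding has_weak_deriv_def by blast
  have "(LINT x|lborel. deriv \<phi> x *\<^sub>R f' x) = (LINT x|lborel. deriv \<phi> x *\<^sub>R f x)"
  proof (rule integral_cong_AE)
    show "(\<lambda>x. deriv \<phi> x *\<^sub>R f' x) \<in> borel_measurable lborel" "(\<lambda>x. deriv \<phi> x *\<^sub>R f x) \<in> borel_measurable lborel"
      by (intro borel_measurable_integrable locally_integrable_mult test_functionD \<phi> lf f')+
    show "AE x in lborel. deriv \<phi> x *\<^sub>R f' x = deriv \<phi> x *\<^sub>R f x" using AE by eventually_elim simp
  qed
  also have "\<dots> = - (LINT x|lborel. \<phi> x *\<^sub>R g x)" using f \<phi> unfolding has_weak_deriv_def by blast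
  finally show "(LINT x|lborel. deriv \<phi> x *\<^sub>R f' x) = - (LINT x|lborel. \<phi> x *\<^sub>R g x)" .
qed (use f f' in \<open>auto simp: has_weak_deriv_def\<close>)

lemma bounded_linear_vector_scalar_mult: "bounded_linear (\<lambda>v :: complex ^ 'n. k *s v)"
  by (rule linear_conv_bounded_linear[THEN iffD1], rule linearI) (simp_all add: vec_eq_iff algebra_simps)

lemma locally_integrable_scalar_mult:
  assumes "locally_integrable g"
  shows "locally_integrable (\<lambda>x. k *s g x)"
proof -
  have "integrable lborel (\<lambda>x. k *s (indicator {a..b} x *\<^sub>R g x))" for a b :: real
    using assms unfolding locally_integrable_def set_integrable_def
    by (intro integrable_bounded_linear[OF bounded_linear_vector_scalar_mult]) blast
  moreover have "k *s (indicator {a..b} x *\<^sub>R g x) = indicator {a..b} x *\<^sub>R (k *s g x)" for a b x :: real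
    by (simp add: vec_eq_iff)
  ultimately show ?thesis unfolding locally_integrable_def set_integrable_def by simp
qed

text \<open>Each of the two choices agrees with the classical derivative outside a null set; the
  sign is (-i)^2.\<close>

lemma P_X_P_X_AE:
  assumes f: "\<And>x. (f has_vector_derivative f1 x) (at x)" "\<And>x. (f1 has_vector_derivative f2 x) (at x)"
    "continuous_on UNIV f2"
  shows "AE x in lborel. P_X (P_X f) x = - f2 x"
proof -
  have c1: "continuous_on UNIV f1"
    using f by (meson continuous_at_imp_continuous_on has_vector_derivative_continuous)
  note w = weak_deriv_AE[OF C1_has_weak_deriv[OF f(1) c1]]
  have lw: "locally_integrable (weak_deriv f)" using w(1) unfolding has_weak_deriv_def by blast
  have "has_weak_deriv (\<lambda>x. (- \<i>) *s f1 x) (\<lambda>x. (- \<i>) *s f2 x)"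
    by (rule C1_has_weak_deriv)
       (intro bounded_linear.has_vector_derivative[OF bounded_linear_vector_scalar_mult] f
          bounded_linear.continuous_on[OF bounded_linear_vector_scalar_mult])+
  then have "has_weak_deriv (P_X f) (\<lambda>x. (- \<i>) *s f2 x)"
    unfolding P_X_def
    by (rule has_weak_deriv_cong_AE[OF _ locally_integrable_scalar_mult[OF lw]])
       (use w(2) in eventually_elim, simp)
  from weak_deriv_AE(2)[OF this] show ?thesis
    unfolding P_X_def[of "P_X f"] by eventually_elim (simp add: vec_eq_iff)
qed

lemma sobolev_2I:
  assumes f: "\<And>x. (f has_vector_derivative f1 x) (at x)" "\<And>x. (f1 has_vector_derivative f2 x) (at x)"
    "continuous_on UNIV f2"
    and i: "integrable lborel (\<lambda>x. (norm (f x))\<^sup>2)" "integrable lborel (\<lambda>x. (norm (f1 x))\<^sup>2)"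
      "integrable lborel (\<lambda>x. (norm (f2 x))\<^sup>2)"
  shows "f \<in> sobolev 2"
proof -
  have c: "continuous_on UNIV f" "continuous_on UNIV f1"
    using f by (meson continuous_at_imp_continuous_on has_vector_derivative_continuous)+
  have "f \<in> L2" "f1 \<in> L2" "f2 \<in> L2"
    unfolding L2_def using i c f(3) by (auto intro: borel_measurable_continuous_onI)
  then show ?thesis
    using C1_has_weak_deriv[OF f(1) c(2)] C1_has_weak_deriv[OF f(2) f(3)] by (auto simp: numeral_2_eq_2)
qed

lemma norm_vector_2: "(norm (vector [u, v] :: complex ^ 2))\<^sup>2 = (norm u)\<^sup>2 + (norm v)\<^sup>2"
  by (simp add: norm_vec_def L2_set_def sum_2 real_sqrt_pow2)

lemma has_vector_derivative_vector_2:
  assumes "(u has_vector_derivative u') (at x)" "(v has_vector_derivative v') (at x)"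
  shows "((\<lambda>x. vector [u x, v x] :: complex ^ 2) has_vector_derivative vector [u', v']) (at x)"
proof -
  have b: "bounded_linear (\<lambda>z. vector [z, 0] :: complex ^ 2)" "bounded_linear (\<lambda>z. vector [0, z] :: complex ^ 2)"
    by (rule linear_conv_bounded_linear[THEN iffD1], rule linearI; simp add: vec_eq_iff forall_2)+
  have eq: "vector [y, z] = vector [y, 0] + (vector [0, z] :: complex ^ 2)" for y z by (simp add: vec_eq_iff forall_2)
  from has_vector_derivative_add[OF bounded_linear.has_vector_derivative[OF b(1) assms(1)]
      bounded_linear.has_vector_derivative[OF b(2) assms(2)]]
  show ?thesis by (simp only: eq[symmetric])
qed

lemma integrable_norm_lincomb:
  fixes f g :: "real \<Rightarrow> complex"
  assumes "integrable lborel (\<lambda>x. f x \<bullet> f x)" "integrable lborel (\<lambda>x. g x \<bullet> g x)"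
    "continuous_on UNIV f" "continuous_on UNIV g"
  shows "integrable lborel (\<lambda>x. (norm (k * f x + m * g x))\<^sup>2)"
proof (rule Bochner_Integration.integrable_bound)
  show "integrable lborel (\<lambda>x. 2 * (norm k)\<^sup>2 * (f x \<bullet> f x) + 2 * (norm m)\<^sup>2 * (g x \<bullet> g x))"
    using assms by simp
  have "continuous_on UNIV (\<lambda>x. (norm (k * f x + m * g x))\<^sup>2)" by (intro continuous_intros assms)
  then show "(\<lambda>x. (norm (k * f x + m * g x))\<^sup>2) \<in> borel_measurable lborel"
    using borel_measurable_continuous_onI by auto
  show "AE x in lborel. norm ((norm (k * f x + m * g x))\<^sup>2) \<le> norm (2 * (norm k)\<^sup>2 * (f x \<bullet> f x) + 2 * (norm m)\<^sup>2 * (g x \<bullet> g x))"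
  proof (rule AE_I2)
    fix x
    have "(norm (k * f x + m * g x))\<^sup>2 \<le> (norm (k * f x) + norm (m * g x))\<^sup>2"
      by (intro power_mono norm_triangle_ineq) simp
    also have "\<dots> \<le> 2 * (norm (k * f x))\<^sup>2 + 2 * (norm (m * g x))\<^sup>2"
      using sum_squares_bound[of "norm (k * f x)" "norm (m * g x)"] by (simp add: power2_sum)
    also have "\<dots> = 2 * (norm k)\<^sup>2 * (f x \<bullet> f x) + 2 * (norm m)\<^sup>2 * (g x \<bullet> g x)"
      by (simp add: norm_mult power_mult_distrib power2_norm_eq_inner)
    finally show "norm ((norm (k * f x + m * g x))\<^sup>2) \<le> norm (2 * (norm k)\<^sup>2 * (f x \<bullet> f x) + 2 * (norm m)\<^sup>2 * (g x \<bullet> g x))"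
      by simp
  qed
qed

subsection \<open>The eigenvalues\<close>

text \<open>Inverting the change of components with q = a and p = -i (\<alpha>2 / \<Omega>) b gives
  the eigenfunction. Only \<Omega>^2 is tied to \<open>l\<close>, so either sign of \<Omega> is
  admissible.\<close>

lemma eigenvalue_from_pair:
  fixes \<alpha>2 \<theta> \<Omega> l :: real
  assumes "\<alpha>2 \<noteq> 0" "\<Omega> \<noteq> 0" "\<Omega>\<^sup>2 = \<alpha>2\<^sup>2 * l" and chi: "continuous_on UNIV chi" "\<And>x. \<bar>chi x\<bar> \<le> M"
    and a: "\<And>x. (a has_vector_derivative a1 x) (at x)" "\<And>x. (a1 has_vector_derivative a2 x) (at x)"
    and b: "\<And>x. (b has_vector_derivative b1 x) (at x)" "\<And>x. (b1 has_vector_derivative b2 x) (at x)"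
    and a2: "\<And>x. a2 x = (\<theta> / \<alpha>2 * chi x) *\<^sub>R (\<i> * a x) - b x"
    and b2: "\<And>x. b2 x = - ((\<theta> / \<alpha>2 * chi x) *\<^sub>R (\<i> * b x)) - l *\<^sub>R a x"
    and nz: "a x0 \<noteq> 0"
    and L2: "integrable lborel (\<lambda>x. a x \<bullet> a x)" "integrable lborel (\<lambda>x. b x \<bullet> b x)"
  shows "eigenvalue_on (sobolev 2) (\<SS> 1 \<alpha>1 \<alpha>2 \<theta> chi 0) (complex_of_real \<Omega>)"
proof -
  have ca: "continuous_on UNIV a" "continuous_on UNIV a1" and cb: "continuous_on UNIV b" "continuous_on UNIV b1"
    using a b by (meson continuous_at_imp_continuous_on has_vector_derivative_continuous)+
  have ca2: "continuous_on UNIV a2" unfolding a2[abs_def] by (intro continuous_intros chi ca cb)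
  have cb2: "continuous_on UNIV b2" unfolding b2[abs_def] by (intro continuous_intros chi ca cb)
  \<comment> \<open>Boundedness of \<open>chi\<close> and the equations give square-integrable
    second derivatives; the first derivatives then follow from
    \<open>integrable_derivative\<close>.\<close>
  have i_chi: "integrable lborel (\<lambda>x. ((\<theta> / \<alpha>2 * chi x) *\<^sub>R (\<i> * f x)) \<bullet> ((\<theta> / \<alpha>2 * chi x) *\<^sub>R (\<i> * f x)))"
    if f: "continuous_on UNIV f" "integrable lborel (\<lambda>x. f x \<bullet> f x)" for f
  proof (rule Bochner_Integration.integrable_bound)
    show "integrable lborel (\<lambda>x. (\<theta> / \<alpha>2 * M)\<^sup>2 * (f x \<bullet> f x))" using f by simp
    have "continuous_on UNIV (\<lambda>x. ((\<theta> / \<alpha>2 * chi x) *\<^sub>R (\<i> * f x)) \<bullet> ((\<theta> / \<alpha>2 * chi x) *\<^sub>R (\<i> * f x)))"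
      by (intro continuous_intros chi f)
    then show "(\<lambda>x. ((\<theta> / \<alpha>2 * chi x) *\<^sub>R (\<i> * f x)) \<bullet> ((\<theta> / \<alpha>2 * chi x) *\<^sub>R (\<i> * f x))) \<in> borel_measurable lborel"
      using borel_measurable_continuous_onI by auto
    show "AE x in lborel. norm (((\<theta> / \<alpha>2 * chi x) *\<^sub>R (\<i> * f x)) \<bullet> ((\<theta> / \<alpha>2 * chi x) *\<^sub>R (\<i> * f x)))
        \<le> norm ((\<theta> / \<alpha>2 * M)\<^sup>2 * (f x \<bullet> f x))"
    proof (rule AE_I2)
      fix x
      have "(chi x)\<^sup>2 \<le> M\<^sup>2" using power_mono[OF chi(2)[of x], of 2] by simp
      then have "(\<theta> / \<alpha>2 * chi x)\<^sup>2 \<le> (\<theta> / \<alpha>2 * M)\<^sup>2"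
        unfolding power_mult_distrib by (rule mult_left_mono) simp
      then have "(\<theta> / \<alpha>2 * chi x)\<^sup>2 * (f x \<bullet> f x) \<le> (\<theta> / \<alpha>2 * M)\<^sup>2 * (f x \<bullet> f x)"
        by (rule mult_right_mono) simp
      moreover have "((\<theta> / \<alpha>2 * chi x) *\<^sub>R (\<i> * f x)) \<bullet> ((\<theta> / \<alpha>2 * chi x) *\<^sub>R (\<i> * f x)) = (\<theta> / \<alpha>2 * chi x)\<^sup>2 * (f x \<bullet> f x)"
        unfolding inner_scaleR_left inner_scaleR_right inner_ii by (simp only: power2_eq_square mult.assoc)
      ultimately show "norm (((\<theta> / \<alpha>2 * chi x) *\<^sub>R (\<i> * f x)) \<bullet> ((\<theta> / \<alpha>2 * chi x) *\<^sub>R (\<i> * f x)))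
        \<le> norm ((\<theta> / \<alpha>2 * M)\<^sup>2 * (f x \<bullet> f x))" by simp
    qed
  qed
  have i_comb: "integrable lborel (\<lambda>x. (k * f x + m * g x) \<bullet> (k * f x + m * g x))"
    if "integrable lborel (\<lambda>x. f x \<bullet> f x)" "integrable lborel (\<lambda>x. g x \<bullet> g x)" "continuous_on UNIV f" "continuous_on UNIV g"
    for k m :: complex and f g :: "real \<Rightarrow> complex"
    using integrable_norm_lincomb[OF that, of k m] by (simp add: power2_norm_eq_inner)
  have cc: "continuous_on UNIV (\<lambda>x. (\<theta> / \<alpha>2 * chi x) *\<^sub>R (\<i> * f x))" if "continuous_on UNIV f" for f
    by (intro continuous_intros chi that)
  have ia2: "integrable lborel (\<lambda>x. a2 x \<bullet> a2 x)"
    using i_comb[OF i_chi[OF ca(1) L2(1)] L2(2) cc[OF ca(1)] cb(1), of 1 "-1"] unfolding a2 by simp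
  have ib2: "integrable lborel (\<lambda>x. b2 x \<bullet> b2 x)"
    using i_comb[OF i_chi[OF cb(1) L2(2)] L2(1) cc[OF cb(1)] ca(1), of "-1" "- complex_of_real l"] unfolding b2
    by (simp add: scaleR_conv_of_real)
  have ia1: "integrable lborel (\<lambda>x. a1 x \<bullet> a1 x)" by (rule integrable_derivative[OF a ca2 L2(1) ia2])
  have ib1: "integrable lborel (\<lambda>x. b1 x \<bullet> b1 x)" by (rule integrable_derivative[OF b cb2 L2(2) ib2])
  \<comment> \<open>\<open>k\<close> b is half of p; the halves come from solving p and q for the
    two components.\<close>
  define k where "k = - \<i> * complex_of_real (\<alpha>2 / (2 * \<Omega>))"
  let ?v = "\<lambda>f g x. vector [k * f x + (1/2) * g x, k * f x + (-1/2) * g x] :: complex ^ 2"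
  have dv: "(?v f g has_vector_derivative ?v f' g' x) (at x)"
    if "\<And>x. (f has_vector_derivative f' x) (at x)" "\<And>x. (g has_vector_derivative g' x) (at x)" for f f' g g' x
    by (intro has_vector_derivative_vector_2 has_vector_derivative_add has_vector_derivative_mult_right that)
  have iv: "integrable lborel (\<lambda>x. (norm (?v f g x))\<^sup>2)"
    if "integrable lborel (\<lambda>x. f x \<bullet> f x)" "integrable lborel (\<lambda>x. g x \<bullet> g x)" "continuous_on UNIV f" "continuous_on UNIV g"
    for f g :: "real \<Rightarrow> complex"
    unfolding norm_vector_2
    by (intro Bochner_Integration.integrable_add integrable_norm_lincomb that)
  have veq: "?v f g x = vector [k * f x, k * f x] + vector [(1/2) * g x, (-1/2) * g x]" for f g x
    by (simp add: vec_eq_iff forall_2)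
  have cv: "continuous_on UNIV (?v b2 a2)"
  proof -
    have bl: "bounded_linear (\<lambda>z. vector [k * z, k * z] :: complex ^ 2)"
      "bounded_linear (\<lambda>z. vector [(1/2) * z, (-1/2) * z] :: complex ^ 2)"
      by (rule linear_conv_bounded_linear[THEN iffD1], rule linearI; simp add: vec_eq_iff forall_2 algebra_simps)+
    have "continuous_on UNIV (\<lambda>x. vector [k * b2 x, k * b2 x] + (vector [(1/2) * a2 x, (-1/2) * a2 x] :: complex ^ 2))"
      by (rule continuous_on_add[OF bounded_linear.continuous_on[OF bl(1) cb2] bounded_linear.continuous_on[OF bl(2) ca2]])
    then show ?thesis by (simp only: veq)
  qed
  have PP: "AE x in lborel. P_X (P_X (?v b a)) x = - ?v b2 a2 x"
    by (rule P_X_P_X_AE[OF dv[OF b(1) a(1)] dv[OF b(2) a(2)] cv])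
  have sob: "?v b a \<in> sobolev 2"
    by (rule sobolev_2I[OF dv[OF b(1) a(1)] dv[OF b(2) a(2)] cv iv[OF L2(2,1) cb(1) ca(1)] iv[OF ib1 ia1 cb(2) ca(2)] iv[OF ib2 ia2 cb2 ca2]])
  have cva: "continuous_on UNIV (?v b a)"
    using dv[OF b(1) a(1)] by (meson continuous_at_imp_continuous_on has_vector_derivative_continuous)
  have "\<not> (AE x in lborel. ?v b a x = 0)"
  proof
    assume "AE x in lborel. ?v b a x = 0"
    then have "?v b a x0 = 0" by (rule AE_zero_continuous[OF cva])
    then have "k * b x0 + (1/2) * a x0 = 0" "k * b x0 + (-1/2) * a x0 = 0"
      by (simp_all add: vec_eq_iff forall_2)
    \<comment> \<open>The difference of the two components is \<open>a\<close>, which is nonzero at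
      \<open>x0\<close>.\<close>
    then have "(k * b x0 + (1/2) * a x0) - (k * b x0 + (-1/2) * a x0) = 0" by simp
    then show False using nz by (simp add: algebra_simps)
  qed
  moreover have "AE x in lborel. \<SS> 1 \<alpha>1 \<alpha>2 \<theta> chi 0 (?v b a) x = complex_of_real \<Omega> *s ?v b a x"
    using PP
  proof eventually_elim
    case (elim x)
    let ?\<alpha> = "complex_of_real \<alpha>2" and ?t = "complex_of_real \<theta>" and ?w = "complex_of_real \<Omega>" and ?x = "complex_of_real (chi x)"
    have \<alpha>: "?\<alpha> \<noteq> 0" "?w \<noteq> 0" using assms by auto
    have l: "complex_of_real l = ?w\<^sup>2 / ?\<alpha>\<^sup>2"
    proof -
      have "l = \<Omega>\<^sup>2 / \<alpha>2\<^sup>2" using assms by simp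
      then show ?thesis by simp
    qed
    have kk: "k = - \<i> * ?\<alpha> / (2 * ?w)" by (simp add: k_def)
    have A: "a2 x = ?t / ?\<alpha> * ?x * \<i> * a x - b x" by (simp add: a2 scaleR_conv_of_real)
    have B: "b2 x = - (?t / ?\<alpha> * ?x * \<i> * b x) - ?w\<^sup>2 / ?\<alpha>\<^sup>2 * a x" by (simp add: b2 scaleR_conv_of_real l)
    \<comment> \<open>\<open>e1\<close> and \<open>e2\<close> are the two rows of the eigenvalue
      equation after inserting the values of a'' and b''.\<close>
    have e1: "?t * (?x * (k * b x + a x / 2)) - ?\<alpha> * (\<i> * (k * b2 x - a2 x / 2)) = ?w * (k * b x + a x / 2)"
      unfolding kk A B using \<alpha> by (simp add: field_simps power2_eq_square)
    have e2: "?t * (?x * (a x / 2 - k * b x)) + ?\<alpha> * (\<i> * (k * b2 x + a2 x / 2)) = ?w * (k * b x - a x / 2)"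
      unfolding kk A B using \<alpha> by (simp add: field_simps power2_eq_square)
    show ?case
      unfolding \<SS>_at_zero elim
      using e1 e2
      by (simp add: vec_eq_iff forall_2 \<sigma>2_def \<sigma>3_def matrix_vector_mult_def sum_2 mult.assoc)
  qed
  ultimately show ?thesis
    unfolding eigenvalue_on_def using sob by (intro bexI[of _ "?v b a"] conjI)
qed

theorem theorem7p5:
  fixes \<alpha>1 \<alpha>2 \<theta> :: real and chi :: "real \<Rightarrow> real"
  assumes "\<alpha>1 \<noteq> 0" and "\<alpha>2 \<noteq> 0" and "\<theta> \<noteq> 0"
    and "smooth chi"
    and "((\<lambda>X. (chi X)\<^sup>2) \<longlongrightarrow> 1) at_infinity"
    and "integrable lborel (\<lambda>X. (chi X)\<^sup>2 - 1)"
    and "(LINT X|lborel. ((chi X)\<^sup>2 - 1)) < 0"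
  shows "\<exists>\<Omega>p \<Omega>m :: real. 0 < \<Omega>p \<and> \<Omega>m = - \<Omega>p
    \<and> \<Omega>p \<in> {- \<bar>\<theta>\<bar> <..< \<bar>\<theta>\<bar>} \<and> \<Omega>m \<in> {- \<bar>\<theta>\<bar> <..< \<bar>\<theta>\<bar>}
    \<and> eigenvalue_on (sobolev 2) (\<SS> 1 \<alpha>1 \<alpha>2 \<theta> chi 0) (complex_of_real \<Omega>p)
    \<and> eigenvalue_on (sobolev 2) (\<SS> 1 \<alpha>1 \<alpha>2 \<theta> chi 0) (complex_of_real \<Omega>m)"
proof -
  have sm: "(deriv ^^ n) chi differentiable (at x)" for n x
    using assms(4) unfolding smooth_def by blast
  have d: "((deriv ^^ n) chi has_real_derivative (deriv ^^ Suc n) chi x) (at x)" for n x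
    using sm[of n x] by (simp add: DERIV_deriv_iff_real_differentiable)
  interpret wall "\<theta> / \<alpha>2" chi "(deriv ^^ Suc 0) chi" "(deriv ^^ Suc (Suc 0)) chi"
  proof
    show "\<theta> / \<alpha>2 \<noteq> 0" using assms by simp
    show "(chi has_real_derivative (deriv ^^ Suc 0) chi x) (at x)" for x using d[of 0 x] by simp
    show "((deriv ^^ Suc 0) chi has_real_derivative (deriv ^^ Suc (Suc 0)) chi x) (at x)" for x by (rule d)
    show "continuous_on UNIV ((deriv ^^ Suc (Suc 0)) chi)"
      using sm[of "Suc (Suc 0)"] by (simp add: continuous_on_eq_continuous_at differentiable_imp_continuous_within del: funpow.simps)
  qed (rule assms(5))
  obtain a a1 a2 b b1 b2 l where s:
    "\<And>x. (a has_vector_derivative a1 x) (at x)" "\<And>x. (a1 has_vector_derivative a2 x) (at x)"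
    "\<And>x. (b has_vector_derivative b1 x) (at x)" "\<And>x. (b1 has_vector_derivative b2 x) (at x)"
    "\<And>x. a2 x = (\<theta> / \<alpha>2 * chi x) *\<^sub>R (\<i> * a x) - b x"
    "\<And>x. b2 x = - ((\<theta> / \<alpha>2 * chi x) *\<^sub>R (\<i> * b x)) - l *\<^sub>R a x"
    and l: "0 < l" "l < (\<theta> / \<alpha>2)\<^sup>2" and nz: "\<exists>x. a x \<noteq> 0"
    and L2: "integrable lborel (\<lambda>x. a x \<bullet> a x)" "integrable lborel (\<lambda>x. b x \<bullet> b x)"
    by (rule eigenpair[OF assms(6,7)]) blast
  obtain x0 where x0: "a x0 \<noteq> 0" using nz by blast
  obtain M where M: "\<And>x. \<bar>chi x\<bar> \<le> M" using chi_bounded by blast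
  \<comment> \<open>With c = \<theta> / \<alpha>2, the bound l < c^2 says exactly that w lies below
    the gap edge |\<theta>|.\<close>
  define w where "w = \<bar>\<alpha>2\<bar> * sqrt l"
  have w0: "0 < w" using assms(2) l by (simp add: w_def)
  have w2: "w\<^sup>2 = \<alpha>2\<^sup>2 * l" using l by (simp add: w_def power_mult_distrib)
  have "w\<^sup>2 < \<theta>\<^sup>2"
    unfolding w2 using l(2) assms(2) by (simp add: power_divide field_simps)
  then have wt: "w < \<bar>\<theta>\<bar>" using power2_less_imp_less[of w "\<bar>\<theta>\<bar>"] by simp
  have ev: "eigenvalue_on (sobolev 2) (\<SS> 1 \<alpha>1 \<alpha>2 \<theta> chi 0) (complex_of_real \<Omega>)" if "\<Omega> \<noteq> 0" "\<Omega>\<^sup>2 = w\<^sup>2" for \<Omega>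
    by (rule eigenvalue_from_pair[OF assms(2) that(1) _ chi_cont(1) M s x0 L2]) (use that w2 in simp)
  show ?thesis
    using w0 wt ev[of w] ev[of "- w"] by (intro exI[of _ w] exI[of _ "- w"]) auto
qed

end
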